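(* If a finitely generated group $G$ admits, over a finite symmetric generating set $A$, a quasi-geodesic language of simple word normal forms satisfying a $K$-fellow traveler property, then $G$ (with the presentation $\langle A\mid R\rangle$, where $R$ is the set of all nonempty words over $A$ of length at most $2K+2$ representing the identity) satisfies linear intrinsic and extrinsic tame filling inequalities, i.e. tame filling inequalities for linear functions.
   Context: Conventions. $\mathbb N$ includes $0$, and $\mathbb N[\frac14]$ is the set of nonnegative integer multiples of $\frac14$; a linear function is one bounded by $n\mapsto Cn+C$ for a constant $C$. $A$ is inverse-closed and no element of $A$ represents the identity $\epsilon$; $A^*$ is the set of words over $A$, $l(w)$ is word length; $=_G$ denotes equality in $G$. $\Gamma$ is the Cayley graph with path metric $d_\Gamma$. Normal forms $\mathcal N=\{y_g\mid g\in G\}\subseteq A^*$ contain exactly one word $y_g$ representing each $g\in G$. A simple word is one labeling a path in $\Gamma$ that repeats no vertices or edges. $K$-fellow traveler property ($K\ge1$ an integer constant): whenever $g,h\in G$, $a\in A$, $ga=_Gh$, and $y_g=a_1\cdots a_m$, $y_h=b_1\cdots b_n$ with $a_i,b_i\in A$ and (without loss of generality) $m\le n$, then $d_\Gamma(a_1\cdots a_i,b_1\cdots b_i)\le K$ for $1\le i\le m$ and $d_\Gamma(g,b_1\cdots b_i)\le K$ for $m<i\le n$. The language is quasi-geodesic if there are constants $\lambda,\lambda'\ge1$ such that every $y\in\mathcal N$ is a $(\lambda,\lambda')$-quasi-geodesic: whenever $y=y_1y_2y_3$, $l(y_2)\le\lambda d_\Gamma(\epsilon,y_2)+\lambda'$.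 Under the fellow traveler property, $\langle A\mid R\rangle$ is a finite presentation of $G$. $X$ is its Cayley 2-complex. Tame filling inequalities. A van Kampen diagram over $\langle A\mid R\rangle$ for $w\in A^*$ with $w=_G\epsilon$ is a finite, planar, contractible combinatorial 2-complex $\Delta$ with edges directed and labeled by $A$, whose boundary is an edge path labeled $w$ starting at a basepoint vertex $*$ and reading counterclockwise, every 2-cell having boundary labeled by an element of $R$ (not necessarily reduced). $\pi_\Delta:\Delta\to X$ is the canonical cellular map with $\pi_\Delta( * )=\epsilon$ preserving labels and directions. Coarse distance: for a combinatorial 2-complex $Y$ with basepoint vertex $y$ and $p\in Y$: $\tilde d_Y(y,p)$ is the path metric distance in $Y^1$ if $p$ is a vertex; $\min\{\tilde d_Y(y,v)\mid v\in\partial e\}+\frac12$ if $p$ is in the interior of an edge $e$; and $\max\{\tilde d_Y(y,q)\mid q\in Int(e),\ e\text{ an edge of }\partial\sigma\}-\frac14$ if $p$ is in the interior of a 2-cell $\sigma$. A van Kampen homotopy of $\Delta$ is a continuous $\Psi:\partial\Delta\times[0,1]\to\Delta$ with $\Psi(p,0)=*$, $\Psi(p,1)=p$ for $p\in\partial\Delta$; $\Psi( *,t)=*$ for all $t$; and $\Psi(p,t)\in\Delta^1$ for all $t$ if $p$ is a vertex of $\partial\Delta$. The group with finite presentation satisfies an intrinsic [resp. extrinsic] tame filling inequality for a nondecreasing $f:\mathbb N[\frac14]\to\mathbb N[\frac14]$ if every $w\in A^*$ with $w=_G\epsilon$ has a van Kampen diagram $\Delta$ and van Kampen homotopy $\Psi$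 such that for all $p\in\partial\Delta$, $0\le s<t\le1$: $\tilde d_\Delta( *,\Psi(p,s))\le f(\tilde d_\Delta( *,\Psi(p,t)))$ [resp. $\tilde d_X(\epsilon,\pi_\Delta(\Psi(p,s)))\le f(\tilde d_X(\epsilon,\pi_\Delta(\Psi(p,t))))$]. *)

theory Defs
  imports "HOL-Complex_Analysis.Winding_Numbers" "HOL-Algebra.Generated_Groups"
begin

section \<open>Combinatorial 2-complexes and coarse distance\<close>

text \<open>
  Edges carry both orientations: every geometric edge occurs as two oriented edges, which are
  exchanged by \<open>flip\<close>. The attaching map of a 2-cell is recorded as a closed edge path \<open>bdry\<close>.
\<close>

record ('v, 'e, 'f) complex2 =
  verts :: "'v set"
  edges :: "'e set"
  src :: "'e \<Rightarrow> 'v"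
  flip :: "'e \<Rightarrow> 'e"
  faces :: "'f set"
  bdry :: "'f \<Rightarrow> 'e list"

datatype ('v, 'e, 'f) cell = Vertex 'v | Edge 'e | Face 'f

definition cells :: "('v, 'e, 'f, 'z) complex2_scheme \<Rightarrow> ('v, 'e, 'f) cell set" where
  "cells Y = Vertex ` verts Y \<union> Edge ` edges Y \<union> Face ` faces Y"

abbreviation tgt :: "('v, 'e, 'f, 'z) complex2_scheme \<Rightarrow> 'e \<Rightarrow> 'v" where
  "tgt Y e \<equiv> src Y (flip Y e)"

primrec edge_path :: "('v, 'e, 'f, 'z) complex2_scheme \<Rightarrow> 'v \<Rightarrow> 'e list \<Rightarrow> 'v \<Rightarrow> bool" where
  "edge_path Y x [] y \<longleftrightarrow> x \<in> verts Y \<and> x = y"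
| "edge_path Y x (e # p) y \<longleftrightarrow> e \<in> edges Y \<and> src Y e = x \<and> edge_path Y (tgt Y e) p y"

definition path_dist :: "('v, 'e, 'f, 'z) complex2_scheme \<Rightarrow> 'v \<Rightarrow> 'v \<Rightarrow> nat" where
  "path_dist Y x y = (LEAST n. \<exists>p. edge_path Y x p y \<and> length p = n)"

text \<open>The coarse distance is constant on open cells, so it is defined on cells.\<close>

definition edge_coarse_dist :: "('v, 'e, 'f, 'z) complex2_scheme \<Rightarrow> 'v \<Rightarrow> 'e \<Rightarrow> real" where
  "edge_coarse_dist Y y e =
     min (real (path_dist Y y (src Y e))) (real (path_dist Y y (tgt Y e))) + 1/2"

primrec coarse_dist ::
    "('v, 'e, 'f, 'z) complex2_scheme \<Rightarrow> 'v \<Rightarrow> ('v, 'e, 'f) cell \<Rightarrow> real" where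
  "coarse_dist Y y (Vertex v) = real (path_dist Y y v)"
| "coarse_dist Y y (Edge e) = edge_coarse_dist Y y e"
| "coarse_dist Y y (Face \<sigma>) = Max (edge_coarse_dist Y y ` set (bdry Y \<sigma>)) - 1/4"


section \<open>Words, Cayley complexes and normal forms\<close>

text \<open>
  The generating set \<open>A\<close> is a subset of the group, and words over \<open>A\<close> are elements of \<open>lists A\<close>.
\<close>

definition word_val :: "('g, 'b) monoid_scheme \<Rightarrow> 'g list \<Rightarrow> 'g" where
  "word_val G w = foldr (mult G) w \<one>\<^bsub>G\<^esub>"

text \<open>
  The oriented edge \<open>(g, a)\<close> runs from \<open>g\<close> to \<open>g \<otimes> a\<close>, and \<open>word_path G g w\<close> is the path labeled \<open>w\<close>
  starting at \<open>g\<close>. The two edges \<open>(g, a)\<close> and \<open>(g \<otimes> a, inv a)\<close> are the two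
  orientations of one geometric edge.
\<close>

primrec word_path :: "('g, 'b) monoid_scheme \<Rightarrow> 'g \<Rightarrow> 'g list \<Rightarrow> ('g \<times> 'g) list" where
  "word_path G g [] = []"
| "word_path G g (a # w) = (g, a) # word_path G (g \<otimes>\<^bsub>G\<^esub> a) w"

definition cayley_complex ::
    "('g, 'b) monoid_scheme \<Rightarrow> 'g set \<Rightarrow> 'g list set
     \<Rightarrow> ('g, 'g \<times> 'g, 'g \<times> 'g list) complex2" where
  "cayley_complex G A R =
     \<lparr> verts = carrier G,
       edges = carrier G \<times> A,
       src = fst,
       flip = (\<lambda>(g, a). (g \<otimes>\<^bsub>G\<^esub> a, inv\<^bsub>G\<^esub> a)),
       faces = carrier G \<times> R,
       bdry = (\<lambda>(g, r). word_path G g r) \<rparr>"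

abbreviation cayley_graph ::
    "('g, 'b) monoid_scheme \<Rightarrow> 'g set \<Rightarrow> ('g, 'g \<times> 'g, 'g \<times> 'g list) complex2" where
  "cayley_graph G A \<equiv> cayley_complex G A {}"

abbreviation cayley_dist :: "('g, 'b) monoid_scheme \<Rightarrow> 'g set \<Rightarrow> 'g \<Rightarrow> 'g \<Rightarrow> nat" where
  "cayley_dist G A \<equiv> path_dist (cayley_graph G A)"

definition symmetric_generating_set :: "('g, 'b) monoid_scheme \<Rightarrow> 'g set \<Rightarrow> bool" where
  "symmetric_generating_set G A \<longleftrightarrow>
     A \<subseteq> carrier G \<and> generate G A = carrier G \<and>
     (\<forall>a\<in>A. inv\<^bsub>G\<^esub> a \<in> A) \<and> \<one>\<^bsub>G\<^esub> \<notin> A"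

definition normal_forms :: "('g, 'b) monoid_scheme \<Rightarrow> 'g set \<Rightarrow> 'g list set \<Rightarrow> bool" where
  "normal_forms G A N \<longleftrightarrow>
     N \<subseteq> lists A \<and> (\<forall>g\<in>carrier G. \<exists>!y. y \<in> N \<and> word_val G y = g)"

definition simple_word :: "('g, 'b) monoid_scheme \<Rightarrow> 'g set \<Rightarrow> 'g list \<Rightarrow> bool" where
  "simple_word G A w \<longleftrightarrow>
     (let p = word_path G \<one>\<^bsub>G\<^esub> w in
        distinct (map (src (cayley_graph G A)) p @ [word_val G w]) \<and>
        distinct (map (\<lambda>e. {e, flip (cayley_graph G A) e}) p))"

definition quasi_geodesic_language :: "('g, 'b) monoid_scheme \<Rightarrow> 'g set \<Rightarrow> 'g list set \<Rightarrow> bool" where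
  "quasi_geodesic_language G A N \<longleftrightarrow>
     (\<exists>(l::real) (l'::real). l \<ge> 1 \<and> l' \<ge> 1 \<and>
        (\<forall>y1 y2 y3. y1 @ y2 @ y3 \<in> N \<longrightarrow>
           real (length y2) \<le> l * real (cayley_dist G A \<one>\<^bsub>G\<^esub> (word_val G y2)) + l'))"

text \<open>
  Here \<open>u\<close> and \<open>v\<close> are the normal forms of \<open>g\<close> and \<open>h\<close>. Only the case
  \<open>length u \<le> length v\<close> is listed: the other one is the instance for \<open>v\<close>, \<open>u\<close> and \<open>inv a\<close>.
\<close>

definition fellow_traveler ::
    "('g, 'b) monoid_scheme \<Rightarrow> 'g set \<Rightarrow> 'g list set \<Rightarrow> nat \<Rightarrow> bool" where
  "fellow_traveler G A N K \<longleftrightarrow>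
     (\<forall>u\<in>N. \<forall>v\<in>N. \<forall>a\<in>A.
        word_val G u \<otimes>\<^bsub>G\<^esub> a = word_val G v \<and> length u \<le> length v \<longrightarrow>
          (\<forall>i. 1 \<le> i \<and> i \<le> length u \<longrightarrow>
             cayley_dist G A (word_val G (take i u)) (word_val G (take i v)) \<le> K) \<and>
          (\<forall>i. length u < i \<and> i \<le> length v \<longrightarrow>
             cayley_dist G A (word_val G u) (word_val G (take i v)) \<le> K))"

definition short_relators :: "('g, 'b) monoid_scheme \<Rightarrow> 'g set \<Rightarrow> nat \<Rightarrow> 'g list set" where
  "short_relators G A K =
     {r \<in> lists A. r \<noteq> [] \<and> length r \<le> 2 * K + 2 \<and> word_val G r = \<one>\<^bsub>G\<^esub>}"

text \<open>
  \<open>\<langle>A | R\<rangle>\<close> presents \<open>G\<close> if two words have the same value exactly when they are connected by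
  insertions and deletions of relators and of subwords \<open>a a\<inverse>\<close>.
\<close>

inductive relator_deletion ::
    "('g, 'b) monoid_scheme \<Rightarrow> 'g set \<Rightarrow> 'g list set \<Rightarrow> 'g list \<Rightarrow> 'g list \<Rightarrow> bool"
  for G A R where
  relator: "u \<in> lists A \<Longrightarrow> v \<in> lists A \<Longrightarrow> r \<in> R \<Longrightarrow> relator_deletion G A R (u @ r @ v) (u @ v)"
| cancel: "u \<in> lists A \<Longrightarrow> v \<in> lists A \<Longrightarrow> a \<in> A \<Longrightarrow>
     relator_deletion G A R (u @ [a, inv\<^bsub>G\<^esub> a] @ v) (u @ v)"

definition finite_presentation ::
    "('g, 'b) monoid_scheme \<Rightarrow> 'g set \<Rightarrow> 'g list set \<Rightarrow> bool" where
  "finite_presentation G A R \<longleftrightarrow>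
     finite A \<and> symmetric_generating_set G A \<and> finite R \<and> R \<subseteq> lists A \<and>
     (\<forall>u\<in>lists A. \<forall>v\<in>lists A.
        word_val G u = word_val G v \<longleftrightarrow> equivclp (relator_deletion G A R) u v)"


section \<open>Van Kampen diagrams\<close>

text \<open>
  A diagram is a 2-complex embedded in the plane \<open>\<complex>\<close>: vertices are points, oriented edges are
  parametrized simple paths (possibly closed), orientation reversal is \<open>reversepath\<close>, and 2-cells
  are characteristic maps defined on the closed unit disk. The label of an edge read backwards is
  the inverse of its label.
\<close>

record 'g diagram = "(complex, real \<Rightarrow> complex, complex \<Rightarrow> complex) complex2" +
  label :: "(real \<Rightarrow> complex) \<Rightarrow> 'g"
  base :: complex

primrec open_cell :: "(complex, real \<Rightarrow> complex, complex \<Rightarrow> complex) cell \<Rightarrow> complex set" where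
  "open_cell (Vertex v) = {v}"
| "open_cell (Edge e) = e ` {0<..<1}"
| "open_cell (Face \<sigma>) = \<sigma> ` ball 0 1"

definition support :: "'g diagram \<Rightarrow> complex set" where
  "support \<Delta> = (\<Union>c\<in>cells \<Delta>. open_cell c)"

definition skeleton1 :: "'g diagram \<Rightarrow> complex set" where
  "skeleton1 \<Delta> = verts \<Delta> \<union> (\<Union>e\<in>edges \<Delta>. path_image e)"

text \<open>
  \<open>h\<close> restricted to the unit circle, run through counterclockwise from 1, is the edge path \<open>p\<close>
  starting at \<open>x\<close>, the \<open>k\<close>-th of the equal arcs being mapped to the \<open>k\<close>-th edge.
\<close>

definition traverses :: "(complex \<Rightarrow> complex) \<Rightarrow> complex \<Rightarrow> (real \<Rightarrow> complex) list \<Rightarrow> bool" where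
  "traverses h x p \<longleftrightarrow>
     (if p = [] then \<forall>z\<in>sphere 0 1. h z = x
      else h 1 = x \<and>
        (\<forall>k<length p. \<forall>t\<in>{0..1}.
           h (cis (2 * pi * (real k + t) / real (length p))) = (p ! k) t))"

definition planar_complex :: "'g diagram \<Rightarrow> bool" where
  "planar_complex \<Delta> \<longleftrightarrow>
     finite (verts \<Delta>) \<and> finite (edges \<Delta>) \<and> finite (faces \<Delta>) \<and>
     src \<Delta> = pathstart \<and> flip \<Delta> = reversepath \<and>
     (\<forall>e\<in>edges \<Delta>. simple_path e \<and> reversepath e \<in> edges \<Delta> \<and> pathstart e \<in> verts \<Delta>) \<and>
     (\<forall>\<sigma>\<in>faces \<Delta>. continuous_on (cball 0 1) \<sigma> \<and> inj_on \<sigma> (ball 0 1) \<and>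
        bdry \<Delta> \<sigma> \<noteq> [] \<and> set (bdry \<Delta> \<sigma>) \<subseteq> edges \<Delta> \<and> traverses \<sigma> (\<sigma> 1) (bdry \<Delta> \<sigma>)) \<and>
     (\<forall>c\<in>cells \<Delta>. \<forall>c'\<in>cells \<Delta>. open_cell c \<inter> open_cell c' \<noteq> {} \<longrightarrow>
        c = c' \<or> (\<exists>e. c = Edge e \<and> c' = Edge (reversepath e)))"

text \<open>
  The boundary path of a contractible planar complex is the attaching map of the complementary
  2-cell of the sphere: \<open>\<Omega>\<close> maps the exterior of the closed unit disk homeomorphically onto the
  complement of the diagram, and extends continuously to the unit circle, where it traverses the
  boundary path. That \<open>\<Omega>\<close> preserves orientation, so that the path is read counterclockwise, is
  expressed by a winding number around the base point. This covers diagrams that are not disks,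
  whose boundary paths pass repeatedly through some vertices or edges.
\<close>

definition boundary_path :: "'g diagram \<Rightarrow> (real \<Rightarrow> complex) list \<Rightarrow> bool" where
  "boundary_path \<Delta> p \<longleftrightarrow>
     set p \<subseteq> edges \<Delta> \<and>
     (\<exists>\<Omega>. continuous_on {z. 1 \<le> norm z} \<Omega> \<and>
          inj_on \<Omega> {z. 1 < norm z} \<and>
          \<Omega> ` {z. 1 < norm z} = - support \<Delta> \<and>
          traverses \<Omega> (base \<Delta>) p \<and>
          winding_number (\<Omega> \<circ> circlepath 0 2) (base \<Delta>) = 1)"

definition van_kampen_diagram ::
    "('g, 'b) monoid_scheme \<Rightarrow> 'g set \<Rightarrow> 'g list set \<Rightarrow> 'g list \<Rightarrow> 'g diagram \<Rightarrow> bool" where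
  "van_kampen_diagram G A R w \<Delta> \<longleftrightarrow>
     planar_complex \<Delta> \<and> contractible (support \<Delta>) \<and> base \<Delta> \<in> verts \<Delta> \<and>
     (\<forall>e\<in>edges \<Delta>. label \<Delta> e \<in> A \<and> label \<Delta> (reversepath e) = inv\<^bsub>G\<^esub> (label \<Delta> e)) \<and>
     (\<forall>\<sigma>\<in>faces \<Delta>. map (label \<Delta>) (bdry \<Delta> \<sigma>) \<in> R) \<and>
     (\<exists>p. boundary_path \<Delta> p \<and> map (label \<Delta>) p = w)"

text \<open>
  The open cell containing a point. An open edge carries two oriented edges; the choice between
  them does not affect coarse distances.
\<close>

definition cell_of ::
    "'g diagram \<Rightarrow> complex \<Rightarrow> (complex, real \<Rightarrow> complex, complex \<Rightarrow> complex) cell" where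
  "cell_of \<Delta> p = (SOME c. c \<in> cells \<Delta> \<and> p \<in> open_cell c)"

text \<open>
  The canonical map to the Cayley complex, on cells. A vertex is sent to the value of the label of
  any edge path from the base point to it. Distinct 2-cells of the Cayley complex may have the same
  boundary circuit (relators that are cyclic conjugates or inverses of each other); the one chosen
  here, given by the starting point and direction of \<open>bdry\<close>, has the same coarse distance as the
  others.
\<close>

definition proj_vertex :: "('g, 'b) monoid_scheme \<Rightarrow> 'g diagram \<Rightarrow> complex \<Rightarrow> 'g" where
  "proj_vertex G \<Delta> v =
     (THE g. \<exists>p. edge_path \<Delta> (base \<Delta>) p v \<and> word_val G (map (label \<Delta>) p) = g)"

primrec proj_cell ::
    "('g, 'b) monoid_scheme \<Rightarrow> 'g diagram \<Rightarrow> (complex, real \<Rightarrow> complex, complex \<Rightarrow> complex) cell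
     \<Rightarrow> ('g, 'g \<times> 'g, 'g \<times> 'g list) cell" where
  "proj_cell G \<Delta> (Vertex v) = Vertex (proj_vertex G \<Delta> v)"
| "proj_cell G \<Delta> (Edge e) = Edge (proj_vertex G \<Delta> (src \<Delta> e), label \<Delta> e)"
| "proj_cell G \<Delta> (Face \<sigma>) =
     Face (proj_vertex G \<Delta> (src \<Delta> (hd (bdry \<Delta> \<sigma>))), map (label \<Delta>) (bdry \<Delta> \<sigma>))"

definition intrinsic_dist :: "'g diagram \<Rightarrow> complex \<Rightarrow> real" where
  "intrinsic_dist \<Delta> p = coarse_dist \<Delta> (base \<Delta>) (cell_of \<Delta> p)"

definition extrinsic_dist ::
    "('g, 'b) monoid_scheme \<Rightarrow> 'g set \<Rightarrow> 'g list set \<Rightarrow> 'g diagram \<Rightarrow> complex \<Rightarrow> real" where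
  "extrinsic_dist G A R \<Delta> p =
     coarse_dist (cayley_complex G A R) \<one>\<^bsub>G\<^esub> (proj_cell G \<Delta> (cell_of \<Delta> p))"


section \<open>Tame filling inequalities\<close>

definition van_kampen_homotopy :: "'g diagram \<Rightarrow> (complex \<times> real \<Rightarrow> complex) \<Rightarrow> bool" where
  "van_kampen_homotopy \<Delta> \<Psi> \<longleftrightarrow>
     continuous_on (frontier (support \<Delta>) \<times> {0..1}) \<Psi> \<and>
     \<Psi> ` (frontier (support \<Delta>) \<times> {0..1}) \<subseteq> support \<Delta> \<and>
     (\<forall>p\<in>frontier (support \<Delta>). \<Psi> (p, 0) = base \<Delta> \<and> \<Psi> (p, 1) = p) \<and>
     (\<forall>t\<in>{0..1}. \<Psi> (base \<Delta>, t) = base \<Delta>) \<and>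
     (\<forall>p\<in>frontier (support \<Delta>) \<inter> verts \<Delta>. \<forall>t\<in>{0..1}. \<Psi> (p, t) \<in> skeleton1 \<Delta>)"

definition quarter_nats :: "real set" where
  "quarter_nats = (\<lambda>n. real n / 4) ` UNIV"

text \<open>Functions on \<open>quarter_nats\<close> are represented by functions on the reals.\<close>

definition filling_function :: "(real \<Rightarrow> real) \<Rightarrow> bool" where
  "filling_function f \<longleftrightarrow> f ` quarter_nats \<subseteq> quarter_nats \<and> mono_on quarter_nats f"

definition linear_function :: "(real \<Rightarrow> real) \<Rightarrow> bool" where
  "linear_function f \<longleftrightarrow> (\<exists>C. \<forall>n\<in>quarter_nats. f n \<le> C * n + C)"

definition tame_along ::
    "'g diagram \<Rightarrow> (complex \<times> real \<Rightarrow> complex) \<Rightarrow> (complex \<Rightarrow> real) \<Rightarrow> (real \<Rightarrow> real) \<Rightarrow> bool" where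
  "tame_along \<Delta> \<Psi> d f \<longleftrightarrow>
     (\<forall>p\<in>frontier (support \<Delta>). \<forall>s t. 0 \<le> s \<and> s < t \<and> t \<le> 1 \<longrightarrow>
        d (\<Psi> (p, s)) \<le> f (d (\<Psi> (p, t))))"

definition intrinsic_tame_filling ::
    "('g, 'b) monoid_scheme \<Rightarrow> 'g set \<Rightarrow> 'g list set \<Rightarrow> (real \<Rightarrow> real) \<Rightarrow> bool" where
  "intrinsic_tame_filling G A R f \<longleftrightarrow>
     finite_presentation G A R \<and> filling_function f \<and>
     (\<forall>w\<in>lists A. word_val G w = \<one>\<^bsub>G\<^esub> \<longrightarrow>
        (\<exists>\<Delta> \<Psi>. van_kampen_diagram G A R w \<Delta> \<and> van_kampen_homotopy \<Delta> \<Psi> \<and>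
                tame_along \<Delta> \<Psi> (intrinsic_dist \<Delta>) f))"

definition extrinsic_tame_filling ::
    "('g, 'b) monoid_scheme \<Rightarrow> 'g set \<Rightarrow> 'g list set \<Rightarrow> (real \<Rightarrow> real) \<Rightarrow> bool" where
  "extrinsic_tame_filling G A R f \<longleftrightarrow>
     finite_presentation G A R \<and> filling_function f \<and>
     (\<forall>w\<in>lists A. word_val G w = \<one>\<^bsub>G\<^esub> \<longrightarrow>
        (\<exists>\<Delta> \<Psi>. van_kampen_diagram G A R w \<Delta> \<and> van_kampen_homotopy \<Delta> \<Psi> \<and>
                tame_along \<Delta> \<Psi> (extrinsic_dist G A R \<Delta>) f))"

end

theory Submission
  imports Defs
begin

text \<open>
  Every word \<open>a a\<inverse>\<close> is a relator, so cells can always be glued along arcs containing at least one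
  edge, and every nonempty word representing the identity bounds a diagram that is a disc. The disc
  grows in polar coordinates: its boundary is a curve \<open>r = F t\<close>, and replacing a subword \<open>r\<close> by \<open>r'\<close>
  raises \<open>F\<close> by a bump. The homotopy of the larger disc first pushes the new arc across the new cell
  and then follows the old homotopy.

  Let \<open>u k i\<close> be the \<open>i\<close>-th vertex on the normal form of the \<open>k\<close>-th prefix of \<open>w\<close>. The level \<open>i\<close> word
  joins \<open>u 0 i, \<dots>, u n i\<close> by geodesics of length at most \<open>K\<close>; sweeping over the columns turns the
  level \<open>i\<close> word into the level \<open>i + 1\<close> word by cells of perimeter at most \<open>2 K + 2\<close>, and high levels
  are \<open>w\<close> itself. Points of a cell added at level \<open>i\<close> have intrinsic distance at most linear in \<open>i\<close>
  by construction and extrinsic distance at least linear in \<open>i\<close> by quasi-geodesicity, and levels do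
  not decrease along the homotopy tracks.
\<close>

section \<open>Polar coordinates\<close>

text \<open>A single inequality gives both fillings: the intrinsic distance at the earlier time is
  at most \<open>C\<close> times the extrinsic distance at the later time plus \<open>C\<close>, and
  extrinsic distances never exceed intrinsic ones. The lower bound by quasi-geodesicity is available
  only while a normal form is still running. Hence a column receives a cell at level
  \<open>i\<close> only if one of its two normal forms is longer than \<open>i\<close>; a finished
  column keeps its letter of \<open>w\<close>. The upper bound must grow per level, not per column.
  New vertices are therefore reached from the right end of their cell, which still lies on the
  previous level, or from the base point, and one level costs at most \<open>K + 2\<close>. Discs
  have nonempty boundary words, whereas geodesics between neighbouring normal forms may be empty. A
  cell with one empty side borrows an adjacent letter, and simplicity of the normal forms keeps the
  words of positive level nonempty. Level 0 is the empty word; a cancelling pair placed in front of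
  it starts the sweep.\<close>

definition pol :: "real \<Rightarrow> real \<Rightarrow> complex" where
  "pol r t = of_real r * cis (2 * pi * t)"

definition turn :: "complex \<Rightarrow> real" where
  "turn z = Arg2pi z / (2 * pi)"

lemma norm_pol [simp]: "norm (pol r t) = \<bar>r\<bar>"
  by (simp add: pol_def norm_mult)

lemma pol_zero [simp]: "pol 0 t = 0"
  by (simp add: pol_def)

lemma pol_at_0 [simp]: "pol r 0 = of_real r" and pol_at_1 [simp]: "pol r 1 = of_real r"
  by (simp_all add: pol_def)

lemma turn_bounds: "0 \<le> turn z" "turn z < 1" "turn z \<in> {0..1}"
  using Arg2pi_ge_0[of z] Arg2pi_lt_2pi[of z] by (auto simp: turn_def field_simps)

lemma turn_pol: "0 < r \<Longrightarrow> 0 \<le> t \<Longrightarrow> t < 1 \<Longrightarrow> turn (pol r t) = t"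
proof -
  assume "0 < r" "0 \<le> t" "t < 1"
  then have "Arg2pi (pol r t) = 2 * pi * t"
    by (intro Arg2pi_unique[of r]) (auto simp: pol_def cis_conv_exp)
  then show ?thesis by (simp add: turn_def)
qed

lemma pol_turn [simp]: "pol (norm z) (turn z) = z"
  using Arg2pi_eq[of z] by (simp add: pol_def turn_def cis_conv_exp)

lemma pol_eqD:
  assumes "pol r t = pol r' t'" "0 < r" "0 \<le> r'" "t \<in> {0..1}" "t' \<in> {0..1}"
  shows "r = r' \<and> (t = t' \<or> t = 0 \<and> t' = 1 \<or> t = 1 \<and> t' = 0)"
proof -
  have r: "r = r'" using arg_cong[OF assms(1), of norm] assms(2,3) by simp
  have *: "turn (pol r s) = (if s = 1 then 0 else s)" if "s \<in> {0..1}" for s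
  proof (cases "s = 1")
    case True
    have "turn (pol r 0) = 0" using assms(2) turn_pol[of r 0] by simp
    then show ?thesis using True by simp
  next
    case False
    then show ?thesis using that turn_pol[of r s] assms(2) by auto
  qed
  show ?thesis using r assms(1) *[OF assms(4)] *[OF assms(5)] by (auto split: if_splits)
qed

lemma continuous_on_pol [continuous_intros]:
  "continuous_on S f \<Longrightarrow> continuous_on S g \<Longrightarrow> continuous_on S (\<lambda>x. pol (f x) (g x))"
  unfolding pol_def by (intro continuous_intros)

text \<open>A continuous map from a compact space to a Hausdorff space is closed, hence a quotient
  map onto its image. This is how maps given in polar coordinates or along a boundary curve are seen
  to be continuous, although \<open>turn\<close> jumps at the positive real axis.\<close>

lemma continuous_on_compact_quotient:
  fixes q :: "'a::t2_space \<Rightarrow> 'b::t2_space" and f :: "'b \<Rightarrow> 'c::t2_space"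
  assumes "compact K" "continuous_on K q" "continuous_on K (\<lambda>x. f (q x))"
  shows "continuous_on (q ` K) f"
proof -
  have "\<exists>A. closed A \<and> A \<inter> q ` K = f -` C \<inter> q ` K" if "closed C" for C
  proof -
    obtain A where A: "closed A" "A \<inter> K = (\<lambda>x. f (q x)) -` C \<inter> K"
      using assms(3) \<open>closed C\<close> unfolding continuous_on_closed_invariant by blast
    have "compact (q ` (A \<inter> K))"
      by (intro compact_continuous_image continuous_on_subset[OF assms(2)] closed_Int_compact
          A(1) assms(1)) auto
    moreover have "q ` (A \<inter> K) \<inter> q ` K = f -` C \<inter> q ` K"
      unfolding A(2) by auto
    ultimately show ?thesis using compact_imp_closed by blast
  qed
  then show ?thesis unfolding continuous_on_closed_invariant by blast
qed

text \<open>A map on a rectangle of radii and angles descends to the annulus, or to the disc if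
  \<open>r0 = 0\<close>, once it respects the identifications made by polar coordinates: the angles
  0 and 1 agree, and at radius 0 all angles agree.\<close>

lemma polar_map:
  fixes f :: "real \<Rightarrow> real \<Rightarrow> 'a::t2_space"
  assumes cont: "continuous_on ({r0..r1} \<times> {0..1}) (\<lambda>(r, t). f r t)"
    and zero: "\<And>t. r0 = 0 \<Longrightarrow> t \<in> {0..1} \<Longrightarrow> f 0 t = f 0 0"
    and per: "\<And>r. r \<in> {r0..r1} \<Longrightarrow> f r 1 = f r 0" and "0 \<le> r0"
  shows "continuous_on {z. r0 \<le> norm z \<and> norm z \<le> r1} (\<lambda>z. f (norm z) (turn z))"
    and "\<And>r t. r \<in> {r0..r1} \<Longrightarrow> t \<in> {0..1} \<Longrightarrow> f (norm (pol r t)) (turn (pol r t)) = f r t"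
proof -
  show *: "f (norm (pol r t)) (turn (pol r t)) = f r t" if "r \<in> {r0..r1}" "t \<in> {0..1}" for r t
  proof (cases "r = 0")
    case True
    then have "r0 = 0" using that \<open>0 \<le> r0\<close> by auto
    then show ?thesis using True zero[OF _ turn_bounds(3)] zero[OF _ that(2)] by simp
  next
    case False
    then have r: "0 < r" "norm (pol r t) = r" using that \<open>0 \<le> r0\<close> by auto
    show ?thesis
    proof (cases "t = 1")
      case True
      have "turn (pol r t) = 0" using turn_pol[of r 0] r True by simp
      then show ?thesis using per[OF that(1)] True r by simp
    next
      case False
      then show ?thesis using turn_pol[of r t] r that by simp
    qed
  qed
  let ?q = "\<lambda>(r, t). pol r t" and ?K = "{r0..r1} \<times> {0..1::real}"
  have "continuous_on ?K (\<lambda>x. f (norm (?q x)) (turn (?q x)))"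
    using cont by (rule continuous_on_eq) (use * in auto)
  moreover have "continuous_on ?K ?q"
    by (auto simp: case_prod_unfold intro!: continuous_intros)
  ultimately have "continuous_on (?q ` ?K) (\<lambda>z. f (norm z) (turn z))"
    by (intro continuous_on_compact_quotient) (auto intro: compact_Times)
  moreover have "?q ` ?K = {z. r0 \<le> norm z \<and> norm z \<le> r1}"
  proof (intro equalityI subsetI)
    fix z :: complex assume "z \<in> {z. r0 \<le> norm z \<and> norm z \<le> r1}"
    then show "z \<in> ?q ` ?K"
      by (intro image_eqI[of _ _ "(norm z, turn z)"]) (use turn_bounds(3) in auto)
  qed (use \<open>0 \<le> r0\<close> in auto)
  ultimately show "continuous_on {z. r0 \<le> norm z \<and> norm z \<le> r1} (\<lambda>z. f (norm z) (turn z))"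
    by simp
qed

text \<open>The cone from an interior point over the frontier of a convex set is a characteristic map.\<close>

lemma convex_cone_map:
  fixes S :: "complex set" and \<gamma> :: "real \<Rightarrow> complex"
  assumes S: "convex S" "closed S" "z0 \<in> interior S"
    and \<gamma>: "continuous_on {0..1} \<gamma>" "\<gamma> ` {0..1} \<subseteq> frontier S" "\<gamma> 0 = \<gamma> 1" "inj_on \<gamma> {0..<1}"
  obtains \<sigma> where "continuous_on (cball 0 1) \<sigma>" "inj_on \<sigma> (ball 0 1)" "\<sigma> ` ball 0 1 = interior S"
    "\<sigma> ` cball 0 1 \<subseteq> S" "\<And>x. x \<in> {0..1} \<Longrightarrow> \<sigma> (cis (2 * pi * x)) = \<gamma> x"
proof -
  define f where "f = (\<lambda>r t. z0 + of_real r * (\<gamma> t - z0))"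
  define \<sigma> where "\<sigma> = (\<lambda>z. f (norm z) (turn z))"
  have cf: "continuous_on ({0..1} \<times> {0..1}) (\<lambda>(r, t). f r t)"
    unfolding f_def case_prod_unfold
    by (intro continuous_intros continuous_on_compose2[OF \<gamma>(1)]) auto
  note P = polar_map[of 0 1 f, OF cf]
  have cont: "continuous_on (cball 0 1) \<sigma>"
    using P(1) \<gamma>(3) by (simp add: \<sigma>_def f_def cball_def dist_norm)
  have \<sigma>_pol: "\<sigma> (pol r t) = f r t" if "r \<in> {0..1}" "t \<in> {0..1}" for r t
    using P(2) \<gamma>(3) that by (simp add: \<sigma>_def f_def)
  have fr: "\<gamma> t \<in> S" "\<gamma> t \<notin> interior S" if "t \<in> {0..1}" for t
    using \<gamma>(2) that S(2) unfolding frontier_def closure_closed[OF S(2)] by blast+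
  have f_int: "f r t \<in> interior S" if "0 \<le> r" "r < 1" "t \<in> {0..1}" for r t
  proof -
    have "f r t = \<gamma> t - (1 - r) *\<^sub>R (\<gamma> t - z0)"
      by (simp add: f_def scaleR_conv_of_real algebra_simps)
    then show ?thesis using mem_interior_convex_shrink[OF S(1,3) fr(1)[OF that(3)], of "1 - r"] that
      by simp
  qed
  have \<gamma>z0: "\<gamma> t \<noteq> z0" if "t \<in> {0..1}" for t using fr(2)[OF that] S(3) by auto
  have f_inj: "r \<le> r' \<Longrightarrow> f r t = f r' t' \<Longrightarrow> r = r' \<and> (r = 0 \<or> t = t')"
    if "0 \<le> r" "0 \<le> r'" "t \<in> {0..<1}" "t' \<in> {0..<1}" for r r' t t'
  proof -
    assume le: "r \<le> r'" and e: "f r t = f r' t'"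
    then have e': "of_real r * (\<gamma> t - z0) = of_real r' * (\<gamma> t' - z0)" by (simp add: f_def)
    show "r = r' \<and> (r = 0 \<or> t = t')"
    proof (cases "r' = 0")
      case True then show ?thesis using le that by auto
    next
      case False
      have "\<gamma> t' - z0 = of_real (r / r') * (\<gamma> t - z0)"
        using e' False by (simp add: field_simps)
      \<comment> \<open>For different radii the frontier point \<open>\<gamma> t'\<close> would lie
        on the segment from \<open>z0\<close> to \<open>\<gamma> t\<close> short of its end, hence
        in the interior.\<close>
      then have "\<gamma> t' = f (r / r') t" unfolding f_def by (metis add.commute diff_add_cancel)
      then have "\<not> r / r' < 1" using f_int[of "r / r'" t] fr(2)[of t'] that by auto
      then have "r = r'" using le that False by (simp add: field_simps)
      then have "\<gamma> t = \<gamma> t'" using e' False by simp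
      then show ?thesis using \<open>r = r'\<close> \<gamma>(4) that by (simp add: inj_on_def)
    qed
  qed
  have inj: "inj_on \<sigma> (ball 0 1)"
  proof (rule inj_onI)
    fix w z assume "w \<in> ball 0 1" "z \<in> ball 0 1" "\<sigma> w = \<sigma> z"
    then have "norm w = norm z \<and> (norm w = 0 \<or> turn w = turn z)"
      using f_inj[of "norm w" "norm z" "turn w" "turn z"] f_inj[of "norm z" "norm w" "turn z" "turn w"]
        turn_bounds[of w] turn_bounds[of z] unfolding \<sigma>_def
      by (cases "norm w \<le> norm z") auto
    then show "w = z" using pol_turn[of w] pol_turn[of z] by auto
  qed
  have ball_int: "\<sigma> ` ball 0 1 \<subseteq> interior S"
    using f_int turn_bounds(3) by (auto simp: \<sigma>_def)
  have cis: "\<sigma> (cis (2 * pi * x)) = \<gamma> x" if "x \<in> {0..1}" for x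
    using \<sigma>_pol[of 1 x] that by (simp add: f_def pol_def)
  have sph: "\<sigma> z \<in> frontier S" if "norm z = 1" for z
    using that \<gamma>(2) turn_bounds(3)[of z] by (auto simp: \<sigma>_def f_def)
  \<comment> \<open>Surjectivity onto the interior: the image of the open disc is open by invariance
    of domain, and relatively closed because the unit circle goes to the frontier; the interior is
    connected.\<close>
  have op: "open (\<sigma> ` ball 0 1)"
    by (intro invariance_of_domain inj continuous_on_subset[OF cont]) auto
  have eq: "\<sigma> ` ball 0 1 = \<sigma> ` cball 0 1 \<inter> interior S"
  proof (intro equalityI subsetI)
    fix y assume y: "y \<in> \<sigma> ` cball 0 1 \<inter> interior S"
    then obtain z where z: "norm z \<le> 1" "y = \<sigma> z" by auto
    then have "norm z \<noteq> 1" using sph[of z] y by (auto simp: frontier_def)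
    then show "y \<in> \<sigma> ` ball 0 1" using z by auto
  qed (use ball_int in auto)
  have cl: "closed (\<sigma> ` cball 0 1)"
    using compact_continuous_image[OF cont] compact_imp_closed by auto
  have "\<sigma> ` ball 0 1 = interior S"
  proof -
    have "connected (interior S)" using S(1) convex_connected convex_interior by blast
    moreover have "openin (top_of_set (interior S)) (\<sigma> ` ball 0 1)"
      using op ball_int by (simp add: open_subset)
    moreover have "closedin (top_of_set (interior S)) (\<sigma> ` ball 0 1)"
      using eq cl by (metis closedin_closed_Int inf_commute)
    ultimately show ?thesis unfolding connected_clopen by force
  qed
  moreover have "\<sigma> ` cball 0 1 \<subseteq> S"
  proof
    fix y assume "y \<in> \<sigma> ` cball 0 1"
    then obtain z where z: "norm z \<le> 1" "y = \<sigma> z" by auto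
    show "y \<in> S"
    proof (cases "norm z = 1")
      case True then show ?thesis using sph z S(2) by (auto simp: frontier_def)
    next
      case False
      then have "z \<in> ball 0 1" using z by auto
      then show ?thesis using ball_int z(2) interior_subset by blast
    qed
  qed
  ultimately show ?thesis using that cont inj cis by blast
qed

section \<open>Star-shaped planar regions\<close>

abbreviation curve :: "(real \<Rightarrow> real) \<Rightarrow> real \<Rightarrow> complex" where
  "curve F t \<equiv> pol (F t) t"

definition region :: "(real \<Rightarrow> real) \<Rightarrow> complex set" where
  "region F = {pol r t |r t. t \<in> {0..1} \<and> 0 \<le> r \<and> r \<le> F t}"

text \<open>Fixing the value 1 at the angles 0 and 1 keeps the base point of every diagram at the
  complex number 1 while the disc grows.\<close>

definition radial :: "(real \<Rightarrow> real) \<Rightarrow> bool" where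
  "radial F \<longleftrightarrow> continuous_on {0..1} F \<and> (\<forall>t\<in>{0..1}. 0 < F t) \<and> F 0 = 1 \<and> F 1 = 1"

lemma radialD:
  assumes "radial F"
  shows "continuous_on {0..1} F" "t \<in> {0..1} \<Longrightarrow> 0 < F t" "F 0 = 1" "F 1 = 1"
  using assms by (auto simp: radial_def)

lemma pol_in_region_iff:
  assumes "radial F" "t \<in> {0..1}" "0 \<le> r"
  shows "pol r t \<in> region F \<longleftrightarrow> r \<le> F t"
proof
  assume "pol r t \<in> region F"
  then obtain r' t' where *: "pol r t = pol r' t'" "t' \<in> {0..1}" "0 \<le> r'" "r' \<le> F t'"
    unfolding region_def by blast
  show "r \<le> F t"
  proof (cases "r = 0")
    case True then show ?thesis using radialD(2)[OF assms(1,2)] by simp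
  next
    case False
    then show ?thesis using pol_eqD[OF *(1)] * assms radialD[OF assms(1)] by auto
  qed
qed (use assms in \<open>auto simp: region_def\<close>)

lemma in_region_iff: "radial F \<Longrightarrow> z \<in> region F \<longleftrightarrow> norm z \<le> F (turn z)"
  using pol_in_region_iff[of F "turn z" "norm z"] turn_bounds(3) by simp

lemma starlike_region: "radial F \<Longrightarrow> starlike (region F)"
proof -
  assume F: "radial F"
  have "closed_segment 0 z \<subseteq> region F" if "z \<in> region F" for z
  proof
    fix w assume "w \<in> closed_segment 0 z"
    then obtain u where u: "w = u *\<^sub>R z" "0 \<le> u" "u \<le> 1" by (auto simp: in_segment)
    from that have "\<exists>r t. z = pol r t \<and> t \<in> {0..1} \<and> 0 \<le> r \<and> r \<le> F t"
      unfolding region_def by blast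
    then obtain r t where z: "z = pol r t" "t \<in> {0..1}" "0 \<le> r" "r \<le> F t" by blast
    have "w = pol (u * r) t" using u z by (simp add: pol_def scaleR_conv_of_real)
    moreover have "u * r \<le> F t" using u z mult_left_le_one_le[of r u] by linarith
    ultimately show "w \<in> region F"
      using pol_in_region_iff[OF F z(2), of "u * r"] u(2) z(3) by simp
  qed
  moreover have "0 \<in> region F"
    using pol_in_region_iff[OF F, of 0 0] radialD[OF F] by simp
  ultimately show ?thesis unfolding starlike_def by blast
qed

text \<open>Scaling along rays. It supplies compactness of the region and, by invariance of domain,
  the fact that points strictly inside the curve are interior.\<close>

lemma region_disc_map:
  assumes F: "radial F"
  obtains \<Phi> where "continuous_on (cball 0 1) \<Phi>" "inj_on \<Phi> (ball 0 1)"
    "\<And>r t. r \<in> {0..1} \<Longrightarrow> t \<in> {0..1} \<Longrightarrow> \<Phi> (pol r t) = pol (r * F t) t"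
proof -
  define f where "f = (\<lambda>r t. pol (r * F t) t)"
  have cf: "continuous_on ({0..1} \<times> {0..1}) (\<lambda>(r, t). f r t)"
    unfolding f_def case_prod_unfold
    by (intro continuous_intros continuous_on_compose2[OF radialD(1)[OF F]]) auto
  note P = polar_map[of 0 1 f, OF cf]
  define \<Phi> where "\<Phi> = (\<lambda>z. f (norm z) (turn z))"
  have "inj_on \<Phi> (ball 0 1)"
  proof (rule inj_onI)
    fix w z assume *: "w \<in> ball 0 1" "z \<in> ball 0 1" "\<Phi> w = \<Phi> z"
    have Fp: "0 < F (turn w)" "0 < F (turn z)" using radialD(2)[OF F] turn_bounds(3) by auto
    show "w = z"
    proof (cases "w = 0 \<or> z = 0")
      case True
      have "norm (\<Phi> w) = norm w * F (turn w)" "norm (\<Phi> z) = norm z * F (turn z)"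
        using Fp by (simp_all add: \<Phi>_def f_def)
      then have "norm w * F (turn w) = norm z * F (turn z)" using *(3) by simp
      then have "w = 0 \<longleftrightarrow> z = 0" using Fp by (metis less_irrefl mult_eq_0_iff norm_eq_zero)
      then show ?thesis using True by blast
    next
      case False
      then have "0 < norm w * F (turn w)" "0 \<le> norm z * F (turn z)" using Fp by auto
      moreover have "pol (norm w * F (turn w)) (turn w) = pol (norm z * F (turn z)) (turn z)"
        using *(3) unfolding \<Phi>_def f_def .
      ultimately have "norm w * F (turn w) = norm z * F (turn z) \<and> turn w = turn z"
        using pol_eqD[of "norm w * F (turn w)" "turn w" "norm z * F (turn z)" "turn z"]
          turn_bounds[of w] turn_bounds[of z] by linarith
      then show ?thesis using Fp(2) pol_turn[of w] pol_turn[of z]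
        by (metis less_irrefl mult_right_cancel)
    qed
  qed
  moreover have "continuous_on (cball 0 1) \<Phi>"
    using P(1) radialD[OF F] by (simp add: \<Phi>_def f_def cball_def dist_norm)
  moreover have "\<Phi> (pol r t) = pol (r * F t) t" if "r \<in> {0..1}" "t \<in> {0..1}" for r t
    using P(2) radialD[OF F] that by (simp add: \<Phi>_def f_def)
  ultimately show ?thesis using that by blast
qed

text \<open>A frontier point is the image of a point of the closed disc, but of none of the open
  disc, so it has full radius on its ray.\<close>

lemma frontier_region: "radial F \<Longrightarrow> frontier (region F) \<subseteq> curve F ` {0..1}"
proof
  fix z assume F: "radial F" and z: "z \<in> frontier (region F)"
  obtain \<Phi> where \<Phi>: "continuous_on (cball 0 1) \<Phi>" "inj_on \<Phi> (ball 0 1)"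
    "\<And>r t. r \<in> {0..1} \<Longrightarrow> t \<in> {0..1} \<Longrightarrow> \<Phi> (pol r t) = pol (r * F t) t"
    using region_disc_map[OF F] by metis
  have reg: "\<Phi> ` cball 0 1 = region F"
  proof (intro equalityI subsetI)
    fix y assume "y \<in> \<Phi> ` cball 0 1"
    then obtain x where x: "norm x \<le> 1" "y = \<Phi> x" by auto
    have "\<Phi> x = pol (norm x * F (turn x)) (turn x)"
      using \<Phi>(3)[of "norm x" "turn x"] x turn_bounds(3)[of x] by simp
    moreover have "0 \<le> norm x * F (turn x)" "norm x * F (turn x) \<le> F (turn x)"
      using x(1) radialD(2)[OF F turn_bounds(3), of x] by (simp_all add: mult_left_le_one_le)
    ultimately show "y \<in> region F"
      using x(2) pol_in_region_iff[OF F turn_bounds(3), of "norm x * F (turn x)" x] by simp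
  next
    fix y assume "y \<in> region F"
    then obtain r t where y: "y = pol r t" "t \<in> {0..1}" "0 \<le> r" "r \<le> F t"
      unfolding region_def by blast
    have "y = \<Phi> (pol (r / F t) t)" using \<Phi>(3)[of "r / F t" t] y radialD(2)[OF F y(2)] by simp
    moreover have "pol (r / F t) t \<in> cball 0 1" using y radialD(2)[OF F y(2)] by simp
    ultimately show "y \<in> \<Phi> ` cball 0 1" by blast
  qed
  have "open (\<Phi> ` ball 0 1)"
    by (intro invariance_of_domain \<Phi>(2) continuous_on_subset[OF \<Phi>(1)]) auto
  moreover have "\<Phi> ` ball 0 1 \<subseteq> region F" using reg ball_subset_cball by blast
  ultimately have int: "\<Phi> ` ball 0 1 \<subseteq> interior (region F)" by (simp add: interior_maximal)
  have "closed (region F)" using compact_continuous_image[OF \<Phi>(1)] compact_imp_closed reg by auto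
  then have "z \<in> region F" "z \<notin> interior (region F)" using z by (auto simp: frontier_def)
  then obtain x where x: "x \<in> cball 0 1" "z = \<Phi> x" using reg by blast
  then have "x \<notin> ball 0 1" using \<open>z \<notin> interior (region F)\<close> int by blast
  then have "norm x = 1" using x(1) by simp
  then have "z = curve F (turn x)"
    using \<Phi>(3)[of "norm x" "turn x"] x(2) turn_bounds(3)[of x] pol_turn[of x] by simp
  then show "z \<in> curve F ` {0..1}" using turn_bounds(3) by blast
qed

section \<open>Words and word distance\<close>

lemma word_val_Nil [simp]: "word_val G [] = \<one>\<^bsub>G\<^esub>"
  and word_val_Cons [simp]: "word_val G (a # w) = a \<otimes>\<^bsub>G\<^esub> word_val G w"
  by (simp_all add: word_val_def)

locale marked_group = group G for G :: "('g, 'b) monoid_scheme" (structure) +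
  fixes A :: "'g set"
  assumes gens: "symmetric_generating_set G A"
begin

lemma A_closed: "a \<in> A \<Longrightarrow> a \<in> carrier G"
  and A_inv: "a \<in> A \<Longrightarrow> inv a \<in> A"
  and one_notin_A: "\<one> \<notin> A"
  and generate_A: "generate G A = carrier G"
  using gens by (auto simp: symmetric_generating_set_def)

definition inv_word :: "'g list \<Rightarrow> 'g list" where
  "inv_word w = map (m_inv G) (rev w)"

lemma inv_word_simps [simp]:
  "inv_word [] = []" "inv_word (a # w) = inv_word w @ [inv a]"
  "length (inv_word w) = length w" "inv_word w = [] \<longleftrightarrow> w = []"
  by (simp_all add: inv_word_def)

lemma inv_word_in_lists [intro, simp]: "w \<in> lists A \<Longrightarrow> inv_word w \<in> lists A"
  by (auto simp: inv_word_def A_inv)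

lemma word_val_closed [intro, simp]: "w \<in> lists A \<Longrightarrow> word_val G w \<in> carrier G"
  by (induction w) (auto simp: A_closed)

lemma word_val_append:
  "u \<in> lists A \<Longrightarrow> v \<in> lists A \<Longrightarrow> word_val G (u @ v) = word_val G u \<otimes> word_val G v"
  by (induction u) (auto simp: A_closed m_assoc)

lemma word_val_inv_word: "w \<in> lists A \<Longrightarrow> word_val G (inv_word w) = inv (word_val G w)"
  by (induction w) (auto simp: word_val_append A_closed A_inv inv_mult_group)

lemma lists_take_drop [intro, simp]:
  "w \<in> lists A \<Longrightarrow> take i w \<in> lists A" "w \<in> lists A \<Longrightarrow> drop i w \<in> lists A"
  by (auto dest: in_set_takeD in_set_dropD)

text \<open>A path is determined by its start and its label. As \<open>R\<close> is arbitrary,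
  distances in the Cayley graph and in the Cayley complex are the same minimal word lengths.\<close>

lemma edge_path_cayley:
  "x \<in> carrier G \<Longrightarrow> edge_path (cayley_complex G A R) x p y \<longleftrightarrow>
     (\<exists>w\<in>lists A. p = word_path G x w \<and> x \<otimes> word_val G w = y)"
proof (induction p arbitrary: x)
  case Nil
  show ?case
  proof
    assume "edge_path (cayley_complex G A R) x [] y"
    then show "\<exists>w\<in>lists A. [] = word_path G x w \<and> x \<otimes> word_val G w = y"
      using Nil by (intro bexI[of _ "[]"]) auto
  next
    assume "\<exists>w\<in>lists A. [] = word_path G x w \<and> x \<otimes> word_val G w = y"
    then obtain w where "w \<in> lists A" "[] = word_path G x w" "x \<otimes> word_val G w = y" by blast
    then show "edge_path (cayley_complex G A R) x [] y"
      using Nil by (cases w) (auto simp: cayley_complex_def)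
  qed
next
  case (Cons e p)
  obtain g a where e: "e = (g, a)" by force
  show ?case
  proof
    assume "edge_path (cayley_complex G A R) x (e # p) y"
    then have *: "g = x" "a \<in> A" "edge_path (cayley_complex G A R) (x \<otimes> a) p y"
      by (auto simp: cayley_complex_def e)
    then obtain w where "w \<in> lists A" "p = word_path G (x \<otimes> a) w" "x \<otimes> a \<otimes> word_val G w = y"
      using Cons.IH[of "x \<otimes> a"] Cons.prems A_closed by auto
    then show "\<exists>w\<in>lists A. e # p = word_path G x w \<and> x \<otimes> word_val G w = y"
      using * e Cons.prems A_closed by (intro bexI[of _ "a # w"]) (auto simp: m_assoc)
  next
    assume "\<exists>w\<in>lists A. e # p = word_path G x w \<and> x \<otimes> word_val G w = y"
    then obtain w where w: "w \<in> lists A" "e # p = word_path G x w" "x \<otimes> word_val G w = y" by blast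
    then obtain w' where w': "w = a # w'" "g = x" "p = word_path G (x \<otimes> a) w'" by (cases w) (auto simp: e)
    then have "x \<otimes> a \<otimes> word_val G w' = y" using w Cons.prems A_closed by (auto simp: m_assoc)
    then have "edge_path (cayley_complex G A R) (x \<otimes> a) p y"
      using Cons.IH[of "x \<otimes> a"] Cons.prems w w' A_closed by auto
    then show "edge_path (cayley_complex G A R) x (e # p) y"
      using w w' Cons.prems by (auto simp: cayley_complex_def e)
  qed
qed

lemma path_dist_cayley:
  assumes "x \<in> carrier G"
  shows "path_dist (cayley_complex G A R) x y =
    (LEAST n. \<exists>w\<in>lists A. x \<otimes> word_val G w = y \<and> length w = n)"
proof -
  have "length (word_path G z w) = length w" for z w by (induction w arbitrary: z) auto
  then have "(\<exists>p. edge_path (cayley_complex G A R) x p y \<and> length p = n) \<longleftrightarrow>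
    (\<exists>w\<in>lists A. x \<otimes> word_val G w = y \<and> length w = n)" for n
    by (auto simp: edge_path_cayley[OF assms])
  then show ?thesis unfolding path_dist_def by simp
qed

lemma cayley_dist_le:
  "x \<in> carrier G \<Longrightarrow> w \<in> lists A \<Longrightarrow> cayley_dist G A x (x \<otimes> word_val G w) \<le> length w"
  unfolding path_dist_cayley by (rule Least_le) blast

lemma word_exists: "g \<in> carrier G \<Longrightarrow> \<exists>w\<in>lists A. word_val G w = g"
proof -
  assume "g \<in> carrier G"
  then have "g \<in> generate G A" by (simp add: generate_A)
  then show ?thesis
  proof (induction rule: generate.induct)
    case one
    show ?case by (intro bexI[of _ "[]"]) auto
  next
    case (incl h)
    then show ?case by (intro bexI[of _ "[h]"]) (auto simp: A_closed)
  next
    case (inv h)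
    then show ?case by (intro bexI[of _ "[inv h]"]) (auto simp: A_closed A_inv)
  next
    case (eng h1 h2)
    then obtain w1 w2 where "w1 \<in> lists A" "word_val G w1 = h1" "w2 \<in> lists A" "word_val G w2 = h2"
      by blast
    then show ?case by (intro bexI[of _ "w1 @ w2"]) (auto simp: word_val_append)
  qed
qed

lemma geodesic_exists:
  assumes "x \<in> carrier G" "y \<in> carrier G"
  shows "\<exists>w\<in>lists A. x \<otimes> word_val G w = y \<and> length w = cayley_dist G A x y"
proof -
  obtain w where "w \<in> lists A" "word_val G w = inv x \<otimes> y" using word_exists assms by blast
  then have "w \<in> lists A \<and> x \<otimes> word_val G w = y" using assms by (simp add: m_assoc[symmetric])
  then have "\<exists>n. \<exists>w\<in>lists A. x \<otimes> word_val G w = y \<and> length w = n" by blast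
  then show ?thesis unfolding path_dist_cayley[OF assms(1)] by (rule LeastI_ex)
qed

lemma cayley_dist_commute:
  assumes "x \<in> carrier G" "y \<in> carrier G"
  shows "cayley_dist G A x y = cayley_dist G A y x"
proof -
  have "cayley_dist G A y x \<le> cayley_dist G A x y" if xy: "x \<in> carrier G" "y \<in> carrier G" for x y
  proof -
    obtain w where w: "w \<in> lists A" "x \<otimes> word_val G w = y" "length w = cayley_dist G A x y"
      using geodesic_exists[OF xy] by blast
    have "y \<otimes> word_val G (inv_word w) = x"
      using xy word_val_closed[OF w(1)] by (simp add: w(2)[symmetric] word_val_inv_word[OF w(1)] m_assoc)
    then show ?thesis using cayley_dist_le[OF xy(2), of "inv_word w"] w by auto
  qed
  then show ?thesis using assms by (meson le_antisym)
qed

definition wlen :: "'g \<Rightarrow> nat" where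
  "wlen g = cayley_dist G A \<one> g"

lemma wlen_le: "w \<in> lists A \<Longrightarrow> wlen (word_val G w) \<le> length w"
  using cayley_dist_le[of \<one> w] by (simp add: wlen_def)

lemma wlen_one [simp]: "wlen \<one> = 0"
  using wlen_le[of "[]"] by simp

lemma wlen_mult_le:
  assumes "g \<in> carrier G" "s \<in> lists A"
  shows "wlen (g \<otimes> word_val G s) \<le> wlen g + length s"
proof -
  obtain w where "w \<in> lists A" "word_val G w = g" "length w = wlen g"
    using geodesic_exists[of \<one> g] assms by (auto simp: wlen_def)
  then show ?thesis using wlen_le[of "w @ s"] assms by (auto simp: word_val_append)
qed

lemma wlen_le_mult:
  assumes "g \<in> carrier G" "s \<in> lists A"
  shows "wlen g \<le> wlen (g \<otimes> word_val G s) + length s"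
  using wlen_mult_le[of "g \<otimes> word_val G s" "inv_word s"] assms
  by (auto simp: word_val_inv_word m_assoc)

section \<open>Consequences of short relators\<close>

abbreviation rel_equiv :: "'g list set \<Rightarrow> 'g list \<Rightarrow> 'g list \<Rightarrow> bool" where
  "rel_equiv R \<equiv> equivclp (relator_deletion G A R)"

lemma relator_deletion_context:
  assumes "relator_deletion G A R u v" "x \<in> lists A" "y \<in> lists A"
  shows "relator_deletion G A R (x @ u @ y) (x @ v @ y)"
  using assms(1)
proof cases
  case (relator u' v' r)
  have "relator_deletion G A R ((x @ u') @ r @ (v' @ y)) ((x @ u') @ (v' @ y))"
    by (rule relator_deletion.relator) (use relator assms in auto)
  then show ?thesis using relator by simp
next
  case (cancel u' v' a)
  have "relator_deletion G A R ((x @ u') @ [a, inv a] @ (v' @ y)) ((x @ u') @ (v' @ y))"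
    by (rule relator_deletion.cancel) (use cancel assms in auto)
  then show ?thesis using cancel by simp
qed

lemma rel_equiv_context:
  assumes "rel_equiv R u v" "x \<in> lists A" "y \<in> lists A"
  shows "rel_equiv R (x @ u @ y) (x @ v @ y)"
  using assms(1)
proof (induction rule: equivclp_induct)
  case (step v w)
  then show ?case
    using relator_deletion_context[OF _ assms(2,3)] by (meson equivclp_into_equivclp)
qed simp

lemma rel_equiv_cancel: "s \<in> lists A \<Longrightarrow> rel_equiv R (s @ inv_word s) []"
proof (induction s)
  case (Cons a s)
  have "rel_equiv R ([a] @ (s @ inv_word s) @ [inv a]) ([a] @ [] @ [inv a])"
    using Cons by (intro rel_equiv_context) (auto simp: A_inv)
  moreover have "relator_deletion G A R ([] @ [a, inv a] @ []) ([] @ [])"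
    using Cons by (intro relator_deletion.cancel) auto
  ultimately show ?case by (simp add: equivclp_into_equivclp)
qed simp

text \<open>The word \<open>inv_word r' @ r\<close> is a relator and may be inserted after
  \<open>r'\<close>; then \<open>r' @ inv_word r'\<close> cancels freely. This is the algebraic
  counterpart of gluing one cell.\<close>

lemma rel_equiv_short_swap:
  assumes "r \<in> lists A" "r' \<in> lists A" "word_val G r = word_val G r'"
    "length r + length r' \<le> 2 * K + 2"
  shows "rel_equiv (short_relators G A K) r r'"
proof (cases "r = [] \<and> r' = []")
  case False
  let ?R = "short_relators G A K"
  have "rel_equiv ?R (r' @ (inv_word r' @ r)) r'"
  proof (rule r_into_equivclp)
    have "relator_deletion G A ?R (r' @ (inv_word r' @ r) @ []) (r' @ [])"
      using assms False
      by (intro relator_deletion.relator) (auto simp: short_relators_def word_val_append word_val_inv_word)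
    then show "relator_deletion G A ?R (r' @ (inv_word r' @ r)) r'" by simp
  qed
  moreover have "rel_equiv ?R ([] @ (r' @ inv_word r') @ r) ([] @ [] @ r)"
    using assms by (intro rel_equiv_context rel_equiv_cancel) auto
  ultimately show ?thesis
    by (metis append_Nil append_assoc equivclp_sym equivclp_trans)
qed simp

lemma rel_equiv_word_val:
  assumes "rel_equiv R u v" "\<And>r. r \<in> R \<Longrightarrow> r \<in> lists A \<and> word_val G r = \<one>"
  shows "word_val G u = word_val G v"
  using assms(1)
proof (induction rule: equivclp_induct)
  case (step v w)
  have "word_val G v = word_val G w" if "relator_deletion G A R v w" for v w
    using that
  proof cases
    case (relator u' v' r)
    then show ?thesis using assms(2)[of r] by (simp add: word_val_append)
  next
    case (cancel u' v' a)
    then have "[a, inv a] \<in> lists A" "word_val G [a, inv a] = \<one>" by (auto simp: A_closed A_inv)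
    then show ?thesis using cancel(1-4) by (simp only: word_val_append append_in_lists_conv l_one word_val_closed)
  qed
  then show ?case using step by metis
qed simp

lemma short_relatorsD: "r \<in> short_relators G A K \<Longrightarrow> r \<in> lists A \<and> word_val G r = \<one>"
  by (simp add: short_relators_def)

text \<open>Trivialising the words that represent the identity is enough: \<open>u\<close> and
  \<open>v\<close> of equal value are compared through \<open>u @ inv_word v @ v\<close>.\<close>

lemma finite_presentation_short_relators:
  assumes "finite A"
    and triv: "\<And>w. w \<in> lists A \<Longrightarrow> word_val G w = \<one> \<Longrightarrow> rel_equiv (short_relators G A K) w []"
  shows "finite_presentation G A (short_relators G A K)"
  unfolding finite_presentation_def
proof (intro conjI ballI iffI)
  have "short_relators G A K \<subseteq> {w. set w \<subseteq> A \<and> length w \<le> 2 * K + 2}"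
    by (auto simp: short_relators_def)
  then show "finite (short_relators G A K)"
    using finite_lists_length_le[OF assms(1)] finite_subset by blast
next
  fix u v assume uv: "u \<in> lists A" "v \<in> lists A" "word_val G u = word_val G v"
  let ?E = "rel_equiv (short_relators G A K)"
  have "?E ((u @ inv_word v) @ v) v"
    using rel_equiv_context[OF triv[of "u @ inv_word v"], of "[]" v] uv
    by (simp add: word_val_append word_val_inv_word)
  moreover have "?E (u @ inv_word v @ v) u"
  proof -
    have "inv_word (inv_word v) = v"
      using uv(2) by (induction v) (auto simp: inv_word_def rev_map A_closed)
    then show ?thesis
      using rel_equiv_context[OF rel_equiv_cancel[of "inv_word v"], of u "[]"] uv by simp
  qed
  ultimately show "?E u v" by (metis append_assoc equivclp_sym equivclp_trans)
next
  fix u v assume "rel_equiv (short_relators G A K) u v"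
  then show "word_val G u = word_val G v" using rel_equiv_word_val short_relatorsD by blast
qed (use assms gens in \<open>auto simp: short_relators_def\<close>)

end

section \<open>Disc diagrams with a tame homotopy\<close>

lemma open_cell_reversepath [simp]: "open_cell (Edge (reversepath e)) = open_cell (Edge e)"
proof -
  have "(\<lambda>t::real. 1 - t) ` {0<..<1} = {0<..<1}"
    by (auto intro!: image_eqI[where x = "1 - _ :: real"])
  moreover have "reversepath e ` {0<..<1} = e ` ((\<lambda>t::real. 1 - t) ` {0<..<1})"
    by (simp add: image_image reversepath_def)
  ultimately show ?thesis by simp
qed

text \<open>For a face the starting points of its boundary edges are all its corners, because the
  boundary circuit is closed.\<close>

primrec cell_verts ::
    "'g diagram \<Rightarrow> (complex, real \<Rightarrow> complex, complex \<Rightarrow> complex) cell \<Rightarrow> complex set" where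
  "cell_verts \<Delta> (Vertex v) = {v}"
| "cell_verts \<Delta> (Edge e) = {pathstart e, pathfinish e}"
| "cell_verts \<Delta> (Face \<sigma>) = pathstart ` set (bdry \<Delta> \<sigma>)"

text \<open>A bound is recorded instead of the distance: it persists when edges are added to the
  diagram, whereas the distance itself may drop.\<close>

definition reach :: "'g diagram \<Rightarrow> complex \<Rightarrow> nat \<Rightarrow> bool" where
  "reach \<Delta> v n \<longleftrightarrow> (\<exists>p. edge_path \<Delta> (base \<Delta>) p v \<and> length p \<le> n)"

lemma reach_mono: "reach \<Delta> v n \<Longrightarrow> n \<le> n' \<Longrightarrow> reach \<Delta> v n'"
  by (meson reach_def order_trans)

lemma edge_path_snoc:
  "edge_path Y x p y \<Longrightarrow> e \<in> edges Y \<Longrightarrow> src Y e = y \<Longrightarrow> tgt Y e \<in> verts Y \<Longrightarrow>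
   edge_path Y x (p @ [e]) (tgt Y e)"
  by (induction p arbitrary: x) auto

lemma edge_path_mono:
  assumes "verts \<Delta> \<subseteq> verts \<Delta>'" "edges \<Delta> \<subseteq> edges \<Delta>'" "src \<Delta>' = src \<Delta>" "flip \<Delta>' = flip \<Delta>"
  shows "edge_path \<Delta> x p y \<Longrightarrow> edge_path \<Delta>' x p y"
  by (induction p arbitrary: x) (use assms in auto)

text \<open>An entry consists of an edge, the angle at which it ends, and a bound for the distance
  of its starting point from the base point. The angle at which it starts is the end of the
  preceding arc.\<close>

primrec arc_chain ::
    "'g diagram \<Rightarrow> (real \<Rightarrow> real) \<Rightarrow> real \<Rightarrow> ((real \<Rightarrow> complex) \<times> real \<times> nat) list \<Rightarrow> real \<Rightarrow> bool" where
  "arc_chain \<Delta> F \<alpha> [] \<beta> \<longleftrightarrow> \<alpha> = \<beta>"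
| "arc_chain \<Delta> F \<alpha> (s # S) \<beta> \<longleftrightarrow>
     (case s of (e, \<gamma>, k) \<Rightarrow> \<alpha> < \<gamma> \<and> e \<in> edges \<Delta> \<and> (\<forall>t\<in>{0..1}. e t = curve F (\<alpha> + t * (\<gamma> - \<alpha>))) \<and>
        reach \<Delta> (curve F \<alpha>) k \<and> arc_chain \<Delta> F \<gamma> S \<beta>)"

lemma arc_chain_append:
  "arc_chain \<Delta> F \<alpha> (S @ S') \<beta> \<longleftrightarrow> (\<exists>\<gamma>. arc_chain \<Delta> F \<alpha> S \<gamma> \<and> arc_chain \<Delta> F \<gamma> S' \<beta>)"
  by (induction S arbitrary: \<alpha>) (auto split: prod.splits)

lemma arc_chain_le: "arc_chain \<Delta> F \<alpha> S \<beta> \<Longrightarrow> \<alpha> \<le> \<beta>"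
  by (induction S arbitrary: \<alpha>) (force split: prod.splits)+

lemma arc_chain_less: "arc_chain \<Delta> F \<alpha> S \<beta> \<Longrightarrow> S \<noteq> [] \<Longrightarrow> \<alpha> < \<beta>"
  by (cases S) (auto dest!: arc_chain_le split: prod.splits)

lemma arc_chain_edges: "arc_chain \<Delta> F \<alpha> T \<beta> \<Longrightarrow> s \<in> set T \<Longrightarrow> fst s \<in> edges \<Delta>"
  by (induction T arbitrary: \<alpha>) (auto split: prod.splits)

lemma arc_chain_mono:
  assumes "edges \<Delta> \<subseteq> edges \<Delta>'" "\<And>v k. reach \<Delta> v k \<Longrightarrow> reach \<Delta>' v k"
  shows "arc_chain \<Delta> F \<alpha> S \<beta> \<Longrightarrow> (\<And>t. t \<in> {\<alpha>..\<beta>} \<Longrightarrow> F' t = F t) \<Longrightarrow> arc_chain \<Delta>' F' \<alpha> S \<beta>"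
proof (induction S arbitrary: \<alpha>)
  case (Cons s S)
  obtain e \<gamma> k where s: "s = (e, \<gamma>, k)" by (cases s)
  have *: "\<alpha> < \<gamma>" "e \<in> edges \<Delta>" "\<And>t. t\<in>{0..1} \<Longrightarrow> e t = curve F (\<alpha> + t * (\<gamma> - \<alpha>))"
    "reach \<Delta> (curve F \<alpha>) k" "arc_chain \<Delta> F \<gamma> S \<beta>"
    using Cons.prems by (auto simp: s)
  have "\<gamma> \<le> \<beta>" using arc_chain_le *(5) by blast
  have "\<alpha> + t * (\<gamma> - \<alpha>) \<in> {\<alpha>..\<beta>}" if "t \<in> {0..1}" for t
  proof -
    have "0 \<le> t * (\<gamma> - \<alpha>)" "t * (\<gamma> - \<alpha>) \<le> 1 * (\<gamma> - \<alpha>)"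
      using that *(1) by (auto intro!: mult_right_mono mult_nonneg_nonneg simp del: mult_1)
    then show ?thesis using \<open>\<gamma> \<le> \<beta>\<close> by auto
  qed
  then have "e t = curve F' (\<alpha> + t * (\<gamma> - \<alpha>))" if "t \<in> {0..1}" for t
    using that *(3) Cons.prems(2) by simp
  moreover have "F' \<alpha> = F \<alpha>" using Cons.prems(2)[of \<alpha>] *(1) \<open>\<gamma> \<le> \<beta>\<close> by simp
  moreover have "arc_chain \<Delta>' F' \<gamma> S \<beta>"
    using Cons.IH *(1,5) Cons.prems(2) by simp
  ultimately show ?case using * assms by (auto simp: s)
qed simp

text \<open>The arcs are joined into one strictly increasing angle function with the joints at the
  integers. Traversals give every edge the same share of the circle, whatever the angular lengths of
  the arcs are.\<close>

lemma arc_chain_param: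
  "arc_chain \<Delta> F \<alpha> S \<beta> \<Longrightarrow> \<exists>\<tau>. continuous_on {0..real (length S)} \<tau> \<and> strict_mono_on {0..real (length S)} \<tau> \<and>
     \<tau> 0 = \<alpha> \<and> \<tau> (real (length S)) = \<beta> \<and>
     (\<forall>k<length S. \<forall>t\<in>{0..1}. fst (S ! k) t = curve F (\<tau> (real k + t)))"
proof (induction S arbitrary: \<alpha>)
  case Nil
  then show ?case by (intro exI[of _ "\<lambda>_. \<alpha>"]) (auto simp: strict_mono_on_def)
next
  case (Cons s S)
  obtain e \<gamma> k where s: "s = (e, \<gamma>, k)" by (cases s)
  have *: "\<alpha> < \<gamma>" "\<And>t. t\<in>{0..1} \<Longrightarrow> e t = curve F (\<alpha> + t * (\<gamma> - \<alpha>))" "arc_chain \<Delta> F \<gamma> S \<beta>"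
    using Cons.prems by (auto simp: s)
  let ?n = "real (length S)"
  obtain \<tau> where \<tau>: "continuous_on {0..?n} \<tau>" "strict_mono_on {0..?n} \<tau>" "\<tau> 0 = \<gamma>" "\<tau> ?n = \<beta>"
    "\<And>k t. k < length S \<Longrightarrow> t \<in> {0..1} \<Longrightarrow> fst (S ! k) t = curve F (\<tau> (real k + t))"
    using Cons.IH[OF *(3)] by blast
  define \<rho> where "\<rho> = (\<lambda>x. if x \<le> 1 then \<alpha> + x * (\<gamma> - \<alpha>) else \<tau> (x - 1))"
  have "continuous_on ({0..1} \<union> {1..?n + 1}) \<rho>"
    unfolding \<rho>_def
    by (rule continuous_on_cases) (use \<tau>(3) in \<open>auto intro!: continuous_intros continuous_on_compose2[OF \<tau>(1)]\<close>)
  moreover have "{0..1} \<union> {1..?n + 1} = {0..?n + 1}" by auto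
  ultimately have "continuous_on {0..?n + 1} \<rho>" by simp
  moreover have "strict_mono_on {0..?n + 1} \<rho>"
  proof (rule strict_mono_onI)
    fix x y assume xy: "x \<in> {0..?n + 1}" "y \<in> {0..?n + 1}" "x < y"
    consider "y \<le> 1" | "x \<le> 1" "1 < y" | "1 < x" using xy by linarith
    then show "\<rho> x < \<rho> y"
    proof cases
      case 1 then show ?thesis using xy *(1) by (simp add: \<rho>_def)
    next
      case 2
      have "\<alpha> + x * (\<gamma> - \<alpha>) \<le> \<alpha> + 1 * (\<gamma> - \<alpha>)"
        using 2 *(1) by (intro add_left_mono mult_right_mono) auto
      moreover have "\<tau> 0 < \<tau> (y - 1)" using \<tau>(2) xy 2 by (auto simp: strict_mono_on_def)
      ultimately show ?thesis using 2 \<tau>(3) by (simp add: \<rho>_def)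
    next
      case 3 then show ?thesis using xy \<tau>(2) by (auto simp: \<rho>_def strict_mono_on_def)
    qed
  qed
  moreover have "\<rho> (?n + 1) = \<beta>" "\<rho> 0 = \<alpha>"
    using \<tau>(3,4) by (cases S; auto simp: \<rho>_def)+
  moreover have "fst ((s # S) ! k) t = curve F (\<rho> (real k + t))"
    if "k < length (s # S)" "t \<in> {0..1}" for k t
  proof (cases k)
    case 0 then show ?thesis using *(2) that by (simp add: s \<rho>_def)
  next
    case (Suc j)
    have "\<rho> (real k + t) = \<tau> (real j + t)"
    proof (cases "real k + t \<le> 1")
      case True
      then have "j = 0" "t = 0" using Suc that(2) by auto
      then show ?thesis using Suc \<tau>(3) by (simp add: \<rho>_def)
    qed (use Suc in \<open>simp add: \<rho>_def\<close>)
    then show ?thesis using Suc that \<tau>(5)[of j t] by simp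
  qed
  ultimately show ?case by (intro exI[of _ \<rho>]) (simp add: add.commute)
qed

text \<open>
  The boundary of the diagram is the curve \<open>F\<close>, cut into the arcs \<open>S\<close>; \<open>H (t, s)\<close> is the homotopy on
  the boundary point at angle \<open>t\<close>. The level \<open>lev\<close> of a point bounds, up to the linear function
  with constant \<open>C\<close>, the intrinsic distance from above and the extrinsic one from below.
\<close>

locale tame_disc = marked_group G A for G :: "('g, 'b) monoid_scheme" (structure) and A +
  fixes R :: "'g list set" and C :: nat and \<Delta> :: "'g diagram" and F :: "real \<Rightarrow> real"
    and S :: "((real \<Rightarrow> complex) \<times> real \<times> nat) list" and H :: "real \<times> real \<Rightarrow> complex"
    and val :: "complex \<Rightarrow> 'g" and lev :: "complex \<Rightarrow> nat" and B :: nat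
  assumes radial: "radial F"
    and planar: "planar_complex \<Delta>"
    and supp: "support \<Delta> = region F"
    and base: "base \<Delta> = 1" "1 \<in> verts \<Delta>"
    and label_A: "e \<in> edges \<Delta> \<Longrightarrow> label \<Delta> e \<in> A"
    and label_rev: "e \<in> edges \<Delta> \<Longrightarrow> label \<Delta> (reversepath e) = inv (label \<Delta> e)"
    and face_R: "\<sigma> \<in> faces \<Delta> \<Longrightarrow> map (label \<Delta>) (bdry \<Delta> \<sigma>) \<in> R"
    and chain: "arc_chain \<Delta> F 0 S 1"
    and val_1: "val 1 = \<one>"
    and val_closed: "v \<in> verts \<Delta> \<Longrightarrow> val v \<in> carrier G"
    and val_edge: "e \<in> edges \<Delta> \<Longrightarrow> val (pathfinish e) = val (pathstart e) \<otimes> label \<Delta> e"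
    and lev_cell: "c \<in> cells \<Delta> \<Longrightarrow> z \<in> open_cell c \<Longrightarrow> v \<in> cell_verts \<Delta> c \<Longrightarrow>
      reach \<Delta> v (lev z) \<and> lev z + 1 \<le> C * wlen (val v) + C"
    and lev_le: "z \<in> region F \<Longrightarrow> lev z \<le> B"
    and H_cont: "continuous_on ({0..1} \<times> {0..1}) H"
    and H_region: "t \<in> {0..1} \<Longrightarrow> s \<in> {0..1} \<Longrightarrow> H (t, s) \<in> region F"
    and H_0: "t \<in> {0..1} \<Longrightarrow> H (t, 0) = 1"
    and H_1: "t \<in> {0..1} \<Longrightarrow> H (t, 1) = curve F t"
    and H_base: "s \<in> {0..1} \<Longrightarrow> H (0, s) = 1 \<and> H (1, s) = 1"
    and H_skel: "t \<in> {0..1} \<Longrightarrow> curve F t \<in> verts \<Delta> \<Longrightarrow> s \<in> {0..1} \<Longrightarrow> H (t, s) \<in> skeleton1 \<Delta>"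
    and H_lev: "t \<in> {0..1} \<Longrightarrow> 0 \<le> s \<Longrightarrow> s \<le> s' \<Longrightarrow> s' \<le> 1 \<Longrightarrow> lev (H (t, s)) \<le> lev (H (t, s'))"
begin

lemma planar_simps [simp]: "src \<Delta> = pathstart" "flip \<Delta> = reversepath"
  and planar_finite: "finite (verts \<Delta>)" "finite (edges \<Delta>)" "finite (faces \<Delta>)"
  using planar by (auto simp: planar_complex_def)

lemma edgeD:
  assumes "e \<in> edges \<Delta>"
  shows "simple_path e" "reversepath e \<in> edges \<Delta>" "pathstart e \<in> verts \<Delta>" "pathfinish e \<in> verts \<Delta>"
  using planar assms unfolding planar_complex_def by (auto, metis pathstart_reversepath)

lemma faceD:
  assumes "\<sigma> \<in> faces \<Delta>"
  shows "continuous_on (cball 0 1) \<sigma>" "inj_on \<sigma> (ball 0 1)" "bdry \<Delta> \<sigma> \<noteq> []"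
    "set (bdry \<Delta> \<sigma>) \<subseteq> edges \<Delta>" "traverses \<sigma> (\<sigma> 1) (bdry \<Delta> \<sigma>)"
  using planar assms unfolding planar_complex_def by blast+

lemma cells_disjoint:
  assumes "c \<in> cells \<Delta>" "c' \<in> cells \<Delta>" "z \<in> open_cell c" "z \<in> open_cell c'"
  shows "c = c' \<or> (\<exists>e. c = Edge e \<and> c' = Edge (reversepath e))"
  using planar assms unfolding planar_complex_def by blast

lemma open_cell_region: "c \<in> cells \<Delta> \<Longrightarrow> open_cell c \<subseteq> region F"
  using supp unfolding support_def by blast

lemma vert_region: "v \<in> verts \<Delta> \<Longrightarrow> v \<in> region F"
  using open_cell_region[of "Vertex v"] by (simp add: cells_def)

lemma reach_vert: "v \<in> verts \<Delta> \<Longrightarrow> reach \<Delta> v B"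
  using lev_cell[of "Vertex v" v v] lev_le[of v] vert_region[of v] reach_mono
  by (auto simp: cells_def)

lemma reach_base: "reach \<Delta> 1 0"
  unfolding reach_def base by (intro exI[of _ "[]"]) (simp add: base)

lemma chain_verts: "arc_chain \<Delta> F \<alpha> T \<beta> \<Longrightarrow> T \<noteq> [] \<Longrightarrow> curve F \<alpha> \<in> verts \<Delta> \<and> curve F \<beta> \<in> verts \<Delta>"
proof (induction T arbitrary: \<alpha>)
  case (Cons s T)
  obtain e \<gamma> k where s: "s = (e, \<gamma>, k)" by (cases s)
  have *: "e \<in> edges \<Delta>" "\<And>t. t\<in>{0..1} \<Longrightarrow> e t = curve F (\<alpha> + t * (\<gamma> - \<alpha>))" "arc_chain \<Delta> F \<gamma> T \<beta>"
    using Cons.prems by (auto simp: s)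
  have "pathstart e = curve F \<alpha>" "pathfinish e = curve F \<gamma>"
    using *(2)[of 0] *(2)[of 1] by (auto simp: pathstart_def pathfinish_def)
  then have "curve F \<alpha> \<in> verts \<Delta>" "curve F \<gamma> \<in> verts \<Delta>" using edgeD(3,4)[OF *(1)] by auto
  then show ?case using Cons.IH[OF *(3)] *(3) by (cases "T = []") auto
qed simp

text \<open>The third claim places every arc end at a prefix of the label word, which bounds its
  word distance from the left end of the chain; this is how the corners on the old side of a new
  cell are controlled.\<close>

lemma chain_val:
  assumes "arc_chain \<Delta> F \<alpha> T \<beta>" "val (curve F \<alpha>) \<in> carrier G"
  shows "map (label \<Delta> \<circ> fst) T \<in> lists A"
    and "val (curve F \<beta>) = val (curve F \<alpha>) \<otimes> word_val G (map (label \<Delta> \<circ> fst) T)"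
    and "e \<in> set (map fst T) \<Longrightarrow> \<exists>i\<le>length T.
      val (pathfinish e) = val (curve F \<alpha>) \<otimes> word_val G (take i (map (label \<Delta> \<circ> fst) T))"
proof -
  have "map (label \<Delta> \<circ> fst) T \<in> lists A \<and>
    val (curve F \<beta>) = val (curve F \<alpha>) \<otimes> word_val G (map (label \<Delta> \<circ> fst) T) \<and>
    (\<forall>e \<in> set (map fst T). \<exists>i\<le>length T.
      val (pathfinish e) = val (curve F \<alpha>) \<otimes> word_val G (take i (map (label \<Delta> \<circ> fst) T)))"
    using assms
  proof (induction T arbitrary: \<alpha>)
    case (Cons s T)
    obtain e \<gamma> k where s: "s = (e, \<gamma>, k)" by (cases s)
    have *: "e \<in> edges \<Delta>" "\<And>t. t\<in>{0..1} \<Longrightarrow> e t = curve F (\<alpha> + t * (\<gamma> - \<alpha>))" "arc_chain \<Delta> F \<gamma> T \<beta>"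
      using Cons.prems by (auto simp: s)
    have ends: "pathstart e = curve F \<alpha>" "pathfinish e = curve F \<gamma>"
      using *(2)[of 0] *(2)[of 1] by (auto simp: pathstart_def pathfinish_def)
    have v: "val (curve F \<gamma>) = val (curve F \<alpha>) \<otimes> label \<Delta> e" using val_edge[OF *(1)] ends by simp
    have lA: "label \<Delta> e \<in> carrier G" using label_A[OF *(1)] A_closed by blast
    have "val (curve F \<gamma>) \<in> carrier G" using v lA Cons.prems(2) by simp
    note IH = Cons.IH[OF *(3) this]
    have as: "val (curve F \<alpha>) \<otimes> label \<Delta> e \<otimes> word_val G w = val (curve F \<alpha>) \<otimes> word_val G (label \<Delta> e # w)"
      if "w \<in> lists A" for w
      using Cons.prems(2) lA that word_val_closed by (simp add: m_assoc)
    have "\<exists>i\<le>length (s # T). val (pathfinish e') = val (curve F \<alpha>) \<otimes> word_val G (take i (map (label \<Delta> \<circ> fst) (s # T)))"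
      if e': "e' \<in> set (map fst (s # T))" for e'
    proof (cases "e' = e")
      case True
      then show ?thesis using ends v lA by (intro exI[of _ 1]) (simp add: s)
    next
      case False
      then have "e' \<in> set (map fst T)" using e' by (auto simp: s)
      then obtain i where "i \<le> length T" "val (pathfinish e') = val (curve F \<gamma>) \<otimes> word_val G (take i (map (label \<Delta> \<circ> fst) T))"
        using IH by blast
      then show ?thesis using v as[of "take i (map (label \<Delta> \<circ> fst) T)"] IH
        by (intro exI[of _ "Suc i"]) (simp add: s del: in_lists_conv_set)
    qed
    moreover have "map (label \<Delta> \<circ> fst) (s # T) \<in> lists A"
      using IH label_A[OF *(1)] by (simp add: s o_def)
    moreover have "val (curve F \<beta>) = val (curve F \<alpha>) \<otimes> word_val G (map (label \<Delta> \<circ> fst) (s # T))"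
      using IH v as[of "map (label \<Delta> \<circ> fst) T"] by (simp add: s o_def del: in_lists_conv_set)
    ultimately show ?case by blast
  qed simp
  then show "map (label \<Delta> \<circ> fst) T \<in> lists A"
    and "val (curve F \<beta>) = val (curve F \<alpha>) \<otimes> word_val G (map (label \<Delta> \<circ> fst) T)"
    and "e \<in> set (map fst T) \<Longrightarrow> \<exists>i\<le>length T.
      val (pathfinish e) = val (curve F \<alpha>) \<otimes> word_val G (take i (map (label \<Delta> \<circ> fst) T))"
    by auto
qed

end

section \<open>Gluing a cell\<close>

text \<open>\<open>Q\<close>, between the angles \<open>a\<close> and \<open>b\<close>, is the old
  side of the new cell, and \<open>N\<close> is the word with distance bounds on the new side. By
  \<open>bound\<close> an inner vertex of the new side may be reached from either of its ends.
  \<open>low\<close> is the quasi-geodesic estimate: the values at all corners are within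
  \<open>2 * K + 2\<close> of the value at \<open>a\<close>, so they satisfy the lower bound for
  level \<open>B'\<close>.\<close>

locale cell_gluing = tame_disc G A "short_relators G A K" C \<Delta> F S H val lev B
  for G :: "('g, 'b) monoid_scheme" (structure) and A and K :: nat and C \<Delta> F S H val lev B +
  fixes X Q Y :: "((real \<Rightarrow> complex) \<times> real \<times> nat) list" and N :: "('g \<times> nat) list"
    and a b :: real and B' :: nat
  assumes S_eq: "S = X @ Q @ Y"
    and X_chain: "arc_chain \<Delta> F 0 X a" and Q_chain: "arc_chain \<Delta> F a Q b" and Y_chain: "arc_chain \<Delta> F b Y 1"
    and Q_ne: "Q \<noteq> []" and N_ne: "N \<noteq> []" and N_A: "map fst N \<in> lists A"
    and N_val: "word_val G (map fst N) = word_val G (map (label \<Delta> \<circ> fst) Q)"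
    and short: "length N + length Q \<le> 2 * K + 2"
    and B'_ge: "B \<le> B'"
    and bound_0: "reach \<Delta> (curve F a) (snd (N ! 0))"
    and bound: "\<And>k. 0 < k \<Longrightarrow> k < length N \<Longrightarrow>
      (\<exists>n. reach \<Delta> (curve F a) n \<and> n + k \<le> snd (N ! k)) \<or>
      (\<exists>n. reach \<Delta> (curve F b) n \<and> n + (length N - k) \<le> snd (N ! k))"
    and bound_B': "\<And>q. q \<in> set N \<Longrightarrow> snd q \<le> B'"
    and low: "\<And>d. wlen (val (curve F a)) \<le> d + (2 * K + 2) \<Longrightarrow> B' + 1 \<le> C * d + C"
begin

definition "m = length N"
definition "h = (b - a) / real m"
definition "knot k = a + real k * h"
text \<open>A concave bump vanishing at both ends; concavity makes the flattened cell
  convex.\<close>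

definition "hat t = (t - a) * (b - t)"
definition "F' t = F t + max 0 (hat t)"
definition "E k = (\<lambda>t. curve F' (a + (real k + t) * h))"
definition "nv k = curve F' (knot k)"
definition "fb = map E [0..<m] @ map reversepath (rev (map fst Q))"
definition "lens = {pol r t |r t. a < t \<and> t < b \<and> F t < r \<and> r < F' t}"

lemma ab: "0 \<le> a" "a < b" "b \<le> 1" "t \<in> {a..b} \<Longrightarrow> t \<in> {0..1}"
  using arc_chain_le[OF X_chain] arc_chain_le[OF Y_chain] arc_chain_less[OF Q_chain Q_ne] by auto

lemma m_pos: "0 < m" using N_ne by (simp add: m_def)

lemma h_pos: "0 < h" using ab m_pos by (simp add: h_def)

lemma mh: "real m * h = b - a" using m_pos by (simp add: h_def)

lemma knot_0 [simp]: "knot 0 = a" and knot_m [simp]: "knot m = b"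
  using mh by (auto simp: knot_def)

lemma knot_Suc: "knot (Suc k) = knot k + h" by (simp add: knot_def algebra_simps)

lemma knot_less_iff [simp]: "knot k < knot l \<longleftrightarrow> k < l"
  using h_pos by (simp add: knot_def)

lemma knot_le_iff [simp]: "knot k \<le> knot l \<longleftrightarrow> k \<le> l"
  using h_pos by (simp add: knot_def)

lemma knot_in: "k \<le> m \<Longrightarrow> knot k \<in> {a..b}"
  using knot_le_iff[of 0 k] knot_le_iff[of k m] by (simp del: knot_le_iff)

lemma E_eq: "E k t = curve F' (knot k + t * h)"
  by (simp add: E_def knot_def algebra_simps)

lemma hat_pos: "a < t \<Longrightarrow> t < b \<Longrightarrow> 0 < hat t"
  by (simp add: hat_def)

lemma hat_nonneg: "t \<in> {a..b} \<Longrightarrow> 0 \<le> hat t"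
  by (simp add: hat_def)

lemma hat_nonpos: "t \<notin> {a<..<b} \<Longrightarrow> hat t \<le> 0"
  using ab(2) by (auto simp: hat_def mult_nonpos_nonneg mult_nonneg_nonpos)

lemma F'_in: "t \<in> {a..b} \<Longrightarrow> F' t = F t + hat t"
  using hat_nonneg by (simp add: F'_def)

lemma F'_out: "t \<notin> {a<..<b} \<Longrightarrow> F' t = F t"
  using hat_nonpos by (simp add: F'_def)

lemma F_le_F': "F t \<le> F' t" by (simp add: F'_def)

lemma F_less_F': "a < t \<Longrightarrow> t < b \<Longrightarrow> F t < F' t"
  using hat_pos[of t] by (simp add: F'_def)

lemma nv_0: "nv 0 = curve F a" and nv_m: "nv m = curve F b"
  using F'_out by (simp_all add: nv_def)

lemma radial': "radial F'"
  unfolding radial_def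
proof (intro conjI ballI)
  show "continuous_on {0..1} F'"
    unfolding F'_def hat_def by (intro continuous_intros radialD(1)[OF radial])
  show "0 < F' t" if "t \<in> {0..1}" for t using radialD(2)[OF radial that] F_le_F'[of t] by simp
  show "F' 0 = 1" "F' 1 = 1" using F'_out[of 0] F'_out[of 1] radialD[OF radial] ab by auto
qed

lemma new_notin: "a < t \<Longrightarrow> t < b \<Longrightarrow> F t < r \<Longrightarrow> pol r t \<notin> region F"
  using pol_in_region_iff[OF radial, of t r] radialD(2)[OF radial, of t] ab by auto

text \<open>Strictly between \<open>a\<close> and \<open>b\<close> the angle is neither 0 nor 1, so
  polar coordinates are unambiguous there, even if \<open>a = 0\<close> and
  \<open>b = 1\<close>.\<close>

lemma new_unique:
  assumes "pol r t = pol r' t'" "a < t" "t < b" "F t < r" "a < t'" "t' < b" "F t' < r'"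
  shows "r = r' \<and> t = t'"
  using pol_eqD[OF assms(1)] radialD(2)[OF radial, of t] radialD(2)[OF radial, of t'] assms ab by auto

lemma region'_eq: "region F' = region F \<union> {pol r t |r t. a < t \<and> t < b \<and> F t < r \<and> r \<le> F' t}"
proof (intro equalityI subsetI)
  fix z assume "z \<in> region F'"
  then have *: "norm z \<le> F' (turn z)" using in_region_iff[OF radial'] by blast
  show "z \<in> region F \<union> {pol r t |r t. a < t \<and> t < b \<and> F t < r \<and> r \<le> F' t}"
  proof (cases "norm z \<le> F (turn z)")
    case True then show ?thesis using in_region_iff[OF radial] by blast
  next
    case False
    then have "turn z \<in> {a<..<b}" using * F'_out[of "turn z"] by fastforce
    then show ?thesis using False * pol_turn[of z, symmetric] by fastforce
  qed
next
  fix z assume "z \<in> region F \<union> {pol r t |r t. a < t \<and> t < b \<and> F t < r \<and> r \<le> F' t}"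
  then show "z \<in> region F'"
  proof
    assume "z \<in> region F"
    then show ?thesis using in_region_iff[OF radial] in_region_iff[OF radial'] F_le_F' order_trans by blast
  next
    assume "z \<in> {pol r t |r t. a < t \<and> t < b \<and> F t < r \<and> r \<le> F' t}"
    then obtain r t where z: "z = pol r t" "a < t" "t < b" "F t < r" "r \<le> F' t" by blast
    then show ?thesis
      using pol_in_region_iff[OF radial', of t r] radialD(2)[OF radial, of t] ab by auto
  qed
qed

lemma E_simple: "k < m \<Longrightarrow> simple_path (E k)"
proof -
  assume k: "k < m"
  have in01: "knot k + t * h \<in> {0..1}" if "t \<in> {0..1}" for t
  proof -
    have "0 \<le> t * h" "t * h \<le> 1 * h" using that h_pos by (auto intro!: mult_right_mono)
    moreover have "knot k + h \<in> {a..b}" "knot k \<in> {a..b}"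
      using knot_in[of "Suc k"] knot_in[of k] k by (auto simp: knot_Suc)
    ultimately show ?thesis using ab(4)[of "knot k + t * h"] by auto
  qed
  have "path (E k)"
    unfolding path_def E_eq
    by (intro continuous_intros continuous_on_compose2[OF radialD(1)[OF radial']])
      (use in01 in auto)
  moreover have "loop_free (E k)"
    unfolding loop_free_def
  proof (intro ballI impI)
    fix x y :: real assume xy: "x \<in> {0..1}" "y \<in> {0..1}" "E k x = E k y"
    let ?x = "knot k + x * h" and ?y = "knot k + y * h"
    \<comment> \<open>The angle 0 can occur only at the start of the edge and the angle 1 only at
      its end. The one coincidence left is that of the two end points, which
      \<open>loop_free\<close> admits.\<close>
    have ends: "u = 0" if "knot k + u * h = 0" "u \<in> {0..1}" for u
    proof -
      have "0 \<le> knot k" using knot_in[of k] k ab by auto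
      then have "u * h \<le> 0" using that(1) by linarith
      then show ?thesis using h_pos that(2) by (auto simp: mult_le_0_iff)
    qed
    have ends': "u = 1" if "knot k + u * h = 1" "u \<in> {0..1}" for u
    proof -
      have "knot k + h \<le> 1" using knot_in[of "Suc k"] k ab by (auto simp: knot_Suc)
      then have "0 \<le> (u - 1) * h" using that(1) by (simp add: algebra_simps)
      then show ?thesis using h_pos that(2) by (auto simp: zero_le_mult_iff)
    qed
    have "?x = ?y \<or> ?x = 0 \<and> ?y = 1 \<or> ?x = 1 \<and> ?y = 0"
      using pol_eqD[of "F' ?x" ?x "F' ?y" ?y] xy in01[OF xy(1)] in01[OF xy(2)]
        radialD(2)[OF radial', of ?x] radialD(2)[OF radial', of ?y] by (auto simp: E_eq)
    then show "x = y \<or> x = 0 \<and> y = 1 \<or> x = 1 \<and> y = 0"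
      using ends ends' xy(1,2) h_pos by (metis add_left_cancel less_irrefl mult_right_cancel)
  qed
  ultimately show ?thesis by (simp add: simple_path_def)
qed

lemma E_start: "pathstart (E k) = nv k" and E_finish: "pathfinish (E k) = nv (Suc k)"
  by (simp_all add: pathstart_def pathfinish_def E_eq nv_def knot_Suc)

lemma E_open: "open_cell (Edge (E k)) = curve F' ` {knot k<..<knot (Suc k)}"
proof -
  have "(\<lambda>t. knot k + t * h) ` {0<..<1} = {knot k<..<knot (Suc k)}"
  proof (intro equalityI subsetI)
    fix x assume "x \<in> {knot k<..<knot (Suc k)}"
    then show "x \<in> (\<lambda>t. knot k + t * h) ` {0<..<1}"
      using h_pos by (intro image_eqI[of _ _ "(x - knot k) / h"]) (auto simp: knot_Suc field_simps)
  qed (use h_pos in \<open>auto simp: knot_Suc\<close>)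
  then show ?thesis by (simp add: E_eq image_image[symmetric, of "curve F'" "\<lambda>t. knot k + t * h"])
qed

lemma E_mid: "E k (1/2) = curve F' (knot k + h / 2)" by (simp add: E_eq)

lemma mid_in: "k < m \<Longrightarrow> a < knot k + h / 2 \<and> knot k + h / 2 < b"
  using knot_in[of k] knot_in[of "Suc k"] h_pos by (auto simp: knot_Suc)

text \<open>Midpoints tell the new edges apart: they lie off the old region at angles strictly
  between \<open>a\<close> and \<open>b\<close>, where the angle is determined, and reversal fixes
  them.\<close>

lemma E_mid_eq: "k < m \<Longrightarrow> l < m \<Longrightarrow> E k (1/2) = E l (1/2) \<Longrightarrow> k = l"
  using new_unique[of "F' (knot k + h / 2)" "knot k + h / 2" "F' (knot l + h / 2)" "knot l + h / 2"]
    mid_in[of k] mid_in[of l] F_less_F' h_pos by (auto simp: E_mid knot_def)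

lemma E_inj: "inj_on E {..<m}"
  by (intro inj_onI) (use E_mid_eq in force)

lemma E_not_rev: "k < m \<Longrightarrow> l < m \<Longrightarrow> E k \<noteq> reversepath (E l)"
proof
  assume k: "k < m" "l < m" and e: "E k = reversepath (E l)"
  then have "E k (1/2) = E l (1/2)" by (simp add: reversepath_def)
  then have "k = l" using E_mid_eq k by blast
  then have "E k (1/4) = E k (3/4)" using fun_cong[OF e, of "1/4"] by (simp add: reversepath_def)
  have lf: "\<forall>x\<in>{0..1}. \<forall>y\<in>{0..1}. E k x = E k y \<longrightarrow> x = y \<or> x = 0 \<and> y = 1 \<or> x = 1 \<and> y = 0"
    using E_simple[OF k(1)] by (simp add: simple_path_def loop_free_def)
  show False
    using bspec[OF bspec[OF lf, of "1/4"], of "3/4"] \<open>E k (1/4) = E k (3/4)\<close> by simp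
qed

lemma new_pt_not_old: "k < m \<Longrightarrow> E k \<notin> edges \<Delta>" "k < m \<Longrightarrow> reversepath (E k) \<notin> edges \<Delta>"
proof -
  have *: "e \<notin> edges \<Delta>" if "k < m" "e (1/2) = E k (1/2)" for e
  proof
    assume "e \<in> edges \<Delta>"
    then have "open_cell (Edge e) \<subseteq> region F" by (intro open_cell_region) (simp add: cells_def)
    then have "E k (1/2) \<in> region F" using that by (auto simp: subset_iff image_iff intro!: bexI[of _ "1/2"])
    then show False using new_notin mid_in[OF that(1)] F_less_F' by (auto simp: E_mid)
  qed
  show "k < m \<Longrightarrow> E k \<notin> edges \<Delta>" "k < m \<Longrightarrow> reversepath (E k) \<notin> edges \<Delta>"
    using * by (auto simp: reversepath_def)
qed

end

text \<open>The closed new cell in the coordinates angle and height over the old curve. They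
  straighten the old side to a segment, so the cell becomes convex whatever \<open>F\<close>
  is.\<close>

definition hat_set :: "real \<Rightarrow> real \<Rightarrow> complex set" where
  "hat_set a b = {z. a \<le> Re z \<and> Re z \<le> b \<and> 0 \<le> Im z \<and> Im z \<le> (Re z - a) * (b - Re z)}"

lemma convex_hat_set: "convex (hat_set a b)"
proof (rule convexI)
  fix x y :: complex and u v :: real
  assume x: "x \<in> hat_set a b" and y: "y \<in> hat_set a b" and uv: "0 \<le> u" "0 \<le> v" "u + v = 1"
  let ?f = "\<lambda>t. (t - a) * (b - t)"
  have "u * Re x + v * Re y \<le> u * b + v * b" "u * a + v * a \<le> u * Re x + v * Re y"
    using x y uv by (auto simp: hat_set_def intro!: add_mono mult_left_mono)
  moreover have "u * b + v * b = b" "u * a + v * a = a" using uv by (metis distrib_right mult_1)+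
  moreover have "0 \<le> u * Im x + v * Im y" using x y uv by (auto simp: hat_set_def)
  moreover have "u * Im x + v * Im y \<le> ?f (u * Re x + v * Re y)"
  proof -
    have "u * Im x + v * Im y \<le> u * ?f (Re x) + v * ?f (Re y)"
      using x y uv by (auto simp: hat_set_def intro!: add_mono mult_left_mono)
    \<comment> \<open>For a quadratic with leading coefficient -1 the defect of concavity is exactly
      \<open>u * v * (Re x - Re y)\<^sup>2\<close>.\<close>
    also have "\<dots> \<le> u * ?f (Re x) + v * ?f (Re y) + u * v * (Re x - Re y)\<^sup>2"
      using uv by simp
    also have "\<dots> = ?f (u * Re x + v * Re y)"
    proof -
      have v: "v = 1 - u" using uv by simp
      show ?thesis unfolding v by (simp add: algebra_simps power2_eq_square)
    qed
    finally show ?thesis .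
  qed
  ultimately show "u *\<^sub>R x + v *\<^sub>R y \<in> hat_set a b" by (simp add: hat_set_def)
qed

lemma closed_hat_set: "closed (hat_set a b)"
  unfolding hat_set_def
  by (intro closed_Collect_conj closed_Collect_le continuous_intros)

text \<open>An interior point can be moved vertically both ways inside the set, so both height
  inequalities are strict; at the abscissae \<open>a\<close> and \<open>b\<close> they would
  contradict each other.\<close>

lemma interior_hat_set:
  "interior (hat_set a b) = {z. a < Re z \<and> Re z < b \<and> 0 < Im z \<and> Im z < (Re z - a) * (b - Re z)}"
  (is "_ = ?U")
proof
  have "open ?U" by (intro open_Collect_conj open_Collect_less continuous_intros)
  then show "?U \<subseteq> interior (hat_set a b)" by (intro interior_maximal) (auto simp: hat_set_def)
next
  show "interior (hat_set a b) \<subseteq> ?U"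
  proof
    fix z assume "z \<in> interior (hat_set a b)"
    then obtain e where e: "0 < e" "ball z e \<subseteq> hat_set a b" by (auto simp: mem_interior)
    then have *: "z \<in> hat_set a b" "z + Complex 0 (e/2) \<in> hat_set a b" "z - Complex 0 (e/2) \<in> hat_set a b"
      by (auto simp: subset_iff dist_norm complex_norm)
    then have "0 < Im z" "Im z < (Re z - a) * (b - Re z)" using e(1) by (auto simp: hat_set_def)
    moreover then have "Re z \<noteq> a" "Re z \<noteq> b" by auto
    ultimately show "z \<in> ?U" using *(1) by (auto simp: hat_set_def)
  qed
qed

context cell_gluing
begin

text \<open>The cone over the boundary of the flattened cell, followed by the chart back to the
  plane. Injectivity of the chart is claimed on the interior: if \<open>a = 0\<close> and
  \<open>b = 1\<close>, both tips of the cell go to the base point.\<close>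

lemma face_exists:
  "\<exists>\<sigma>. continuous_on (cball 0 1) \<sigma> \<and> inj_on \<sigma> (ball 0 1) \<and> \<sigma> ` ball 0 1 = lens \<and> traverses \<sigma> (\<sigma> 1) fb"
proof -
  let ?n = "length Q" and ?S = "hat_set a b"
  obtain \<tau> where \<tau>: "continuous_on {0..real ?n} \<tau>" "strict_mono_on {0..real ?n} \<tau>" "\<tau> 0 = a" "\<tau> (real ?n) = b"
    "\<And>k t. k < ?n \<Longrightarrow> t \<in> {0..1} \<Longrightarrow> fst (Q ! k) t = curve F (\<tau> (real k + t))"
    using arc_chain_param[OF Q_chain] by blast
  have \<tau>_less: "\<tau> x < \<tau> y" if "0 \<le> x" "x < y" "y \<le> real ?n" for x y
    using \<tau>(2) that by (auto simp: strict_mono_on_def)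
  have n_pos: "0 < ?n" using Q_ne by simp
  define T where "T = real m + real ?n"
  have T: "0 < T" "real m < T" using m_pos n_pos by (auto simp: T_def)
  \<comment> \<open>Up to time \<open>m\<close> the loop follows the new side, one unit per edge;
    then it returns along the old side, where \<open>\<tau>\<close> makes every old edge one unit
    long as well.\<close>
  define g where "g = (\<lambda>y. if y \<le> real m then Complex (a + y * h) (hat (a + y * h)) else Complex (\<tau> (T - y)) 0)"
  have g_up: "g y = Complex (a + y * h) (hat (a + y * h))" if "y \<le> real m" for y using that by (simp add: g_def)
  have g_low: "g y = Complex (\<tau> (T - y)) 0" if "real m \<le> y" for y
    using that mh \<tau>(4) by (cases "y = real m") (auto simp: g_def hat_def T_def)
  define \<gamma> where "\<gamma> = (\<lambda>x. g (T * x))"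
  have up_in: "a + y * h \<in> {a..b}" if "0 \<le> y" "y \<le> real m" for y
  proof -
    have "0 \<le> y * h" "y * h \<le> real m * h" using that h_pos by (auto intro!: mult_right_mono)
    then show ?thesis using mh by simp
  qed
  have low_in: "\<tau> (T - y) \<in> {a..b}" if "real m \<le> y" "y \<le> T" for y
  proof -
    have "0 \<le> T - y" "T - y \<le> real ?n" using that by (auto simp: T_def)
    then show ?thesis using \<tau>_less[of 0 "T - y"] \<tau>_less[of "T - y" "real ?n"] \<tau>(3,4)
      by (cases "T - y = 0"; cases "T - y = real ?n") auto
  qed
  have g_cont: "continuous_on {0..T} g"
  proof -
    have "continuous_on ({0..real m} \<union> {real m..T}) g"
    proof (rule continuous_on_closed_Un)
      have "continuous_on {0..real m} (\<lambda>y. Complex (a + y * h) (hat (a + y * h)))"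
        unfolding Complex_eq hat_def by (intro continuous_intros)
      then show "continuous_on {0..real m} g" by (rule continuous_on_eq) (simp add: g_up)
      have "continuous_on {real m..T} (\<lambda>y. Complex (\<tau> (T - y)) 0)"
        unfolding Complex_eq
        by (intro continuous_intros continuous_on_compose2[OF \<tau>(1)]) (auto simp: T_def)
      then show "continuous_on {real m..T} g" by (rule continuous_on_eq) (simp add: g_low)
    qed auto
    moreover have "{0..real m} \<union> {real m..T} = {0..T}" using T by auto
    ultimately show ?thesis by simp
  qed
  have Tx: "0 \<le> T * x" "T * x \<le> T" if "x \<in> {0..1}" for x
    using that T mult_left_mono[of x 1 T] by auto
  have \<gamma>_cont: "continuous_on {0..1} \<gamma>"
    unfolding \<gamma>_def by (intro continuous_on_compose2[OF g_cont] continuous_intros) (use Tx in auto)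
  have g_fr: "g y \<in> frontier ?S" if "0 \<le> y" "y \<le> T" for y
  proof (cases "y \<le> real m")
    case True
    then have "a + y * h \<in> {a..b}" using up_in that by simp
    then show ?thesis using hat_nonneg[of "a + y * h"] True
      unfolding frontier_def closure_closed[OF closed_hat_set] interior_hat_set
      by (simp add: g_up hat_set_def hat_def)
  next
    case False
    then have "\<tau> (T - y) \<in> {a..b}" using low_in that by simp
    then show ?thesis using hat_nonneg[of "\<tau> (T - y)"] False
      unfolding frontier_def closure_closed[OF closed_hat_set] interior_hat_set
      by (simp add: g_low hat_set_def hat_def)
  qed
  have g_inj: "x = y" if "0 \<le> x" "x \<le> y" "y < T" "g x = g y" for x y
  proof -
    consider "y \<le> real m" | "real m \<le> x" | "x < real m" "real m < y" by linarith
    then show ?thesis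
    proof cases
      case 1 then show ?thesis using that h_pos by (simp add: g_up)
    next
      case 2
      then have "\<tau> (T - x) = \<tau> (T - y)" using that by (simp add: g_low)
      then show ?thesis using \<tau>_less[of "T - y" "T - x"] 2 that by (cases "x = y") (auto simp: T_def)
    next
      case 3
      then have "Complex (a + x * h) (hat (a + x * h)) = Complex (\<tau> (T - y)) 0"
        using that(4) g_up[of x] g_low[of y] 3 by (metis less_imp_le)
      then have "a + x * h = \<tau> (T - y)" "hat (a + x * h) = 0" unfolding complex.inject by blast+
      moreover have "x * h < real m * h" using 3 h_pos by simp
      then have "a + x * h < b" using mh by simp
      moreover have "a < \<tau> (T - y)" using \<tau>_less[of 0 "T - y"] that 3 \<tau>(3) by (auto simp: T_def)
      ultimately show ?thesis using hat_pos[of "a + x * h"] by simp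
    qed
  qed
  have "inj_on \<gamma> {0..<1}"
  proof (rule inj_onI)
    fix x y :: real assume xy: "x \<in> {0..<1}" "y \<in> {0..<1}" "\<gamma> x = \<gamma> y"
    then have "0 \<le> T * x" "0 \<le> T * y" "T * x < T" "T * y < T" using T by auto
    then have "T * x = T * y"
      using g_inj[of "T * x" "T * y"] g_inj[of "T * y" "T * x"] xy(3) unfolding \<gamma>_def by (metis linear)
    then show "x = y" using T by simp
  qed
  moreover have "\<gamma> 0 = \<gamma> 1"
    using g_up[of 0] g_low[of T] T \<tau>(3) by (simp add: \<gamma>_def hat_def)
  moreover have "\<gamma> ` {0..1} \<subseteq> frontier ?S" using g_fr Tx by (auto simp: \<gamma>_def)
  \<comment> \<open>The cone point lies over the midpoint of the interval, at half the height of the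
    bump.\<close>
  moreover have "Complex ((a + b) / 2) ((b - a)\<^sup>2 / 8) \<in> interior ?S"
  proof -
    have eq: "((a + b) / 2 - a) * (b - (a + b) / 2) = (b - a)\<^sup>2 / 4"
      by (simp add: field_simps power2_eq_square)
    have "0 < (b - a)\<^sup>2" using ab by simp
    then show ?thesis using ab(2)
      unfolding interior_hat_set mem_Collect_eq complex.sel eq by (auto simp: less_divide_eq)
  qed
  ultimately obtain \<sigma>0 where \<sigma>0: "continuous_on (cball 0 1) \<sigma>0" "inj_on \<sigma>0 (ball 0 1)"
    "\<sigma>0 ` ball 0 1 = interior ?S" "\<sigma>0 ` cball 0 1 \<subseteq> ?S"
    "\<And>x. x \<in> {0..1} \<Longrightarrow> \<sigma>0 (cis (2 * pi * x)) = \<gamma> x"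
    using convex_cone_map[OF convex_hat_set closed_hat_set _ \<gamma>_cont] by metis
  define chart where "chart = (\<lambda>z. pol (F (Re z) + Im z) (Re z))"
  have chart_cont: "continuous_on ?S chart"
    unfolding chart_def
    by (intro continuous_intros continuous_on_compose2[OF radialD(1)[OF radial]])
      (use ab in \<open>auto simp: hat_set_def\<close>)
  have chart_inj: "inj_on chart (interior ?S)"
  proof (rule inj_onI)
    fix w z assume "w \<in> interior ?S" "z \<in> interior ?S" "chart w = chart z"
    then show "w = z"
      using new_unique[of "F (Re w) + Im w" "Re w" "F (Re z) + Im z" "Re z"]
      by (auto simp: chart_def interior_hat_set complex_eq_iff)
  qed
  have chart_img: "chart ` interior ?S = lens"
  proof (intro equalityI subsetI)
    fix z assume "z \<in> lens"
    then obtain r t where z: "z = pol r t" "a < t" "t < b" "F t < r" "r < F' t" unfolding lens_def by blast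
    then show "z \<in> chart ` interior ?S"
      using F'_in[of t]
      by (intro image_eqI[of _ _ "Complex t (r - F t)"]) (auto simp: chart_def interior_hat_set hat_def)
  next
    fix z assume "z \<in> chart ` interior ?S"
    then obtain w where w: "w \<in> interior ?S" "z = chart w" by blast
    then have "F' (Re w) = F (Re w) + (Re w - a) * (b - Re w)"
      using F'_in[of "Re w"] by (simp add: interior_hat_set hat_def)
    then show "z \<in> lens" using w unfolding lens_def mem_Collect_eq
      by (intro exI[of _ "F (Re w) + Im w"] exI[of _ "Re w"]) (auto simp: interior_hat_set chart_def)
  qed
  let ?\<sigma> = "chart \<circ> \<sigma>0"
  have "continuous_on (cball 0 1) ?\<sigma>"
    by (rule continuous_on_compose[OF \<sigma>0(1) continuous_on_subset[OF chart_cont \<sigma>0(4)]])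
  moreover have "inj_on ?\<sigma> (ball 0 1)"
    using comp_inj_on[OF \<sigma>0(2)] chart_inj \<sigma>0(3) by metis
  moreover have "?\<sigma> ` ball 0 1 = lens" using chart_img \<sigma>0(3) by (metis image_comp)
  moreover have "traverses ?\<sigma> (?\<sigma> 1) fb"
  proof -
    have len: "length fb = m + ?n" by (simp add: fb_def)
    have "?\<sigma> (cis (2 * pi * (real k + t) / real (length fb))) = (fb ! k) t"
      if k: "k < length fb" and t: "t \<in> {0..1}" for k t
    proof -
      let ?y = "real k + t"
      have y: "0 \<le> ?y" "?y \<le> T" using k t by (auto simp: len T_def)
      have "cis (2 * pi * ?y / real (length fb)) = cis (2 * pi * (?y / T))"
        by (simp add: len T_def)
      moreover have "?y / T \<in> {0..1}" using y T by auto
      ultimately have s: "?\<sigma> (cis (2 * pi * ?y / real (length fb))) = chart (g ?y)"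
        using \<sigma>0(5)[of "?y / T"] T by (simp add: \<gamma>_def)
      show ?thesis
      proof (cases "k < m")
        case True
        then have "?y \<le> real m" using t by auto
        then have "chart (g ?y) = E k t"
          using F'_in[OF up_in[of ?y]] y by (simp add: g_up chart_def E_def)
        then show ?thesis using s True by (simp add: fb_def nth_append)
      next
        case False
        \<comment> \<open>The old edges are passed in reverse order and direction, so the local time
          \<open>t\<close> becomes \<open>1 - t\<close>.\<close>
        let ?j = "?n - 1 - (k - m)"
        have j: "?j < ?n" "real ?j + (1 - t) = T - ?y" using False k by (auto simp: len T_def)
        have "fb ! k = reversepath (fst (Q ! ?j))"
          using False k by (simp add: fb_def nth_append rev_nth len)
        then have "(fb ! k) t = curve F (\<tau> (real ?j + (1 - t)))"
          using \<tau>(5)[of ?j "1 - t"] j(1) t by (simp add: reversepath_def)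
        moreover have "chart (g ?y) = curve F (\<tau> (T - ?y))"
          using False t by (simp add: g_low chart_def)
        ultimately show ?thesis using s unfolding j(2) by (metis (no_types))
      qed
    qed
    moreover have "fb \<noteq> []" using len m_pos by auto
    ultimately show ?thesis unfolding traverses_def by auto
  qed
  ultimately show ?thesis by blast
qed


section \<open>The enlarged planar complex\<close>

definition "\<sigma> = (SOME \<sigma>. continuous_on (cball 0 1) \<sigma> \<and> inj_on \<sigma> (ball 0 1) \<and> \<sigma> ` ball 0 1 = lens \<and>
   traverses \<sigma> (\<sigma> 1) fb)"

lemma \<sigma>: "continuous_on (cball 0 1) \<sigma>" "inj_on \<sigma> (ball 0 1)" "\<sigma> ` ball 0 1 = lens" "traverses \<sigma> (\<sigma> 1) fb"
  using someI_ex[OF face_exists, folded \<sigma>_def] by auto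

text \<open>Edges are functions, so the index of a new edge has to be recovered by
  \<open>inv_into\<close>. This is unambiguous: the new edges are pairwise distinct, none is the
  reversal of another or of itself, and none is old.\<close>

definition "label' e =
  (if e \<in> edges \<Delta> then label \<Delta> e
   else if e \<in> E ` {..<m} then fst (N ! inv_into {..<m} E e)
   else inv (fst (N ! inv_into {..<m} E (reversepath e))))"

definition "NV = nv ` {0<..<m}"
definition "NE = E ` {..<m} \<union> reversepath ` E ` {..<m}"

definition "\<Delta>' = \<Delta>\<lparr>verts := verts \<Delta> \<union> NV, edges := edges \<Delta> \<union> NE, faces := insert \<sigma> (faces \<Delta>),
  bdry := (bdry \<Delta>)(\<sigma> := fb), label := label'\<rparr>"

lemma \<Delta>'_simps [simp]:
  "verts \<Delta>' = verts \<Delta> \<union> NV" "edges \<Delta>' = edges \<Delta> \<union> NE" "faces \<Delta>' = insert \<sigma> (faces \<Delta>)"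
  "bdry \<Delta>' = (bdry \<Delta>)(\<sigma> := fb)" "label \<Delta>' = label'" "src \<Delta>' = pathstart" "flip \<Delta>' = reversepath"
  "base \<Delta>' = base \<Delta>"
  by (simp_all add: \<Delta>'_def)

definition "new_cells = Vertex ` NV \<union> Edge ` NE \<union> {Face \<sigma>}"

lemma cells': "cells \<Delta>' = cells \<Delta> \<union> new_cells"
  by (auto simp: cells_def new_cells_def)

text \<open>Each point of a new cell is given an angle strictly between \<open>a\<close> and
  \<open>b\<close>, where coordinates are unique, so the coordinates alone decide which new cell
  contains it. Disjointness of the new cells from each other and from the old region is read off
  from this form.\<close>

lemma new_cell_pt:
  assumes "c \<in> new_cells" "z \<in> open_cell c"
  obtains r t where "z = pol r t" "a < t" "t < b" "F t < r" "r \<le> F' t"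
    "(c = Face \<sigma> \<and> r < F' t) \<or>
     (r = F' t \<and> (\<exists>k. 0 < k \<and> k < m \<and> t = knot k \<and> c = Vertex (nv k))) \<or>
     (r = F' t \<and> (\<exists>k<m. knot k < t \<and> t < knot (Suc k) \<and> (c = Edge (E k) \<or> c = Edge (reversepath (E k)))))"
proof -
  consider (f) "c = Face \<sigma>" | (v) k where "0 < k" "k < m" "c = Vertex (nv k)"
    | (e) k where "k < m" "c = Edge (E k) \<or> c = Edge (reversepath (E k))"
    using assms(1) by (auto simp: new_cells_def NV_def NE_def)
  then show ?thesis
  proof cases
    case f
    then have "z \<in> lens" using assms(2) \<sigma>(3) by simp
    then obtain r t where "z = pol r t" "a < t" "t < b" "F t < r" "r < F' t" unfolding lens_def by blast
    then show ?thesis using that[of r t] f by simp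
  next
    case v
    then have "a < knot k" "knot k < b" using knot_less_iff[of 0 k] knot_less_iff[of k m] by simp_all
    then show ?thesis using that[of "F' (knot k)" "knot k"] v assms(2) F_less_F' by (auto simp: nv_def)
  next
    case e
    then have "z \<in> curve F' ` {knot k<..<knot (Suc k)}"
      using assms(2) E_open by (metis open_cell_reversepath)
    then obtain t where t: "z = curve F' t" "knot k < t" "t < knot (Suc k)" by auto
    moreover have "a \<le> knot k" "knot (Suc k) \<le> b" using knot_in[of k] knot_in[of "Suc k"] e by auto
    ultimately have "a < t" "t < b" by linarith+
    then show ?thesis using that[of "F' t" t] t e F_less_F' by blast
  qed
qed

lemma new_cell_notin: "c \<in> new_cells \<Longrightarrow> z \<in> open_cell c \<Longrightarrow> z \<notin> region F"
  by (elim new_cell_pt) (use new_notin in auto)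

text \<open>A face is identified with its characteristic map. The centre of the new one is mapped
  off the old region, so updating \<open>bdry\<close> at \<open>\<sigma>\<close> leaves the old
  faces alone.\<close>

lemma \<sigma>_new: "\<sigma> \<notin> faces \<Delta>"
proof
  assume "\<sigma> \<in> faces \<Delta>"
  then have sub: "\<sigma> ` ball 0 1 \<subseteq> region F" using open_cell_region[of "Face \<sigma>"] by (simp add: cells_def)
  have \<sigma>0: "\<sigma> 0 \<in> \<sigma> ` ball 0 1" by simp
  then have "\<sigma> 0 \<notin> region F" using new_cell_notin[of "Face \<sigma>" "\<sigma> 0"] by (simp add: new_cells_def)
  then show False using subsetD[OF sub \<sigma>0] by (rule notE)
qed

lemma new_cells_disjoint:
  assumes "c \<in> new_cells" "c' \<in> new_cells" "z \<in> open_cell c" "z \<in> open_cell c'"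
  shows "c = c' \<or> (\<exists>e. c = Edge e \<and> c' = Edge (reversepath e))"
proof -
  obtain r t where 1: "z = pol r t" "a < t" "t < b" "F t < r" "r \<le> F' t"
    "(c = Face \<sigma> \<and> r < F' t) \<or>
     (r = F' t \<and> (\<exists>k. 0 < k \<and> k < m \<and> t = knot k \<and> c = Vertex (nv k))) \<or>
     (r = F' t \<and> (\<exists>k<m. knot k < t \<and> t < knot (Suc k) \<and> (c = Edge (E k) \<or> c = Edge (reversepath (E k)))))"
    by (rule new_cell_pt[OF assms(1,3)])
  obtain r' t' where 2: "z = pol r' t'" "a < t'" "t' < b" "F t' < r'" "r' \<le> F' t'"
    "(c' = Face \<sigma> \<and> r' < F' t') \<or>
     (r' = F' t' \<and> (\<exists>k. 0 < k \<and> k < m \<and> t' = knot k \<and> c' = Vertex (nv k))) \<or>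
     (r' = F' t' \<and> (\<exists>k<m. knot k < t' \<and> t' < knot (Suc k) \<and> (c' = Edge (E k) \<or> c' = Edge (reversepath (E k)))))"
    by (rule new_cell_pt[OF assms(2,4)])
  have eq: "r' = r" "t' = t" using new_unique[of r t r' t'] 1(1-4) 2(1-4) by auto
  have kk: "k = l" if "knot k < t" "t < knot (Suc k)" "knot l < t" "t < knot (Suc l)" for k l
  proof -
    have "knot k < knot (Suc l)" "knot l < knot (Suc k)" using that by linarith+
    then show ?thesis by simp
  qed
  have kv: False if "knot k < knot l" "knot l < knot (Suc k)" for k l
    using that by simp
  have rr: "reversepath (reversepath e) = e" for e :: "real \<Rightarrow> complex" by simp
  have vv: "k = l" if "knot k = knot l" for k l
    using that knot_less_iff[of k l] knot_less_iff[of l k] by linarith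
  show ?thesis
    using 1(6) 2(6)[unfolded eq]
  proof (elim disjE conjE exE)
    fix k l assume "knot k < t" "t < knot (Suc k)" "knot l < t" "t < knot (Suc l)"
      "c = Edge (reversepath (E k))" "c' = Edge (E l)"
    then show ?thesis using kk rr by metis
  next
    fix k l assume "knot k < t" "t < knot (Suc k)" "knot l < t" "t < knot (Suc l)"
      "c = Edge (E k)" "c' = Edge (reversepath (E l))"
    then show ?thesis using kk by metis
  next
    fix k l assume "knot k < t" "t < knot (Suc k)" "knot l < t" "t < knot (Suc l)"
      "c = Edge (E k)" "c' = Edge (E l)"
    then show ?thesis using kk by metis
  next
    fix k l assume "knot k < t" "t < knot (Suc k)" "knot l < t" "t < knot (Suc l)"
      "c = Edge (reversepath (E k))" "c' = Edge (reversepath (E l))"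
    then show ?thesis using kk by metis
  next
    fix k l assume "t = knot k" "t = knot l" "c = Vertex (nv k)" "c' = Vertex (nv l)"
    then show ?thesis using vv by metis
  qed (use kv in \<open>auto simp del: knot_less_iff\<close>)
qed

lemma Q_edge: "e \<in> set (map fst Q) \<Longrightarrow> e \<in> edges \<Delta>"
  using arc_chain_edges[OF Q_chain] by auto

lemma set_fb: "set fb = E ` {..<m} \<union> reversepath ` set (map fst Q)"
  "reversepath ` set (map fst Q) \<subseteq> edges \<Delta>"
  using edgeD(2) Q_edge by (auto simp: fb_def)

lemma fb_edges: "set fb \<subseteq> edges \<Delta> \<union> NE"
  using set_fb unfolding NE_def by blast

lemma rev_NE: "e \<in> NE \<Longrightarrow> reversepath e \<in> NE"
  by (auto simp: NE_def)

lemma nv_vert: "k \<le> m \<Longrightarrow> nv k \<in> verts \<Delta> \<union> NV"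
proof -
  assume "k \<le> m"
  consider "k = 0" | "k = m" | "0 < k" "k < m" using \<open>k \<le> m\<close> by linarith
  then show ?thesis using chain_verts[OF Q_chain Q_ne] by cases (auto simp: nv_0 nv_m NV_def)
qed

lemma NE_ends: "e \<in> NE \<Longrightarrow> (\<exists>k\<le>m. pathstart e = nv k) \<and> (\<exists>k\<le>m. pathfinish e = nv k)"
  by (auto simp: NE_def E_start E_finish) (metis less_imp_le Suc_leI)+

lemma planar': "planar_complex \<Delta>'"
  unfolding planar_complex_def
proof (intro conjI ballI impI)
  show "finite (verts \<Delta>')" "finite (edges \<Delta>')" "finite (faces \<Delta>')"
    using planar_finite by (auto simp: NV_def NE_def)
  show "src \<Delta>' = pathstart" "flip \<Delta>' = reversepath" by simp_all
next
  fix e assume e: "e \<in> edges \<Delta>'"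
  show "simple_path e"
    using e edgeD(1) E_simple by (auto simp: NE_def simple_path_reversepath)
  show "reversepath e \<in> edges \<Delta>'" using e edgeD(2) rev_NE by auto
  show "pathstart e \<in> verts \<Delta>'" using e edgeD(3) NE_ends nv_vert by fastforce
next
  fix \<tau> assume "\<tau> \<in> faces \<Delta>'"
  then have \<tau>: "\<tau> = \<sigma> \<or> \<tau> \<in> faces \<Delta> \<and> \<tau> \<noteq> \<sigma>" using \<sigma>_new by auto
  show "continuous_on (cball 0 1) \<tau>" "inj_on \<tau> (ball 0 1)" using \<tau> \<sigma>(1,2) faceD(1,2) by auto
  show "bdry \<Delta>' \<tau> \<noteq> []" using \<tau> faceD(3) m_pos by (auto simp: fb_def)
  show "set (bdry \<Delta>' \<tau>) \<subseteq> edges \<Delta>'"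
    using \<tau> faceD(4) fb_edges by auto
  show "traverses \<tau> (\<tau> 1) (bdry \<Delta>' \<tau>)" using \<tau> \<sigma>(4) faceD(5) by auto
next
  fix c c' assume c: "c \<in> cells \<Delta>'" "c' \<in> cells \<Delta>'" "open_cell c \<inter> open_cell c' \<noteq> {}"
  then obtain z where z: "z \<in> open_cell c" "z \<in> open_cell c'" by blast
  show "c = c' \<or> (\<exists>e. c = Edge e \<and> c' = Edge (reversepath e))"
  proof (cases "z \<in> region F")
    case True
    then have "c \<in> cells \<Delta>" "c' \<in> cells \<Delta>" using c z new_cell_notin unfolding cells' by blast+
    then show ?thesis using cells_disjoint z by blast
  next
    case False
    then have "c \<in> new_cells" "c' \<in> new_cells" using c z open_cell_region unfolding cells' by blast+
    then show ?thesis using new_cells_disjoint z by blast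
  qed
qed

lemma new_cells_cover:
  assumes "a < t" "t < b" "F t < r" "r \<le> F' t"
  shows "\<exists>c\<in>new_cells. pol r t \<in> open_cell c"
proof (cases "r < F' t")
  case True
  then have "pol r t \<in> lens" using assms unfolding lens_def by blast
  then show ?thesis using \<sigma>(3) by (intro bexI[of _ "Face \<sigma>"]) (auto simp: new_cells_def)
next
  case False
  then have r: "r = F' t" using assms by simp
  define k where "k = nat \<lfloor>(t - a) / h\<rfloor>"
  have q: "0 \<le> (t - a) / h" using assms h_pos by simp
  then have "real k \<le> (t - a) / h" "(t - a) / h < real k + 1"
    unfolding k_def by linarith+
  then have kt: "knot k \<le> t" "t < knot (Suc k)"
    using h_pos by (simp_all add: knot_def field_simps)
  have "knot k < knot m" using kt assms by simp
  then have "k < m" using knot_less_iff by blast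
  show ?thesis
  proof (cases "knot k = t")
    case True
    then have "0 < k" using assms(1) by (cases "k = 0") auto
    then show ?thesis using \<open>k < m\<close> True r
      by (intro bexI[of _ "Vertex (nv k)"]) (auto simp: new_cells_def NV_def nv_def)
  next
    case False
    then have "pol r t \<in> open_cell (Edge (E k))" using kt r unfolding E_open by auto
    then show ?thesis using \<open>k < m\<close> by (intro bexI[of _ "Edge (E k)"]) (auto simp: new_cells_def NE_def)
  qed
qed

lemma support': "support \<Delta>' = region F'"
proof -
  have "(\<Union>c\<in>new_cells. open_cell c) = {pol r t |r t. a < t \<and> t < b \<and> F t < r \<and> r \<le> F' t}"
  proof (intro equalityI subsetI)
    fix z assume "z \<in> (\<Union>c\<in>new_cells. open_cell c)"
    then show "z \<in> {pol r t |r t. a < t \<and> t < b \<and> F t < r \<and> r \<le> F' t}"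
      by (auto elim!: new_cell_pt)
  qed (use new_cells_cover in auto)
  then show ?thesis
    unfolding support_def cells' region'_eq using supp unfolding support_def by auto
qed


section \<open>Labels, distances and group values on the new cell\<close>

abbreviation "wN \<equiv> map fst N"
abbreviation "wQ \<equiv> map (label \<Delta> \<circ> fst) Q"

lemma curve_a_vert: "curve F a \<in> verts \<Delta>" and curve_b_vert: "curve F b \<in> verts \<Delta>"
  using chain_verts[OF Q_chain Q_ne] by blast+

lemma label'_old: "e \<in> edges \<Delta> \<Longrightarrow> label' e = label \<Delta> e"
  by (simp add: label'_def)

lemma label'_E: "k < m \<Longrightarrow> label' (E k) = fst (N ! k)"
  using new_pt_not_old(1) E_inj by (simp add: label'_def)

lemma label'_rev_E: "k < m \<Longrightarrow> label' (reversepath (E k)) = inv (fst (N ! k))"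
proof -
  assume k: "k < m"
  then have "reversepath (E k) \<notin> E ` {..<m}" using E_not_rev by force
  then show ?thesis using new_pt_not_old(2)[OF k] E_inj k by (simp add: label'_def)
qed

lemma N_in_A: "k < m \<Longrightarrow> fst (N ! k) \<in> A"
  using N_A by (auto simp: m_def in_lists_conv_set)

lemma edges'_cases:
  assumes "e \<in> edges \<Delta>'"
  obtains "e \<in> edges \<Delta>" | k where "k < m" "e = E k" | k where "k < m" "e = reversepath (E k)"
  using assms by (auto simp: NE_def)

lemma label'_A: "e \<in> edges \<Delta>' \<Longrightarrow> label' e \<in> A"
  by (erule edges'_cases) (auto simp: label'_old label_A label'_E label'_rev_E N_in_A A_inv)

lemma label'_rev: "e \<in> edges \<Delta>' \<Longrightarrow> label' (reversepath e) = inv (label' e)"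
  by (erule edges'_cases)
    (auto simp: label'_old label_rev edgeD(2) label'_E label'_rev_E N_in_A A_closed)

text \<open>Around the new cell one reads \<open>wN @ inv_word wQ\<close>. Both sides have the same
  value and together at most \<open>2 * K + 2\<close> letters, so this is a short relator.\<close>

lemma face'_R: "\<tau> \<in> faces \<Delta>' \<Longrightarrow> map label' (bdry \<Delta>' \<tau>) \<in> short_relators G A K"
proof -
  assume \<tau>: "\<tau> \<in> faces \<Delta>'"
  show ?thesis
  proof (cases "\<tau> = \<sigma>")
    case False
    then have \<tau>': "\<tau> \<in> faces \<Delta>" using \<tau> by simp
    have "map label' (bdry \<Delta> \<tau>) = map (label \<Delta>) (bdry \<Delta> \<tau>)"
      using faceD(4)[OF \<tau>'] by (auto simp: label'_old)
    moreover have "bdry \<Delta>' \<tau> = bdry \<Delta> \<tau>" using False by simp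
    ultimately show ?thesis using face_R[OF \<tau>'] by metis
  next
    case True
    have 1: "map label' (map E [0..<m]) = wN"
      by (rule nth_equalityI) (auto simp: m_def label'_E[unfolded m_def])
    have 2: "map label' (map reversepath (rev (map fst Q))) = inv_word wQ"
    proof -
      have "label' (reversepath e) = inv (label \<Delta> e)" if "e \<in> set (map fst Q)" for e
        using label'_rev[of e] label'_old Q_edge[OF that] by simp
      then show ?thesis by (simp add: inv_word_def rev_map)
    qed
    have Q: "wQ \<in> lists A" using arc_chain_edges[OF Q_chain] label_A by fastforce
    have "map label' fb = wN @ inv_word wQ" using 1 2 by (simp add: fb_def)
    moreover have "word_val G (wN @ inv_word wQ) = \<one>"
      using word_val_append[OF N_A inv_word_in_lists[OF Q]] word_val_inv_word[OF Q] N_val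
        word_val_closed[OF Q] by simp
    moreover have "wN @ inv_word wQ \<in> lists A"
      using N_A inv_word_in_lists[OF Q] by (simp del: in_lists_conv_set)
    ultimately show ?thesis using True short N_ne by (simp add: short_relators_def del: in_lists_conv_set)
  qed
qed

lemma reach_old: "reach \<Delta> v n \<Longrightarrow> reach \<Delta>' v n"
  unfolding reach_def using edge_path_mono[of \<Delta> \<Delta>'] by fastforce

lemma reach'_edge: "e \<in> edges \<Delta>' \<Longrightarrow> reach \<Delta>' (pathstart e) n \<Longrightarrow> reach \<Delta>' (pathfinish e) (Suc n)"
proof -
  assume e: "e \<in> edges \<Delta>'" "reach \<Delta>' (pathstart e) n"
  then obtain p where p: "edge_path \<Delta>' (base \<Delta>') p (pathstart e)" "length p \<le> n" by (auto simp: reach_def)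
  have "pathfinish e \<in> verts \<Delta>'" using e(1) edgeD(4) NE_ends nv_vert by fastforce
  then have "edge_path \<Delta>' (base \<Delta>') (p @ [e]) (tgt \<Delta>' e)"
    using edge_path_snoc[of \<Delta>' _ p "pathstart e" e] e p by simp
  then show ?thesis using p(2) unfolding reach_def by (intro exI[of _ "p @ [e]"]) simp
qed

lemma reach'_forward: "reach \<Delta> (curve F a) n \<Longrightarrow> k \<le> m \<Longrightarrow> reach \<Delta>' (nv k) (n + k)"
proof (induction k)
  case 0
  then show ?case using reach_old by (simp add: nv_0)
next
  case (Suc k)
  have "E k \<in> edges \<Delta>'" using Suc by (auto simp: NE_def)
  then show ?case using reach'_edge[of "E k" "n + k"] Suc by (simp add: E_start E_finish)
qed

lemma reach'_backward: "reach \<Delta> (curve F b) n \<Longrightarrow> k \<le> m \<Longrightarrow> reach \<Delta>' (nv (m - k)) (n + k)"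
proof (induction k)
  case 0
  then show ?case using reach_old by (simp add: nv_m)
next
  case (Suc k)
  have "reversepath (E (m - Suc k)) \<in> edges \<Delta>'" using Suc by (auto simp: NE_def)
  moreover have "Suc (m - Suc k) = m - k" using Suc by simp
  ultimately show ?case
    using reach'_edge[of "reversepath (E (m - Suc k))" "n + k"] Suc by (simp add: E_start E_finish)
qed

lemma reach'_nv: "k < m \<Longrightarrow> reach \<Delta>' (nv k) (snd (N ! k))"
proof (cases "k = 0")
  case True
  then show ?thesis using bound_0 reach_old by (simp add: nv_0)
next
  case False
  assume k: "k < m"
  then consider n where "reach \<Delta> (curve F a) n" "n + k \<le> snd (N ! k)"
    | n where "reach \<Delta> (curve F b) n" "n + (m - k) \<le> snd (N ! k)"
    using bound[of k] False by (auto simp: m_def)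
  then show ?thesis
  proof cases
    case 1 then show ?thesis using reach'_forward[of n k] reach_mono k by auto
  next
    case 2 then show ?thesis using reach'_backward[of n "m - k"] reach_mono k by auto
  qed
qed

lemma reach'_nv_B': "k \<le> m \<Longrightarrow> reach \<Delta>' (nv k) B'"
proof (cases "k = m")
  case True
  then show ?thesis using reach_vert[OF curve_b_vert] reach_old reach_mono B'_ge by (simp add: nv_m) blast
next
  case False
  assume "k \<le> m"
  then have "k < m" using False by simp
  then show ?thesis using reach_mono[OF reach'_nv bound_B'[of "N ! k"]] by (simp add: m_def)
qed

text \<open>Inner vertices of the new side are read off along \<open>N\<close> starting at
  \<open>a\<close>. Since both sides have the same value, this reading reaches \<open>b\<close> with
  the old value there.\<close>

definition "val' z = (if z \<in> region F then val z
   else val (curve F a) \<otimes> word_val G (take (inv_into {0<..<m} nv z) wN))"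

lemma nv_inj: "inj_on nv {0<..<m}"
proof (rule inj_onI)
  fix k l assume kl: "k \<in> {0<..<m}" "l \<in> {0<..<m}" "nv k = nv l"
  then have "a < knot k" "knot k < b" "a < knot l" "knot l < b"
    using knot_less_iff[of 0] knot_less_iff[of _ m] by simp_all
  then have "knot k = knot l"
    using new_unique[of "F' (knot k)" "knot k" "F' (knot l)" "knot l"] kl(3) F_less_F' by (simp add: nv_def)
  then show "k = l" using knot_less_iff[of k l] knot_less_iff[of l k] by linarith
qed

lemma nv_new: "0 < k \<Longrightarrow> k < m \<Longrightarrow> nv k \<notin> region F"
  using new_notin[of "knot k" "F' (knot k)"] F_less_F'[of "knot k"] knot_less_iff[of 0 k] knot_less_iff[of k m]
  by (simp add: nv_def)

lemma val_a: "val (curve F a) \<in> carrier G" using val_closed curve_a_vert by blast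

lemma val_b: "val (curve F b) = val (curve F a) \<otimes> word_val G wN"
  using chain_val(2)[OF Q_chain val_a] N_val by simp

lemma val'_old: "v \<in> verts \<Delta> \<Longrightarrow> val' v = val v"
  using vert_region by (simp add: val'_def)

lemma val'_nv: "k \<le> m \<Longrightarrow> val' (nv k) = val (curve F a) \<otimes> word_val G (take k wN)"
proof -
  assume "k \<le> m"
  then consider "k = 0" | "k = m" | "0 < k" "k < m" by linarith
  then show ?thesis
  proof cases
    case 1 then show ?thesis using val'_old[OF curve_a_vert] val_a by (simp add: nv_0)
  next
    case 2
    then have "take k wN = wN" by (simp add: m_def)
    then show ?thesis using 2 val'_old[OF curve_b_vert] val_b by (simp add: nv_m)
  next
    case 3
    then show ?thesis using nv_new nv_inj by (simp add: val'_def)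
  qed
qed

lemma take_N [simp]: "word_val G (take k wN) \<in> carrier G"
  using N_A by (intro word_val_closed lists_take_drop)

lemma val'_E: "k < m \<Longrightarrow> val' (nv (Suc k)) = val' (nv k) \<otimes> fst (N ! k)"
proof -
  assume k: "k < m"
  have "take (Suc k) wN = take k wN @ [fst (N ! k)]"
    using k by (simp add: take_Suc_conv_app_nth m_def)
  then have "word_val G (take (Suc k) wN) = word_val G (take k wN) \<otimes> fst (N ! k)"
    using word_val_append[of "take k wN" "[fst (N ! k)]"] N_A N_in_A[OF k] A_closed
    by (simp del: in_lists_conv_set add: lists.intros)
  then show ?thesis using k val'_nv[of k] val'_nv[of "Suc k"] val_a N_in_A[OF k] A_closed
    by (simp add: m_assoc)
qed

lemma val'_closed: "v \<in> verts \<Delta>' \<Longrightarrow> val' v \<in> carrier G"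
  using val_closed val'_old val'_nv val_a by (auto simp: NV_def)

lemma val'_edge: "e \<in> edges \<Delta>' \<Longrightarrow> val' (pathfinish e) = val' (pathstart e) \<otimes> label' e"
proof (erule edges'_cases)
  assume "e \<in> edges \<Delta>"
  then show ?thesis using val_edge val'_old edgeD(3,4) by (simp add: label'_old)
next
  fix k assume "k < m" "e = E k"
  then show ?thesis using val'_E by (simp add: E_start E_finish label'_E)
next
  fix k assume k: "k < m" "e = reversepath (E k)"
  have "val' (nv k) \<in> carrier G" using val'_nv[of k] k val_a by simp
  then show ?thesis using val'_E[OF k(1)] k N_in_A A_closed
    by (simp add: E_start E_finish label'_rev_E m_assoc)
qed

text \<open>Everything outside the old region gets the top level \<open>B'\<close>. Levels are then
  monotone along tracks, which may pass from the old region into the new cell but never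
  back.\<close>

definition "lev' z = (if z \<in> region F then lev z else B')"

lemma lev'_le: "lev' z \<le> B' \<or> z \<notin> region F'"
  using lev_le B'_ge by (auto simp: lev'_def intro: order_trans)

text \<open>Each corner is reached from \<open>a\<close> by a prefix of one of the two sides, so its
  value is within \<open>2 * K + 2\<close> of the value at \<open>a\<close>, and \<open>low\<close>
  applies.\<close>

lemma new_cell_verts:
  assumes "c \<in> new_cells" "v \<in> cell_verts \<Delta>' c"
  shows "reach \<Delta>' v B' \<and> B' + 1 \<le> C * wlen (val' v) + C"
proof -
  have low': "B' + 1 \<le> C * wlen (val' v) + C"
    if "val' v = val (curve F a) \<otimes> word_val G s" "s \<in> lists A" "length s \<le> 2 * K + 2" for v s
    using low[of "wlen (val' v)"] wlen_le_mult[OF val_a that(2)] that by simp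
  have nv: "reach \<Delta>' (nv k) B' \<and> B' + 1 \<le> C * wlen (val' (nv k)) + C" if "k \<le> m" for k
  proof -
    have "take k wN \<in> lists A" "length (take k wN) \<le> 2 * K + 2"
      using short by (auto intro!: lists_take_drop N_A simp del: in_lists_conv_set)
    then show ?thesis using reach'_nv_B'[OF that] low' val'_nv[OF that] by blast
  qed
  have Q: "reach \<Delta>' (pathfinish e) B' \<and> B' + 1 \<le> C * wlen (val' (pathfinish e)) + C"
    if e: "e \<in> set (map fst Q)" for e
  proof -
    have v: "pathfinish e \<in> verts \<Delta>" using edgeD(4) Q_edge[OF e] by blast
    have "reach \<Delta>' (pathfinish e) B'" using reach_vert[OF v] reach_old reach_mono B'_ge by blast
    moreover obtain i where "i \<le> length Q" "val (pathfinish e) = val (curve F a) \<otimes> word_val G (take i wQ)"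
      using chain_val(3)[OF Q_chain val_a e] by blast
    moreover have "take i wQ \<in> lists A" using chain_val(1)[OF Q_chain val_a] by (rule lists_take_drop)
    moreover have "length (take i wQ) \<le> 2 * K + 2" using short by simp
    ultimately show ?thesis using low'[of "pathfinish e"] val'_old[OF v] by simp
  qed
  consider (f) "c = Face \<sigma>" | (v) k where "k < m" "c = Vertex (nv k)"
    | (e) e where "e \<in> NE" "c = Edge e"
    using assms(1) by (auto simp: new_cells_def NV_def)
  then show ?thesis
  proof cases
    case f
    then obtain e where e: "e \<in> set fb" "v = pathstart e" using assms(2) by auto
    then consider k where "k < m" "e = E k" | e' where "e' \<in> set (map fst Q)" "e = reversepath e'"
      unfolding set_fb(1) by auto
    then show ?thesis
    proof cases
      case 1 then show ?thesis using nv[of k] e(2) by (simp add: E_start)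
    next
      case 2 then show ?thesis using Q[of e'] e(2) by simp
    qed
  next
    case v then show ?thesis using nv[of k] assms(2) by simp
  next
    case e then show ?thesis using nv NE_ends[OF e(1)] assms(2) by auto
  qed
qed

lemma lev'_cell:
  assumes "c \<in> cells \<Delta>'" "z \<in> open_cell c" "v \<in> cell_verts \<Delta>' c"
  shows "reach \<Delta>' v (lev' z) \<and> lev' z + 1 \<le> C * wlen (val' v) + C"
proof (cases "c \<in> new_cells")
  case True
  then show ?thesis using new_cell_verts[OF True assms(3)] new_cell_notin[OF True assms(2)]
    by (simp add: lev'_def)
next
  case False
  then have c: "c \<in> cells \<Delta>" using assms(1) cells' by blast
  have v: "v \<in> cell_verts \<Delta> c" "v \<in> verts \<Delta>"
    using assms(3) c \<sigma>_new edgeD(3,4) faceD(4)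
    by (cases c; fastforce simp: cells_def split: if_splits)+
  have "z \<in> region F" using open_cell_region[OF c] assms(2) by blast
  then show ?thesis using lev_cell[OF c assms(2) v(1)] reach_old val'_old[OF v(2)] by (simp add: lev'_def)
qed

definition "newS = map (\<lambda>k. (E k, knot (Suc k), snd (N ! k))) [0..<m]"

lemma chain': "arc_chain \<Delta>' F' 0 (X @ newS @ Y) 1"
proof -
  have "arc_chain \<Delta>' F' (knot k) (map (\<lambda>k. (E k, knot (Suc k), snd (N ! k))) [k..<m]) b" if "k \<le> m" for k
    using that
  proof (induction "m - k" arbitrary: k)
    case 0
    then have "k = m" by simp
    then show ?case by simp
  next
    case (Suc d)
    then have k: "k < m" "Suc k \<le> m" by auto
    have "E k t = curve F' (knot k + t * (knot (Suc k) - knot k))" for t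
      by (simp add: E_eq knot_Suc)
    moreover have "E k \<in> edges \<Delta>'" using k by (auto simp: NE_def)
    moreover have "reach \<Delta>' (curve F' (knot k)) (snd (N ! k))"
      using reach'_nv[OF k(1)] by (simp add: nv_def)
    ultimately show ?case using Suc k by (simp add: upt_conv_Cons del: \<Delta>'_simps)
  qed
  from this[of 0] have "arc_chain \<Delta>' F' a newS b" by (simp add: newS_def)
  moreover have "arc_chain \<Delta>' F' 0 X a"
    by (rule arc_chain_mono[OF _ reach_old X_chain]) (auto intro: F'_out)
  moreover have "arc_chain \<Delta>' F' b Y 1"
    by (rule arc_chain_mono[OF _ reach_old Y_chain]) (auto intro: F'_out)
  ultimately show ?thesis unfolding arc_chain_append by blast
qed

lemma boundary_labels':
  "map (\<lambda>(e, \<gamma>, k). (label' e, k)) (X @ newS @ Y) =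
   map (\<lambda>(e, \<gamma>, k). (label \<Delta> e, k)) X @ N @ map (\<lambda>(e, \<gamma>, k). (label \<Delta> e, k)) Y"
proof -
  have T: "map (\<lambda>(e, \<gamma>, k). (label' e, k)) T = map (\<lambda>(e, \<gamma>, k). (label \<Delta> e, k)) T"
    if "arc_chain \<Delta> F \<alpha> T \<beta>" for \<alpha> T \<beta>
    by (rule map_cong) (use arc_chain_edges[OF that] label'_old in \<open>force simp: case_prod_unfold\<close>)+
  have "map (\<lambda>(e, \<gamma>, k). (label' e, k)) newS = N"
    by (rule nth_equalityI) (auto simp: newS_def label'_E m_def label'_E[unfolded m_def])
  then show ?thesis using T[OF X_chain] T[OF Y_chain] by simp
qed


text \<open>
  On the new arcs \<open>\<kappa>\<close> collapses all but the last one to the point \<open>a\<close>, so that the inner vertices of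
  the new path slide along its edges, and stretches the last one over the whole old path.
\<close>

definition "\<kappa> t = min t (max a (b - real m * (b - t)))"
definition "slide t s = (1 - s) * \<kappa> t + s * t"
text \<open>The cap \<open>s * (b - a)\<^sup>2\<close> starts at 0, so the motion begins on the old
  curve, and ends above the bump. Over angles strictly between \<open>a\<close> and \<open>b\<close>
  the height is positive for all positive times, so the point leaves the old region at once.\<close>

definition "height t s = min (max 0 (hat (slide t s))) (s * (b - a)\<^sup>2)"
definition "G2 t s = pol (F (slide t s) + height t s) (slide t s)"
definition "H' = (\<lambda>(t, s). if s \<le> 1/2 then H (\<kappa> t, 2 * s) else G2 t (2 * s - 1))"

lemma \<kappa>_out: "t \<notin> {a<..<b} \<Longrightarrow> \<kappa> t = t"
proof -
  assume t: "t \<notin> {a<..<b}"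
  show ?thesis
  proof (cases "t \<le> a")
    case False
    then have "b \<le> t" using t by auto
    then have "1 * (t - b) \<le> real m * (t - b)" using m_pos by (intro mult_right_mono) auto
    then show ?thesis by (simp add: \<kappa>_def algebra_simps)
  qed (simp add: \<kappa>_def)
qed

lemma \<kappa>_in: "t \<in> {a<..<b} \<Longrightarrow> a \<le> \<kappa> t \<and> \<kappa> t \<le> t"
  by (auto simp: \<kappa>_def)

lemma \<kappa>_01: "t \<in> {0..1} \<Longrightarrow> \<kappa> t \<in> {0..1}"
  using \<kappa>_out[of t] \<kappa>_in[of t] ab by (cases "t \<in> {a<..<b}") auto

text \<open>An inner vertex is at least one step \<open>h\<close> before \<open>b\<close>, and
  \<open>m\<close> steps make up \<open>b - a\<close>.\<close>

lemma \<kappa>_knot: "0 < k \<Longrightarrow> k < m \<Longrightarrow> \<kappa> (knot k) = a"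
proof -
  assume k: "0 < k" "k < m"
  have "b - knot k = (real m - real k) * h"
    using mh by (simp add: knot_def algebra_simps)
  then have "real m * (b - knot k) = (real m - real k) * (real m * h)" by simp
  also have "\<dots> = (real m - real k) * (b - a)" unfolding mh ..
  also have "\<dots> \<ge> 1 * (b - a)" using k ab by (intro mult_right_mono) auto
  finally show ?thesis using knot_in[of k] k by (auto simp: \<kappa>_def)
qed

lemma slide_out: "t \<notin> {a<..<b} \<Longrightarrow> slide t s = t"
  by (simp add: slide_def \<kappa>_out algebra_simps)

lemma slide_in:
  assumes "t \<in> {a<..<b}" "0 \<le> s" "s \<le> 1"
  shows "a \<le> slide t s" "slide t s \<le> t" "0 < s \<Longrightarrow> a < slide t s"
proof -
  have e: "slide t s = a + (1 - s) * (\<kappa> t - a) + s * (t - a)" by (simp add: slide_def algebra_simps)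
  have k: "0 \<le> (1 - s) * (\<kappa> t - a)" "0 \<le> s * (t - a)" using assms \<kappa>_in[OF assms(1)] by auto
  then show "a \<le> slide t s" by (simp add: e)
  show "a < slide t s" if "0 < s"
  proof -
    have "0 < s * (t - a)" using assms that by simp
    then show ?thesis using k by (simp add: e)
  qed
  have "(1 - s) * \<kappa> t \<le> (1 - s) * t" using assms \<kappa>_in[OF assms(1)] by (intro mult_left_mono) auto
  then show "slide t s \<le> t" by (simp add: slide_def algebra_simps)
qed

lemma slide_01: "t \<in> {0..1} \<Longrightarrow> s \<in> {0..1} \<Longrightarrow> slide t s \<in> {0..1}"
  using slide_out[of t s] slide_in[of t s] ab by (cases "t \<in> {a<..<b}") auto

lemma height_bounds: "0 \<le> s \<Longrightarrow> 0 \<le> height t s \<and> height t s \<le> max 0 (hat (slide t s))"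
  by (simp add: height_def)

lemma height_out: "t \<notin> {a<..<b} \<Longrightarrow> 0 \<le> s \<Longrightarrow> height t s = 0"
  using hat_nonpos[of t] by (simp add: height_def slide_out)

lemma height_pos: "t \<in> {a<..<b} \<Longrightarrow> 0 < s \<Longrightarrow> s \<le> 1 \<Longrightarrow> 0 < height t s"
  using slide_in[of t s] hat_pos[of "slide t s"] ab by (auto simp: height_def)

lemma height_1: "height t 1 = max 0 (hat t)"
proof -
  have "max 0 (hat t) \<le> (b - a)\<^sup>2"
  proof (cases "t \<in> {a<..<b}")
    case True
    then have "(t - a) * (b - t) \<le> (b - a) * (b - a)" by (intro mult_mono) auto
    then show ?thesis by (simp add: hat_def power2_eq_square)
  next
    case False then show ?thesis using hat_nonpos[of t] by simp
  qed
  then show ?thesis by (simp add: height_def slide_def)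
qed

lemma G2_out: "t \<notin> {a<..<b} \<Longrightarrow> 0 \<le> s \<Longrightarrow> G2 t s = curve F t"
  by (simp add: G2_def slide_out height_out)

lemma G2_0: "G2 t 0 = curve F (\<kappa> t)"
  by (simp add: G2_def slide_def height_def)

lemma G2_1: "G2 t 1 = curve F' t"
  by (simp add: G2_def height_1 slide_def F'_def)

lemma G2_new: "t \<in> {a<..<b} \<Longrightarrow> 0 < s \<Longrightarrow> s \<le> 1 \<Longrightarrow> G2 t s \<notin> region F"
  using height_pos[of t s] slide_in[of t s] ab new_notin[of "slide t s"] by (auto simp: G2_def)

lemma G2_region: "t \<in> {0..1} \<Longrightarrow> s \<in> {0..1} \<Longrightarrow> G2 t s \<in> region F'"
proof -
  assume ts: "t \<in> {0..1}" "s \<in> {0..1}"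
  have "0 < F (slide t s)" using radialD(2)[OF radial slide_01[OF ts]] .
  then show ?thesis
    using pol_in_region_iff[OF radial' slide_01[OF ts], of "F (slide t s) + height t s"] height_bounds[of s t] ts
    by (simp add: G2_def F'_def)
qed

text \<open>As \<open>\<kappa>\<close> is \<open>a\<close> at an inner vertex, the angle at time
  \<open>s\<close> exceeds \<open>a\<close> by \<open>s * (knot k - a)\<close>. The bump there is at
  most \<open>s * (b - a)\<^sup>2\<close>, so the cap does not cut in and the vertex moves along the
  new edges.\<close>

lemma G2_knot:
  assumes "0 < k" "k < m" "s \<in> {0..1}"
  shows "G2 (knot k) s = curve F' (slide (knot k) s)" "slide (knot k) s \<in> {a..b}"
proof -
  have t: "knot k \<in> {a<..<b}" using assms knot_less_iff[of 0 k] knot_less_iff[of k m] by simp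
  have sl: "slide (knot k) s - a = s * (knot k - a)"
    using \<kappa>_knot[OF assms(1,2)] by (simp add: slide_def algebra_simps)
  show in': "slide (knot k) s \<in> {a..b}" using slide_in(1,2)[OF t, of s] t assms(3) by auto
  have "s * (knot k - a) * (b - slide (knot k) s) \<le> s * (b - a) * (b - a)"
    using t assms(3) in' by (intro mult_mono) (auto intro!: mult_left_mono)
  then have "hat (slide (knot k) s) \<le> s * (b - a)\<^sup>2"
    by (simp add: hat_def sl power2_eq_square)
  then have "height (knot k) s = max 0 (hat (slide (knot k) s))"
    using assms(3) by (simp add: height_def)
  then show "G2 (knot k) s = curve F' (slide (knot k) s)" by (simp add: G2_def F'_def)
qed

lemma H'_1st: "s \<le> 1/2 \<Longrightarrow> H' (t, s) = H (\<kappa> t, 2 * s)"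
  by (simp add: H'_def)

lemma H'_2nd: "t \<in> {0..1} \<Longrightarrow> 1/2 \<le> s \<Longrightarrow> H' (t, s) = G2 t (2 * s - 1)"
proof (cases "s = 1/2")
  case True
  then have "2 * s - 1 = 0" "2 * s = 1" by simp_all
  moreover assume "t \<in> {0..1}"
  ultimately show ?thesis using H_1[OF \<kappa>_01, of t] G2_0[of t] by (simp add: H'_def)
qed (simp add: H'_def)

lemma H'_out: "t \<in> {0..1} \<Longrightarrow> t \<notin> {a<..<b} \<Longrightarrow> H' (t, s) = H (t, min 1 (2 * s))"
  using H_1[of t] by (auto simp: H'_def \<kappa>_out G2_out)

lemma H'_cont: "continuous_on ({0..1} \<times> {0..1}) H'"
proof -
  let ?P = "{0..1::real} \<times> {0..1/2::real}" and ?Q = "{0..1::real} \<times> {1/2..1::real}"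
  have "continuous_on (?P \<union> ?Q) H'"
  proof (rule continuous_on_closed_Un)
    show "closed ?P" "closed ?Q" by (intro closed_Times closed_atLeastAtMost)+
    have "continuous_on ?P (\<lambda>x. H (\<kappa> (fst x), 2 * snd x))"
      unfolding \<kappa>_def
      by (intro continuous_on_compose2[OF H_cont] continuous_intros)
        (use \<kappa>_01[unfolded \<kappa>_def] in auto)
    then show "continuous_on ?P H'" by (rule continuous_on_eq) (auto simp: H'_1st)
    have sl: "continuous_on ?Q (\<lambda>x. slide (fst x) (2 * snd x - 1))"
      unfolding slide_def \<kappa>_def by (intro continuous_intros)
    have "continuous_on ?Q (\<lambda>x. F (slide (fst x) (2 * snd x - 1)))"
      by (rule continuous_on_compose2[OF radialD(1)[OF radial] sl]) (use slide_01 in auto)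
    moreover have "continuous_on ?Q (\<lambda>x. height (fst x) (2 * snd x - 1))"
      unfolding height_def hat_def by (intro continuous_intros sl)
    ultimately have "continuous_on ?Q (\<lambda>x. G2 (fst x) (2 * snd x - 1))"
      unfolding G2_def by (intro continuous_intros sl)
    then show "continuous_on ?Q H'" by (rule continuous_on_eq) (auto simp: H'_2nd)
  qed
  moreover have "?P \<union> ?Q = {0..1} \<times> {0..1}" by auto
  ultimately show ?thesis by simp
qed

lemma region_subset: "region F \<subseteq> region F'" using region'_eq by blast

lemma H'_region: "t \<in> {0..1} \<Longrightarrow> s \<in> {0..1} \<Longrightarrow> H' (t, s) \<in> region F'"
  using H_region[OF \<kappa>_01, of t "2 * s"] region_subset G2_region[of t "2 * s - 1"]
  by (cases "s \<le> 1/2") (auto simp: H'_1st H'_2nd)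

lemma skeleton_subset: "skeleton1 \<Delta> \<subseteq> skeleton1 \<Delta>'"
  by (auto simp: skeleton1_def)

lemma curve'_skeleton: "t \<in> {a..b} \<Longrightarrow> curve F' t \<in> skeleton1 \<Delta>'"
proof -
  assume t: "t \<in> {a..b}"
  consider "t = a" | "t = b" | "a < t" "t < b" using t by fastforce
  then show ?thesis
  proof cases
    case 1 then show ?thesis using curve_a_vert F'_out[of a] by (simp add: skeleton1_def)
  next
    case 2 then show ?thesis using curve_b_vert F'_out[of b] by (simp add: skeleton1_def)
  next
    case 3
    then obtain c where c: "c \<in> new_cells" "curve F' t \<in> open_cell c"
      using new_cells_cover[of t "F' t"] F_less_F' by auto
    moreover have "c \<noteq> Face \<sigma>"
    proof
      assume "c = Face \<sigma>"
      then have "curve F' t \<in> lens" using c \<sigma>(3) by simp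
      then obtain r' t' where *: "curve F' t = pol r' t'" "a < t'" "t' < b" "F t' < r'" "r' < F' t'"
        unfolding lens_def by blast
      then show False using new_unique[OF *(1)] 3 F_less_F' by auto
    qed
    ultimately consider "curve F' t \<in> NV" | e where "e \<in> NE" "curve F' t \<in> e ` {0<..<1}"
      by (auto simp: new_cells_def)
    then show ?thesis
    proof cases
      case 1 then show ?thesis by (simp add: skeleton1_def)
    next
      case 2
      then have "curve F' t \<in> path_image e" unfolding path_image_def by auto
      then show ?thesis using 2(1) unfolding skeleton1_def by auto
    qed
  qed
qed

text \<open>An inner vertex of the new side follows the track of the old vertex at \<open>a\<close>
  during the first half of the time, and the new side itself during the second half.\<close>

lemma H'_skel: "t \<in> {0..1} \<Longrightarrow> curve F' t \<in> verts \<Delta>' \<Longrightarrow> s \<in> {0..1} \<Longrightarrow> H' (t, s) \<in> skeleton1 \<Delta>'"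
proof -
  assume t: "t \<in> {0..1}" and v: "curve F' t \<in> verts \<Delta>'" and s: "s \<in> {0..1}"
  show ?thesis
  proof (cases "t \<in> {a<..<b}")
    case False
    have "curve F' t \<in> region F" using F'_out[OF False] pol_in_region_iff[OF radial t, of "F t"]
      radialD(2)[OF radial t] by simp
    then have "curve F t \<in> verts \<Delta>" using v F'_out[OF False] nv_new by (auto simp: NV_def)
    then show ?thesis using H'_out[OF t False] H_skel[OF t, of "min 1 (2 * s)"] s skeleton_subset by auto
  next
    case True
    then have "curve F' t \<notin> region F" using new_notin F_less_F' by auto
    then obtain k where k: "0 < k" "k < m" "curve F' t = nv k"
      using v vert_region by (auto simp: NV_def)
    have "knot k \<in> {a<..<b}" using k knot_less_iff[of 0 k] knot_less_iff[of k m] by simp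
    then have tk: "t = knot k"
      using new_unique[of "F' t" t "F' (knot k)" "knot k"] k(3) True F_less_F' by (auto simp: nv_def)
    show ?thesis
    proof (cases "s \<le> 1/2")
      case True
      then show ?thesis
        using H_skel[of a "2 * s"] curve_a_vert \<kappa>_knot[OF k(1,2)] s ab skeleton_subset
        by (auto simp: H'_1st tk)
    next
      case False
      then have "2 * s - 1 \<in> {0..1}" using s by auto
      then show ?thesis using G2_knot[OF k(1,2)] curve'_skeleton H'_2nd[OF t, of s] False by (auto simp: tk)
    qed
  qed
qed

text \<open>Over the new arc and for \<open>s' > 1/2\<close> the later point is off the old region
  and has the maximal level \<open>B'\<close>. In the other cases both points lie on one track of
  the old homotopy.\<close>

lemma H'_lev:
  assumes t: "t \<in> {0..1}" and s: "0 \<le> s" "s \<le> s'" "s' \<le> 1"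
  shows "lev' (H' (t, s)) \<le> lev' (H' (t, s'))"
proof -
  have old: "lev' (H (t', x)) = lev (H (t', x))" if "t' \<in> {0..1}" "x \<in> {0..1}" for t' x
    using H_region[OF that] by (simp add: lev'_def)
  show ?thesis
  proof (cases "t \<in> {a<..<b}")
    case False
    then show ?thesis using H'_out[OF t False] old[OF t] H_lev[OF t, of "min 1 (2 * s)" "min 1 (2 * s')"] s
      by simp
  next
    case True
    show ?thesis
    proof (cases "s' \<le> 1/2")
      case 1: True
      then show ?thesis
        using H_lev[OF \<kappa>_01[OF t], of "2 * s" "2 * s'"] old[OF \<kappa>_01[OF t]] s by (simp add: H'_1st)
    next
      case 2: False
      then have "H' (t, s') \<notin> region F" using G2_new[OF True, of "2 * s' - 1"] H'_2nd[OF t, of s'] s by simp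
      then have "lev' (H' (t, s')) = B'" by (simp add: lev'_def)
      moreover have "lev' (H' (t, s)) \<le> B'" using lev'_le[of "H' (t, s)"] H'_region[OF t, of s] s by auto
      ultimately show ?thesis by simp
    qed
  qed
qed

theorem glued_tame_disc:
  "tame_disc G A (short_relators G A K) C \<Delta>' F' (X @ newS @ Y) H' val' lev' B'"
proof
  show "radial F'" "planar_complex \<Delta>'" "support \<Delta>' = region F'"
    using radial' planar' support' by simp_all
  show "base \<Delta>' = 1" "1 \<in> verts \<Delta>'" using base by simp_all
  show "arc_chain \<Delta>' F' 0 (X @ newS @ Y) 1" by (rule chain')
  show "val' 1 = \<one>" using val'_old[OF base(2)] val_1 by simp
  show "H' (t, 0) = 1" if "t \<in> {0..1}" for t using H_0[OF \<kappa>_01[OF that]] by (simp add: H'_1st)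
  show "H' (t, 1) = curve F' t" if "t \<in> {0..1}" for t using that G2_1 by (simp add: H'_2nd)
  show "H' (0, s) = 1 \<and> H' (1, s) = 1" if "s \<in> {0..1}" for s
    using H'_out[of 0 s] H'_out[of 1 s] H_base[of "min 1 (2 * s)"] that ab by auto
  show "lev' z \<le> B'" if "z \<in> region F'" for z using lev'_le that by blast
  show "continuous_on ({0..1} \<times> {0..1}) H'" by (rule H'_cont)
qed (use label'_A label'_rev face'_R val'_closed val'_edge lev'_cell H'_region H'_skel H'_lev in
      \<open>simp_all del: \<Delta>'_simps(1-4) add: \<Delta>'_simps(5)\<close>)

end

section \<open>From levels to tame fillings\<close>

context marked_group
begin

lemma wlen_path_dist: "path_dist (cayley_complex G A R) \<one> g = wlen g"
  unfolding wlen_def by (simp add: path_dist_cayley)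

lemma edge_coarse_dist_cayley:
  "edge_coarse_dist (cayley_complex G A R) \<one> (g, a) = min (real (wlen g)) (real (wlen (g \<otimes> a))) + 1/2"
proof -
  have "src (cayley_complex G A R) (g, a) = g" "tgt (cayley_complex G A R) (g, a) = g \<otimes> a"
    by (simp_all add: cayley_complex_def)
  then show ?thesis unfolding edge_coarse_dist_def wlen_path_dist by simp
qed

end

lemma bdry_cayley [simp]: "bdry (cayley_complex G A R) (g, r) = word_path G g r"
  by (simp add: cayley_complex_def)

context tame_disc
begin

lemma edge_path_val:
  "edge_path \<Delta> x p y \<Longrightarrow> val x \<in> carrier G \<Longrightarrow>
    map (label \<Delta>) p \<in> lists A \<and> val y = val x \<otimes> word_val G (map (label \<Delta>) p)"
proof (induction p arbitrary: x)
  case (Cons e p)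
  then have e: "e \<in> edges \<Delta>" "pathstart e = x" "edge_path \<Delta> (pathfinish e) p y" by auto
  then have v: "val (pathfinish e) = val x \<otimes> label \<Delta> e" "label \<Delta> e \<in> A"
    using val_edge label_A by auto
  then have "val (pathfinish e) \<in> carrier G" using Cons.prems A_closed by simp
  from Cons.IH[OF e(3) this] show ?case using v Cons.prems(2) A_closed by (auto simp: m_assoc)
qed simp

lemma reach_path: "reach \<Delta> v n \<Longrightarrow> path_dist \<Delta> (base \<Delta>) v \<le> n"
proof -
  assume "reach \<Delta> v n"
  then obtain p where p: "edge_path \<Delta> (base \<Delta>) p v" "length p \<le> n" by (auto simp: reach_def)
  have "path_dist \<Delta> (base \<Delta>) v \<le> length p"
    unfolding path_dist_def by (rule Least_le) (use p in blast)
  then show ?thesis using p(2) by simp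
qed

lemma shortest_path:
  assumes "v \<in> verts \<Delta>"
  obtains p where "edge_path \<Delta> (base \<Delta>) p v" "length p = path_dist \<Delta> (base \<Delta>) v"
proof -
  have "\<exists>n p. edge_path \<Delta> (base \<Delta>) p v \<and> length p = n"
    using reach_vert[OF assms] by (auto simp: reach_def)
  then have "\<exists>p. edge_path \<Delta> (base \<Delta>) p v \<and> length p = path_dist \<Delta> (base \<Delta>) v"
    unfolding path_dist_def by (rule LeastI_ex)
  then show ?thesis using that by blast
qed

text \<open>\<open>val\<close> is multiplicative along edges and trivial at the base point, so every
  path from there to \<open>v\<close> has the value \<open>val v\<close> and the description in
  \<open>proj_vertex\<close> is unique.\<close>

lemma proj_vertex_eq: "v \<in> verts \<Delta> \<Longrightarrow> proj_vertex G \<Delta> v = val v"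
proof -
  assume "v \<in> verts \<Delta>"
  then obtain p where p: "edge_path \<Delta> (base \<Delta>) p v" using shortest_path by blast
  have *: "val v = word_val G (map (label \<Delta>) q)" if "edge_path \<Delta> (base \<Delta>) q v" for q
    using edge_path_val[OF that] base val_1 by simp
  show ?thesis unfolding proj_vertex_def
    by (rule the_equality) (use p * in metis)+
qed

text \<open>Labels of paths in the diagram are words in the group, so the projection does not
  increase distances. This is the source of the comparison of extrinsic with intrinsic
  distances.\<close>

lemma wlen_le_path_dist: "v \<in> verts \<Delta> \<Longrightarrow> wlen (val v) \<le> path_dist \<Delta> (base \<Delta>) v"
proof -
  assume "v \<in> verts \<Delta>"
  then obtain p where p: "edge_path \<Delta> (base \<Delta>) p v" "length p = path_dist \<Delta> (base \<Delta>) v"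
    using shortest_path by blast
  then show ?thesis using edge_path_val[OF p(1)] base val_1 wlen_le[of "map (label \<Delta>) p"] by simp
qed

definition ext_edge :: "(real \<Rightarrow> complex) \<Rightarrow> real" where
  "ext_edge e = min (real (wlen (val (pathstart e)))) (real (wlen (val (pathfinish e)))) + 1/2"

lemma bdry_arc:
  "\<sigma> \<in> faces \<Delta> \<Longrightarrow> j < length (bdry \<Delta> \<sigma>) \<Longrightarrow> t \<in> {0..1} \<Longrightarrow>
   \<sigma> (cis (2 * pi * (real j + t) / real (length (bdry \<Delta> \<sigma>)))) = (bdry \<Delta> \<sigma> ! j) t"
  using faceD(5)[of \<sigma>] by (auto simp: traverses_def split: if_splits)

lemma bdry_consecutive:
  assumes "\<sigma> \<in> faces \<Delta>" "Suc k < length (bdry \<Delta> \<sigma>)"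
  shows "pathfinish (bdry \<Delta> \<sigma> ! k) = pathstart (bdry \<Delta> \<sigma> ! Suc k)"
proof -
  let ?p = "bdry \<Delta> \<sigma>"
  note * = bdry_arc[OF assms(1)]
  have "(?p ! k) 1 = (?p ! Suc k) 0" using *[of k 1] *[of "Suc k" 0] assms(2) by (simp add: add.commute)
  then show ?thesis by (simp add: pathstart_def pathfinish_def)
qed

text \<open>Consecutive arcs of the circle share an end point, and the last arc ends where the first
  one starts.\<close>

lemma bdry_finish:
  assumes "\<sigma> \<in> faces \<Delta>" "e \<in> set (bdry \<Delta> \<sigma>)"
  shows "pathfinish e \<in> pathstart ` set (bdry \<Delta> \<sigma>)"
proof -
  let ?p = "bdry \<Delta> \<sigma>"
  obtain k where k: "k < length ?p" "e = ?p ! k" using assms(2) by (metis in_set_conv_nth)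
  show ?thesis
  proof (cases "Suc k < length ?p")
    case True
    then show ?thesis using bdry_consecutive[OF assms(1) True] k by simp
  next
    case False
    then have "real k + 1 = real (length ?p)" "0 < length ?p" using k by auto
    then have "(?p ! k) 1 = (?p ! 0) 0"
      using bdry_arc[OF assms(1) k(1), of 1] bdry_arc[OF assms(1), of 0 0] by simp
    then show ?thesis using k \<open>0 < length ?p\<close> by (auto simp: pathstart_def pathfinish_def)
  qed
qed

lemma word_path_bdry:
  assumes "set p \<subseteq> edges \<Delta>" "p \<noteq> []" "\<And>k. Suc k < length p \<Longrightarrow> pathfinish (p ! k) = pathstart (p ! Suc k)"
  shows "word_path G (val (pathstart (hd p))) (map (label \<Delta>) p) = map (\<lambda>e. (val (pathstart e), label \<Delta> e)) p"
  using assms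
proof (induction p)
  case (Cons e p)
  show ?case
  proof (cases "p = []")
    case False
    have "pathfinish e = pathstart (hd p)" using Cons.prems(3)[of 0] False by (simp add: hd_conv_nth)
    moreover have "pathfinish (p ! k) = pathstart (p ! Suc k)" if "Suc k < length p" for k
      using Cons.prems(3)[of "Suc k"] that by simp
    ultimately show ?thesis using Cons.IH Cons.prems False val_edge[of e] by simp
  qed simp
qed simp

definition ext_cell :: "(complex, real \<Rightarrow> complex, complex \<Rightarrow> complex) cell \<Rightarrow> real" where
  "ext_cell c = coarse_dist (cayley_complex G A R) \<one> (proj_cell G \<Delta> c)"

lemma ext_edge_eq:
  "e \<in> edges \<Delta> \<Longrightarrow> edge_coarse_dist (cayley_complex G A R) \<one> (val (pathstart e), label \<Delta> e) = ext_edge e"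
  unfolding edge_coarse_dist_cayley ext_edge_def using val_edge by simp

lemma ext_cell_eq:
  "v \<in> verts \<Delta> \<Longrightarrow> ext_cell (Vertex v) = real (wlen (val v))"
  "e \<in> edges \<Delta> \<Longrightarrow> ext_cell (Edge e) = ext_edge e"
  "\<sigma> \<in> faces \<Delta> \<Longrightarrow> ext_cell (Face \<sigma>) = Max (ext_edge ` set (bdry \<Delta> \<sigma>)) - 1/4"
proof -
  show "v \<in> verts \<Delta> \<Longrightarrow> ext_cell (Vertex v) = real (wlen (val v))"
    by (simp add: ext_cell_def proj_vertex_eq wlen_path_dist)
  show "e \<in> edges \<Delta> \<Longrightarrow> ext_cell (Edge e) = ext_edge e"
    using ext_edge_eq by (simp add: ext_cell_def proj_vertex_eq edgeD)
  assume \<sigma>: "\<sigma> \<in> faces \<Delta>"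
  let ?p = "bdry \<Delta> \<sigma>"
  have p: "?p \<noteq> []" "set ?p \<subseteq> edges \<Delta>" using faceD[OF \<sigma>] by auto
  then have "hd ?p \<in> edges \<Delta>" using hd_in_set by blast
  then have pv: "proj_vertex G \<Delta> (pathstart (hd ?p)) = val (pathstart (hd ?p))"
    by (simp add: proj_vertex_eq edgeD)
  have "edge_coarse_dist (cayley_complex G A R) \<one> ` set (word_path G (val (pathstart (hd ?p))) (map (label \<Delta>) ?p))
    = ext_edge ` set ?p"
  proof -
    have "word_path G (val (pathstart (hd ?p))) (map (label \<Delta>) ?p) = map (\<lambda>e. (val (pathstart e), label \<Delta> e)) ?p"
      by (rule word_path_bdry[OF p(2,1)]) (rule bdry_consecutive[OF \<sigma>])
    then show ?thesis using ext_edge_eq p(2) by (simp add: image_image subset_iff)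
  qed
  then show "ext_cell (Face \<sigma>) = Max (ext_edge ` set ?p) - 1/4"
    by (simp add: ext_cell_def pv bdry_cayley)
qed

lemma int_edge_le:
  assumes "pathstart e \<in> verts \<Delta>" "reach \<Delta> (pathstart e) n"
  shows "edge_coarse_dist \<Delta> (base \<Delta>) e \<le> real n + 1/2"
  using reach_path[OF assms(2)] by (simp add: edge_coarse_dist_def)

lemma ext_le_int_edge: "e \<in> edges \<Delta> \<Longrightarrow> ext_edge e \<le> edge_coarse_dist \<Delta> (base \<Delta>) e"
  using wlen_le_path_dist[OF edgeD(3)[of e]] wlen_le_path_dist[OF edgeD(4)[of e]]
  by (simp add: edge_coarse_dist_def ext_edge_def) linarith

text \<open>Every edge of the closed cell starts at a corner within \<open>lev z\<close> of the base
  point, and a coarse distance adds at most 1/2. Conversely the coarse distance of the image is at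
  least the word distance of some corner: for a face the maximum exceeds such a word distance by at
  least 1/2, and 1/4 is subtracted.\<close>

lemma cell_levels:
  assumes c: "c \<in> cells \<Delta>" and z: "z \<in> open_cell c"
  shows "coarse_dist \<Delta> (base \<Delta>) c \<le> real (lev z) + 1/2"
    and "real (lev z) + 1 \<le> real C * ext_cell c + real C"
    and "ext_cell c \<le> coarse_dist \<Delta> (base \<Delta>) c"
proof -
  have L: "reach \<Delta> v (lev z)" "real (lev z) + 1 \<le> real C * real (wlen (val v)) + real C"
    if "v \<in> cell_verts \<Delta> c" for v
    using lev_cell[OF c z that] by (auto simp flip: of_nat_Suc of_nat_mult of_nat_add)
  have up: "real (lev z) + 1 \<le> real C * x + real C" if "v \<in> cell_verts \<Delta> c" "real (wlen (val v)) \<le> x" for v x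
    using L(2)[OF that(1)] mult_left_mono[OF that(2), of "real C"] by simp
  consider (v) v where "v \<in> verts \<Delta>" "c = Vertex v" | (e) e where "e \<in> edges \<Delta>" "c = Edge e"
    | (f) \<sigma> where "\<sigma> \<in> faces \<Delta>" "c = Face \<sigma>"
    using c by (auto simp: cells_def)
  then have "coarse_dist \<Delta> (base \<Delta>) c \<le> real (lev z) + 1/2 \<and> real (lev z) + 1 \<le> real C * ext_cell c + real C \<and>
    ext_cell c \<le> coarse_dist \<Delta> (base \<Delta>) c"
  proof cases
    case v
    then show ?thesis using reach_path[OF L(1)[of v]] up[of v] wlen_le_path_dist by (simp add: ext_cell_eq)
  next
    case e
    have "real (lev z) + 1 \<le> real C * ext_edge e + real C"
    proof -
      have "real (wlen (val (pathstart e))) \<le> ext_edge e \<or> real (wlen (val (pathfinish e))) \<le> ext_edge e"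
        by (auto simp: ext_edge_def min_def)
      then show ?thesis using up[of "pathstart e" "ext_edge e"] up[of "pathfinish e" "ext_edge e"] e by auto
    qed
    then show ?thesis using int_edge_le[of e "lev z"] edgeD(3) L(1)[of "pathstart e"] ext_le_int_edge e
      by (simp add: ext_cell_eq)
  next
    case f
    let ?p = "bdry \<Delta> \<sigma>"
    have p: "?p \<noteq> []" "set ?p \<subseteq> edges \<Delta>" using faceD[OF f(1)] by auto
    have fin: "finite (X ` set ?p)" "X ` set ?p \<noteq> {}" for X :: "_ \<Rightarrow> real" using p(1) by auto
    have "Max (edge_coarse_dist \<Delta> (base \<Delta>) ` set ?p) \<le> real (lev z) + 1/2"
    proof (subst Max_le_iff[OF fin], intro ballI)
      fix x assume "x \<in> edge_coarse_dist \<Delta> (base \<Delta>) ` set ?p"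
      then obtain e where "e \<in> set ?p" "x = edge_coarse_dist \<Delta> (base \<Delta>) e" by blast
      then show "x \<le> real (lev z) + 1/2"
        using int_edge_le[of e "lev z"] edgeD(3) p(2) L(1)[of "pathstart e"] f(2) by auto
    qed
    moreover have "Max (ext_edge ` set ?p) \<le> Max (edge_coarse_dist \<Delta> (base \<Delta>) ` set ?p)"
    proof (subst Max_le_iff[OF fin], intro ballI)
      fix x assume "x \<in> ext_edge ` set ?p"
      then obtain e where e: "e \<in> set ?p" "x = ext_edge e" by blast
      then have "x \<le> edge_coarse_dist \<Delta> (base \<Delta>) e" using ext_le_int_edge p(2) by blast
      also have "\<dots> \<le> Max (edge_coarse_dist \<Delta> (base \<Delta>) ` set ?p)" using e(1) by (intro Max_ge) auto
      finally show "x \<le> Max (edge_coarse_dist \<Delta> (base \<Delta>) ` set ?p)" .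
    qed
    moreover have "real (lev z) + 1 \<le> real C * (Max (ext_edge ` set ?p) - 1/4) + real C"
    proof -
      obtain e where e: "e \<in> set ?p" using p(1) by (meson last_in_set)
      have m: "ext_edge e \<le> Max (ext_edge ` set ?p)" using e by (intro Max_ge) auto
      show ?thesis
      proof (cases "wlen (val (pathstart e)) \<le> wlen (val (pathfinish e))")
        case True
        then have "real (wlen (val (pathstart e))) \<le> Max (ext_edge ` set ?p) - 1/4"
          using m by (simp add: ext_edge_def)
        then show ?thesis using up[of "pathstart e"] e f(2) by auto
      next
        case False
        then have "real (wlen (val (pathfinish e))) \<le> Max (ext_edge ` set ?p) - 1/4"
          using m by (simp add: ext_edge_def)
        then show ?thesis using up[of "pathfinish e"] bdry_finish[OF f(1) e] f(2) by simp
      qed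
    qed
    ultimately show ?thesis using f by (simp add: ext_cell_eq)
  qed
  then show "coarse_dist \<Delta> (base \<Delta>) c \<le> real (lev z) + 1/2"
    and "real (lev z) + 1 \<le> real C * ext_cell c + real C"
    and "ext_cell c \<le> coarse_dist \<Delta> (base \<Delta>) c" by blast+
qed

end

section \<open>Boundary path, homotopy and tameness of a disc\<close>

context tame_disc
begin

text \<open>The exterior map scales along rays: radius \<open>r\<close> and parameter
  \<open>t\<close> go to the ray of angle \<open>T t\<close>, at \<open>r\<close> times the radius
  of the curve. The reparametrisation \<open>T\<close> gives every boundary edge the same share of
  the circle.\<close>

lemma boundary_path_chain: "boundary_path \<Delta> (map fst S)"
proof -
  define n where "n = real (length S)"
  have Sne: "S \<noteq> []" using chain by (cases S) auto
  then have n: "0 < n" by (simp add: n_def)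
  obtain \<tau> where \<tau>: "continuous_on {0..n} \<tau>" "strict_mono_on {0..n} \<tau>" "\<tau> 0 = 0" "\<tau> n = 1"
    "\<And>k t. k < length S \<Longrightarrow> t \<in> {0..1} \<Longrightarrow> fst (S ! k) t = curve F (\<tau> (real k + t))"
    using arc_chain_param[OF chain] unfolding n_def by blast
  define T where "T = (\<lambda>x. \<tau> (n * x))"
  have nx: "n * x \<in> {0..n}" if "x \<in> {0..1}" for x
    using that n mult_left_mono[of x 1 n] by auto
  have T_cont: "continuous_on {0..1} T"
    unfolding T_def by (intro continuous_on_compose2[OF \<tau>(1)] continuous_intros) (use nx in auto)
  have T_less: "T x < T y" if "0 \<le> x" "x < y" "y \<le> 1" for x y
    using that \<tau>(2) nx[of x] nx[of y] n unfolding T_def strict_mono_on_def by auto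
  have T0: "T 0 = 0" and T1: "T 1 = 1" using \<tau>(3,4) by (simp_all add: T_def)
  have T01: "T x \<in> {0..1}" if "x \<in> {0..1}" for x
    using T_less[of 0 x] T_less[of x 1] that T0 T1 by (cases "x = 0"; cases "x = 1") auto
  have FT: "0 < F (T x)" if "x \<in> {0..1}" for x using radialD(2)[OF radial T01[OF that]] .
  have FT_cont: "continuous_on {0..1} (\<lambda>x. F (T x))"
    by (rule continuous_on_compose2[OF radialD(1)[OF radial] T_cont]) (use T01 in auto)
  define f where "f = (\<lambda>r t. pol (r * F (T t)) (T t))"
  define \<Omega> where "\<Omega> = (\<lambda>z. f (norm z) (turn z))"
  have cf: "continuous_on ({1..r1} \<times> {0..1}) (\<lambda>(r, t). f r t)" for r1
    unfolding f_def case_prod_unfold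
    by (intro continuous_intros continuous_on_compose2[OF FT_cont] continuous_on_compose2[OF T_cont]) auto
  note P = polar_map[of 1 _ f, OF cf]
  have per: "f r 1 = f r 0" for r using radialD[OF radial] T0 T1 by (simp add: f_def)
  have \<Omega>_pol: "\<Omega> (pol r t) = f r t" if "1 \<le> r" "t \<in> {0..1}" for r t
    unfolding \<Omega>_def using P(2)[of r r t] per that by simp
  \<comment> \<open>\<open>polar_map\<close> covers bounded annuli; continuity on the unbounded
    exterior is checked near each point.\<close>
  have \<Omega>_cont: "continuous_on {z. 1 \<le> norm z} \<Omega>"
    unfolding continuous_on_eq_continuous_within
  proof
    fix z :: complex assume z: "z \<in> {z. 1 \<le> norm z}"
    have "continuous_on {w. 1 \<le> norm w \<and> norm w \<le> norm z + 1} \<Omega>"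
      unfolding \<Omega>_def by (rule P(1)) (use per in auto)
    then have "continuous (at z within {w. 1 \<le> norm w \<and> norm w \<le> norm z + 1}) \<Omega>"
      using z by (simp add: continuous_on_eq_continuous_within)
    moreover have "at z within {w. 1 \<le> norm w \<and> norm w \<le> norm z + 1} = at z within {w. 1 \<le> norm w}"
    proof (rule at_within_nhd)
      show "z \<in> ball 0 (norm z + 1)" by simp
    qed auto
    ultimately show "continuous (at z within {z. 1 \<le> norm z}) \<Omega>"
      by (simp add: continuous_within)
  qed
  have \<Omega>_inj: "inj_on \<Omega> {z. 1 < norm z}"
  proof (rule inj_onI)
    fix w z assume wz: "w \<in> {z. 1 < norm z}" "z \<in> {z. 1 < norm z}" "\<Omega> w = \<Omega> z"
    let ?t = "turn w" and ?u = "turn z"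
    have nw: "0 < norm w" and nz: "0 < norm z" using wz(1,2) by (auto intro: less_trans[OF zero_less_one] simp del: zero_less_norm_iff)
    have e: "pol (norm w * F (T ?t)) (T ?t) = pol (norm z * F (T ?u)) (T ?u)"
      using wz(3) unfolding \<Omega>_def f_def .
    have *: "norm w * F (T ?t) = norm z * F (T ?u) \<and>
       (T ?t = T ?u \<or> T ?t = 0 \<and> T ?u = 1 \<or> T ?t = 1 \<and> T ?u = 0)"
      by (rule pol_eqD[OF e mult_pos_pos[OF nw FT[OF turn_bounds(3)]]
            less_imp_le[OF mult_pos_pos[OF nz FT[OF turn_bounds(3)]]]])
        (rule T01[OF turn_bounds(3)])+
    have "T ?t < 1" "T ?u < 1"
      using T_less[of ?t 1] T_less[of ?u 1] T1 turn_bounds[of w] turn_bounds[of z] by auto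
    then have "T ?t = T ?u" using * by auto
    then have "?t = ?u"
      using T_less[of ?t ?u] T_less[of ?u ?t] turn_bounds[of w] turn_bounds[of z] by fastforce
    moreover have "norm w = norm z" using * \<open>T ?t = T ?u\<close> FT[OF turn_bounds(3), of z] by auto
    ultimately show "w = z" using pol_turn[of w] pol_turn[of z] by metis
  qed
  have \<Omega>_img: "\<Omega> ` {z. 1 < norm z} = - support \<Delta>"
  proof (intro equalityI subsetI)
    fix y assume "y \<in> \<Omega> ` {z. 1 < norm z}"
    then obtain z where z: "1 < norm z" "y = f (norm z) (turn z)" by (auto simp: \<Omega>_def)
    have "1 * F (T (turn z)) < norm z * F (T (turn z))"
      using z(1) FT[OF turn_bounds(3), of z] by (intro mult_strict_right_mono) auto
    then have "y \<notin> region F"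
      using pol_in_region_iff[OF radial T01[OF turn_bounds(3)], of "norm z * F (T (turn z))" z] z
        FT[OF turn_bounds(3), of z] by (simp add: f_def)
    then show "y \<in> - support \<Delta>" by (simp add: supp)
  next
    fix y assume "y \<in> - support \<Delta>"
    then have y: "F (turn y) < norm y" using in_region_iff[OF radial, of y] supp by auto
    obtain t where t: "0 \<le> t" "t \<le> 1" "T t = turn y"
      using IVT'[of T 0 "turn y" 1] T_cont T0 T1 turn_bounds[of y] by auto
    have Fp: "0 < F (turn y)" using radialD(2)[OF radial turn_bounds(3)] .
    let ?r = "norm y / F (turn y)"
    have r: "1 < ?r" using y Fp by simp
    then have "\<Omega> (pol ?r t) = f ?r t" using \<Omega>_pol[of ?r t] t by simp
    also have "\<dots> = y" using t Fp by (simp add: f_def)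
    finally have "y = \<Omega> (pol ?r t)" ..
    moreover have "1 < norm (pol ?r t)" using r Fp by simp
    ultimately show "y \<in> \<Omega> ` {z. 1 < norm z}" by (rule image_eqI[OF _ CollectI])
  qed
  have \<Omega>_trav: "traverses \<Omega> (base \<Delta>) (map fst S)"
  proof -
    have "\<Omega> (cis (2 * pi * (real k + t) / real (length S))) = fst (S ! k) t"
      if "k < length S" "t \<in> {0..1}" for k t
    proof -
      let ?x = "(real k + t) / n"
      have "Suc k \<le> length S" using that(1) by simp
      then have "real k + 1 \<le> n" unfolding n_def by linarith
      then have "real k + t \<le> n" "0 \<le> real k + t" using that(2) by auto
      then have x: "?x \<in> {0..1}" using n by simp
      have "cis (2 * pi * (real k + t) / real (length S)) = pol 1 ?x" by (simp add: pol_def n_def)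
      then have "\<Omega> (cis (2 * pi * (real k + t) / real (length S))) = curve F (T ?x)"
        using \<Omega>_pol[of 1 ?x] x by (simp add: f_def)
      then show ?thesis using \<tau>(5)[OF that] n by (simp add: T_def)
    qed
    moreover have "\<Omega> 1 = base \<Delta>"
      using \<Omega>_pol[of 1 0] T0 radialD[OF radial] base by (simp add: f_def)
    ultimately show ?thesis using Sne by (simp add: traverses_def)
  qed
  have "winding_number (\<Omega> \<circ> circlepath 0 2) (base \<Delta>) = 1"
  proof -
    define q where "q = (\<lambda>x. f 2 x)"
    have "circlepath 0 2 x = pol 2 x" for x
      by (simp add: circlepath pol_def cis_conv_exp mult_ac)
    then have "winding_number (\<Omega> \<circ> circlepath 0 2) (base \<Delta>) = winding_number q (base \<Delta>)"
      by (intro winding_number_cong) (simp add: q_def \<Omega>_pol)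
    \<comment> \<open>The curve \<open>q\<close> avoids the connected region, which contains both
      the base point and 0.\<close>
    also have "\<dots> = winding_number q 0"
    proof (rule winding_number_eq)
      show "path q" unfolding path_def q_def f_def
        by (intro continuous_intros FT_cont T_cont)
      show "pathfinish q = pathstart q" using per by (simp add: q_def pathstart_def pathfinish_def)
      show "base \<Delta> \<in> region F" using vert_region base by simp
      show "0 \<in> region F" using pol_in_region_iff[OF radial, of 0 0] radialD[OF radial] by simp
      show "connected (region F)" using starlike_region[OF radial] by (rule starlike_imp_connected)
      have "q x \<notin> region F" if "x \<in> {0..1}" for x
      proof -
        have "\<not> 2 * F (T x) \<le> F (T x)" "0 \<le> 2 * F (T x)" using FT[OF that] by auto
        then show ?thesis using pol_in_region_iff[OF radial T01[OF that], of "2 * F (T x)"]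
          by (simp add: q_def f_def)
      qed
      then show "region F \<inter> path_image q = {}" by (auto simp: path_image_def)
    qed
    also have "\<dots> = winding_number (circlepath 0 1) 0"
    proof (rule winding_number_homotopic_loops)
      \<comment> \<open>Linear interpolation in polar coordinates: the radius is deformed to 1 and
        the angle function \<open>T\<close> to the identity, while radii stay positive.\<close>
      define g where "g = (\<lambda>(u, x). pol ((1 - u) * (2 * F (T x)) + u) ((1 - u) * T x + u * x))"
      have g_cont: "continuous_on ({0..1} \<times> {0..1}) g"
        unfolding g_def case_prod_unfold
        by (intro continuous_intros continuous_on_compose2[OF FT_cont] continuous_on_compose2[OF T_cont]) auto
      have g_ne: "g (u, x) \<noteq> 0" if "u \<in> {0..1}" "x \<in> {0..1}" for u x
      proof -
        have "0 < (1 - u) * (2 * F (T x)) + u"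
        proof (cases "u = 1")
          case False
          then have "0 < (1 - u) * (2 * F (T x))"
            using that FT[OF that(2)] by (intro mult_pos_pos) auto
          moreover have "0 \<le> u" using that(1) by simp
          ultimately show ?thesis by (rule add_pos_nonneg)
        qed simp
        then have "norm (g (u, x)) \<noteq> 0" by (simp add: g_def)
        then show ?thesis by auto
      qed
      have g0: "g (0, x) = q x" for x by (simp add: g_def q_def f_def)
      have g1: "g (1, x) = circlepath 0 1 x" for x
        by (simp add: g_def circlepath pol_def cis_conv_exp mult_ac)
      have gl: "pathfinish (g \<circ> Pair u) = pathstart (g \<circ> Pair u)" for u
        using T0 T1 radialD[OF radial] by (simp add: g_def pathfinish_def pathstart_def)
      show "homotopic_loops (- {0}) q (circlepath 0 1)"
        unfolding homotopic_loops
        by (intro exI[of _ g] conjI g_cont ballI g0 g1 gl) (use g_ne in auto)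
    qed
    also have "\<dots> = 1" by (simp add: winding_number_circlepath_centre)
    finally show ?thesis .
  qed
  moreover have "set (map fst S) \<subseteq> edges \<Delta>" using arc_chain_edges[OF chain] by auto
  ultimately show ?thesis unfolding boundary_path_def
    using \<Omega>_cont \<Omega>_inj \<Omega>_img \<Omega>_trav by blast
qed

lemma van_kampen:
  assumes "map (label \<Delta> \<circ> fst) S = w"
  shows "van_kampen_diagram G A R w \<Delta>"
  unfolding van_kampen_diagram_def
proof (intro conjI ballI)
  show "contractible (support \<Delta>)"
    unfolding supp by (rule starlike_imp_contractible[OF starlike_region[OF radial]])
  show "\<exists>p. boundary_path \<Delta> p \<and> map (label \<Delta>) p = w"
    using boundary_path_chain assms by (intro exI[of _ "map fst S"]) simp
qed (use planar base label_A label_rev face_R in auto)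

definition \<Psi> :: "complex \<times> real \<Rightarrow> complex" where
  "\<Psi> = (\<lambda>(z, s). H (turn z, s))"

lemma curve_turn: "z \<in> frontier (support \<Delta>) \<Longrightarrow> curve F (turn z) = z"
proof -
  assume "z \<in> frontier (support \<Delta>)"
  then obtain t where t: "t \<in> {0..1}" "z = curve F t" using frontier_region[OF radial] supp by auto
  have F: "0 < F t" "F 0 = 1" "F 1 = 1" using radialD[OF radial] t by auto
  show ?thesis
  proof (cases "t = 1")
    case True
    then have "z = pol 1 0" using t F by simp
    then show ?thesis using turn_pol[of 1 0] F by simp
  next
    case False
    then show ?thesis using turn_pol[of "F t" t] t F by simp
  qed
qed

text \<open>\<open>H\<close> takes equal values at the angles 0 and 1, so it factors through the
  boundary curve, and continuity passes to the compact quotient.\<close>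

lemma homotopy: "van_kampen_homotopy \<Delta> \<Psi>"
  unfolding van_kampen_homotopy_def
proof (intro conjI ballI)
  let ?q = "\<lambda>(t, s). (curve F t, s)" and ?K = "{0..1::real} \<times> {0..1::real}"
  have "\<Psi> (?q x) = H x" if xK: "x \<in> ?K" for x
  proof -
    obtain t s where x: "x = (t, s)" "t \<in> {0..1}" "s \<in> {0..1}" using xK by blast
    have F: "0 < F t" "F 0 = 1" "F 1 = 1" using radialD[OF radial] x by auto
    show ?thesis
    proof (cases "t = 1")
      case True
      then show ?thesis using turn_pol[of 1 0] F x H_base[OF x(3)] by (simp add: \<Psi>_def)
    next
      case False
      then show ?thesis using turn_pol[of "F t" t] x F by (simp add: \<Psi>_def)
    qed
  qed
  then have "continuous_on ?K (\<lambda>x. \<Psi> (?q x))"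
    using H_cont by (rule_tac continuous_on_eq[of _ H]) auto
  moreover have "continuous_on ?K ?q"
    unfolding case_prod_unfold
    by (intro continuous_intros continuous_on_compose2[OF radialD(1)[OF radial]]) auto
  ultimately have "continuous_on (?q ` ?K) \<Psi>"
    by (intro continuous_on_compact_quotient) (auto intro: compact_Times)
  moreover have "frontier (support \<Delta>) \<times> {0..1} \<subseteq> ?q ` ?K"
  proof
    fix x assume x: "x \<in> frontier (support \<Delta>) \<times> {0..1::real}"
    show "x \<in> ?q ` ?K"
    proof (rule image_eqI)
      show "x = ?q (turn (fst x), snd x)" using x curve_turn by auto
      show "(turn (fst x), snd x) \<in> ?K" using x turn_bounds(3) by auto
    qed
  qed
  ultimately show "continuous_on (frontier (support \<Delta>) \<times> {0..1}) \<Psi>"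
    using continuous_on_subset by blast
  show "\<Psi> ` (frontier (support \<Delta>) \<times> {0..1}) \<subseteq> support \<Delta>"
    using H_region[OF turn_bounds(3)] by (auto simp: \<Psi>_def supp)
  show "\<Psi> (z, 0) = base \<Delta>" for z using H_0[OF turn_bounds(3)] base by (simp add: \<Psi>_def)
  show "\<Psi> (z, 1) = z" if "z \<in> frontier (support \<Delta>)" for z
    using H_1[OF turn_bounds(3), of z] curve_turn[OF that] by (simp add: \<Psi>_def)
  show "\<Psi> (base \<Delta>, t) = base \<Delta>" if "t \<in> {0..1}" for t
    using turn_pol[of 1 0] base H_base[OF that] by (simp add: \<Psi>_def)
  show "\<Psi> (z, t) \<in> skeleton1 \<Delta>" if "z \<in> frontier (support \<Delta>) \<inter> verts \<Delta>" "t \<in> {0..1}" for z t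
    using H_skel[OF turn_bounds(3), of z t] curve_turn[of z] that by (simp add: \<Psi>_def)
qed

text \<open>The intrinsic distance at time \<open>s\<close> is at most the level there plus 1/2,
  hence at most the level at time \<open>t\<close> plus 1, hence at most \<open>C\<close> times the
  extrinsic distance at time \<open>t\<close> plus \<open>C\<close>. The comparison of the two
  distances then yields either claim.\<close>

lemma tame:
  shows "tame_along \<Delta> \<Psi> (intrinsic_dist \<Delta>) (\<lambda>x. real C * x + real C)"
    and "tame_along \<Delta> \<Psi> (extrinsic_dist G A R \<Delta>) (\<lambda>x. real C * x + real C)"
proof -
  have cell: "cell_of \<Delta> z \<in> cells \<Delta>" "z \<in> open_cell (cell_of \<Delta> z)" if "z \<in> support \<Delta>" for z
  proof -
    have "\<exists>c. c \<in> cells \<Delta> \<and> z \<in> open_cell c" using that by (auto simp: support_def)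
    then show "cell_of \<Delta> z \<in> cells \<Delta>" "z \<in> open_cell (cell_of \<Delta> z)"
      unfolding cell_of_def by (metis (mono_tags, lifting) someI_ex)+
  qed
  have D: "intrinsic_dist \<Delta> z \<le> real (lev z) + 1/2" "real (lev z) + 1 \<le> real C * extrinsic_dist G A R \<Delta> z + real C"
    "extrinsic_dist G A R \<Delta> z \<le> intrinsic_dist \<Delta> z" if "z \<in> support \<Delta>" for z
    using cell_levels[OF cell[OF that]] by (simp_all add: intrinsic_dist_def extrinsic_dist_def ext_cell_def)
  have main: "intrinsic_dist \<Delta> (\<Psi> (z, s)) \<le> real C * extrinsic_dist G A R \<Delta> (\<Psi> (z, t)) + real C \<and>
    \<Psi> (z, s) \<in> support \<Delta> \<and> \<Psi> (z, t) \<in> support \<Delta>"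
    if "0 \<le> s \<and> s < t \<and> t \<le> 1" for z s t
  proof -
    have "lev (\<Psi> (z, s)) \<le> lev (\<Psi> (z, t))"
      using H_lev[OF turn_bounds(3), of s t z] that by (simp add: \<Psi>_def)
    moreover have "\<Psi> (z, s) \<in> support \<Delta>" "\<Psi> (z, t) \<in> support \<Delta>"
      using H_region[OF turn_bounds(3)] that by (auto simp: \<Psi>_def supp)
    ultimately show ?thesis using D(1)[of "\<Psi> (z, s)"] D(2)[of "\<Psi> (z, t)"] by linarith
  qed
  show "tame_along \<Delta> \<Psi> (intrinsic_dist \<Delta>) (\<lambda>x. real C * x + real C)"
    unfolding tame_along_def
  proof (intro ballI allI impI)
    fix z s t assume st: "0 \<le> s \<and> s < t \<and> t \<le> (1::real)"
    have "real C * extrinsic_dist G A R \<Delta> (\<Psi> (z, t)) \<le> real C * intrinsic_dist \<Delta> (\<Psi> (z, t))"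
      using D(3) main[OF st] by (intro mult_left_mono) auto
    then show "intrinsic_dist \<Delta> (\<Psi> (z, s)) \<le> real C * intrinsic_dist \<Delta> (\<Psi> (z, t)) + real C"
      using main[OF st, of z] by linarith
  qed
  show "tame_along \<Delta> \<Psi> (extrinsic_dist G A R \<Delta>) (\<lambda>x. real C * x + real C)"
    unfolding tame_along_def using D(3) main by (meson order_trans)
qed

end

section \<open>The initial diagrams\<close>

definition halfU :: "real \<Rightarrow> complex" where "halfU t = pol 1 (t / 2)"
definition halfL :: "real \<Rightarrow> complex" where "halfL t = pol 1 ((1 + t) / 2)"

lemma pol_1_eq_iff: "t \<in> {0..<1} \<Longrightarrow> u \<in> {0..<1} \<Longrightarrow> pol 1 t = pol 1 u \<longleftrightarrow> t = u"
  using pol_eqD[of 1 t 1 u] by auto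

lemma pol_1_half: "pol 1 (1/2) = -1"
  by (simp add: pol_def)

lemma half_distinct:
  "halfU \<noteq> halfL" "halfU \<noteq> reversepath halfU" "halfU \<noteq> reversepath halfL"
  "halfL \<noteq> reversepath halfU" "halfL \<noteq> reversepath halfL"
  "reversepath halfU \<noteq> reversepath halfL"
proof -
  have 0: "halfU 0 = 1" "halfU 1 = -1" "halfL 0 = -1" "halfL 1 = 1"
    by (simp_all add: halfU_def halfL_def pol_1_half)
  have m: "halfU (1/2) \<noteq> halfL (1/2)"
    using pol_1_eq_iff[of "1/4" "3/4"] by (simp add: halfU_def halfL_def)
  show "halfU \<noteq> halfL" "halfU \<noteq> reversepath halfL" "halfL \<noteq> reversepath halfU"
    "reversepath halfU \<noteq> reversepath halfL"
    using m by (auto dest: fun_cong[where x = "1/2"] simp: reversepath_def)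
  show "halfU \<noteq> reversepath halfU" "halfL \<noteq> reversepath halfL"
    using 0 by (auto dest: fun_cong[where x = 0] simp: reversepath_def)
qed

lemma half_simple: "simple_path halfU" "simple_path halfL"
proof -
  have "path halfU" "path halfL"
    unfolding path_def halfU_def halfL_def by (intro continuous_intros; simp)+
  moreover have "loop_free halfU"
    unfolding loop_free_def halfU_def
    using pol_eqD[of 1 _ 1] by (fastforce dest!: pol_eqD)
  moreover have "loop_free halfL"
    unfolding loop_free_def halfL_def
    using pol_eqD[of 1 _ 1] by (fastforce dest!: pol_eqD)
  ultimately show "simple_path halfU" "simple_path halfL" by (simp_all add: simple_path_def)
qed

lemma half_ends [simp]:
  "pathstart halfU = 1" "pathfinish halfU = -1" "pathstart halfL = -1" "pathfinish halfL = 1"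
  by (simp_all add: pathstart_def pathfinish_def halfU_def halfL_def pol_1_half)

lemma half_open:
  "z \<in> open_cell (Edge halfU) \<longleftrightarrow> norm z = 1 \<and> 0 < turn z \<and> turn z < 1/2"
  "z \<in> open_cell (Edge halfL) \<longleftrightarrow> norm z = 1 \<and> 1/2 < turn z"
proof -
  show "z \<in> open_cell (Edge halfU) \<longleftrightarrow> norm z = 1 \<and> 0 < turn z \<and> turn z < 1/2"
  proof
    assume "norm z = 1 \<and> 0 < turn z \<and> turn z < 1/2"
    then show "z \<in> open_cell (Edge halfU)"
      using pol_turn[of z] by (auto simp: halfU_def image_iff intro!: bexI[of _ "2 * turn z"])
  qed (auto simp: halfU_def turn_pol)
  show "z \<in> open_cell (Edge halfL) \<longleftrightarrow> norm z = 1 \<and> 1/2 < turn z"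
  proof
    assume "norm z = 1 \<and> 1/2 < turn z"
    then show "z \<in> open_cell (Edge halfL)"
      using pol_turn[of z] turn_bounds[of z]
      by (auto simp: halfL_def image_iff field_simps intro!: bexI[of _ "2 * turn z - 1"])
  qed (auto simp: halfL_def turn_pol)
qed

lemma turn_1: "turn 1 = 0" and turn_m1: "turn (- 1) = 1/2"
  using turn_pol[of 1 0] turn_pol[of 1 "1/2"] by (simp_all add: pol_1_half)

lemma region_1: "region (\<lambda>_. 1) = cball 0 1"
proof -
  have "radial (\<lambda>_. 1)" by (simp add: radial_def)
  then show ?thesis using in_region_iff by auto
qed

text \<open>
  On the lower half circle this is the Coons interpolation of the prescribed boundary values,
  projected radially into the disc.
\<close>

definition bigon_homotopy :: "real \<times> real \<Rightarrow> complex" where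
  "bigon_homotopy = (\<lambda>(t, s). if t \<le> 1/2 then pol 1 (t * s) else
     (let w = of_real (2 - 2 * t) * pol 1 (s / 2) + of_real (2 * t - 1) + of_real s * (pol 1 t + of_real (3 - 4 * t))
      in w / of_real (max 1 (norm w))))"

lemma bigon_homotopy_upper: "t \<le> 1/2 \<Longrightarrow> bigon_homotopy (t, s) = pol 1 (t * s)"
  by (simp add: bigon_homotopy_def)

text \<open>At angle 1/2 both branches give \<open>pol 1 (s / 2)\<close>, so the lower formula may
  be used on a closed set and the two halves glue continuously.\<close>

lemma bigon_homotopy_lower:
  assumes "1/2 \<le> t"
    and w: "w = of_real (2 - 2 * t) * pol 1 (s / 2) + of_real (2 * t - 1) + of_real s * (pol 1 t + of_real (3 - 4 * t))"
  shows "bigon_homotopy (t, s) = w / of_real (max 1 (norm w))"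
proof (cases "t = 1/2")
  case True
  have "w = pol 1 (s / 2)" unfolding w True by (simp add: pol_1_half)
  then show ?thesis unfolding True bigon_homotopy_def by simp
next
  case False
  then show ?thesis using assms by (simp add: bigon_homotopy_def Let_def)
qed

lemma bigon_homotopy_cont: "continuous_on ({0..1} \<times> {0..1}) bigon_homotopy"
proof -
  let ?P = "{0..1/2::real} \<times> {0..1::real}" and ?Q = "{1/2..1::real} \<times> {0..1::real}"
  have "continuous_on (?P \<union> ?Q) bigon_homotopy"
  proof (rule continuous_on_closed_Un)
    show "closed ?P" "closed ?Q" by (intro closed_Times closed_atLeastAtMost)+
    have "continuous_on ?P (\<lambda>x. pol 1 (fst x * snd x))" by (intro continuous_intros)
    then show "continuous_on ?P bigon_homotopy"
      by (rule continuous_on_eq) (auto simp: bigon_homotopy_upper)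
    let ?w = "\<lambda>x. of_real (2 - 2 * fst x) * pol 1 (snd x / 2) + of_real (2 * fst x - 1) +
      of_real (snd x) * (pol 1 (fst x) + of_real (3 - 4 * fst x))"
    have c: "continuous_on ?Q ?w" by (intro continuous_intros) auto
    have "continuous_on ?Q (\<lambda>x. ?w x / of_real (max 1 (norm (?w x))))"
      by (intro continuous_on_divide c continuous_on_of_real continuous_on_max continuous_on_const
          continuous_on_norm) (auto simp: max_def)
    then show "continuous_on ?Q bigon_homotopy"
      by (rule continuous_on_eq) (auto simp: bigon_homotopy_lower[OF _ refl])
  qed
  moreover have "?P \<union> ?Q = {0..1} \<times> {0..1}" by auto
  ultimately show ?thesis by simp
qed

lemma bigon_homotopy_norm: "norm (bigon_homotopy x) \<le> 1"
proof -
  obtain t s where x: "x = (t, s)" by (cases x)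
  show ?thesis
  proof (cases "t \<le> 1/2")
    case False
    obtain w where "bigon_homotopy (t, s) = w / of_real (max 1 (norm w))"
      using False by (simp add: bigon_homotopy_def Let_def)
    then show ?thesis by (simp add: x norm_divide divide_le_eq)
  qed (simp add: x bigon_homotopy_upper)
qed

text \<open>The vertex -1, at angle 1/2, has to stay in the 1-skeleton and is made to run along
  \<open>halfU\<close>. The upper half circle moves along the same edge, and the tracks of the lower
  half circle have to bridge the face from there.\<close>

lemma bigon_homotopy_simps:
  assumes "t \<in> {0..1}"
  shows "bigon_homotopy (t, 0) = 1" "bigon_homotopy (t, 1) = pol 1 t"
    "bigon_homotopy (0, s) = 1" "bigon_homotopy (1, s) = 1" "bigon_homotopy (1/2, s) = halfU s"
proof -
  note l = bigon_homotopy_lower[OF _ refl]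
  show "bigon_homotopy (t, 0) = 1"
  proof (cases "t \<le> 1/2")
    case False
    have "of_real (2 - 2 * t) * pol 1 (0 / 2) + of_real (2 * t - 1) + of_real 0 * (pol 1 t + of_real (3 - 4 * t)) = 1"
      by (simp add: algebra_simps)
    then show ?thesis using False l[of t 0] by simp
  qed (simp add: bigon_homotopy_upper)
  show "bigon_homotopy (t, 1) = pol 1 t"
  proof (cases "t \<le> 1/2")
    case False
    have "of_real (2 - 2 * t) * pol 1 (1 / 2) + of_real (2 * t - 1) + of_real 1 * (pol 1 t + of_real (3 - 4 * t)) = pol 1 t"
      by (simp add: pol_1_half algebra_simps)
    from l[of t 1, unfolded this] show ?thesis using False by simp
  qed (simp add: bigon_homotopy_upper)
  show "bigon_homotopy (0, s) = 1" by (simp add: bigon_homotopy_upper)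
  show "bigon_homotopy (1, s) = 1"
    using l[of 1 s] by simp
  show "bigon_homotopy (1/2, s) = halfU s" by (simp add: bigon_homotopy_upper halfU_def)
qed

context marked_group
begin

definition bigon :: "'g \<Rightarrow> 'g diagram" where
  "bigon c = \<lparr>verts = {1, -1}, edges = {halfU, halfL, reversepath halfU, reversepath halfL},
     src = pathstart, flip = reversepath, faces = {id}, bdry = (\<lambda>_. [halfU, halfL]),
     label = (\<lambda>e. if e = halfU \<or> e = reversepath halfL then c else inv c), base = 1\<rparr>"

lemma bigon_simps [simp]:
  "verts (bigon c) = {1, -1}" "edges (bigon c) = {halfU, halfL, reversepath halfU, reversepath halfL}"
  "src (bigon c) = pathstart" "flip (bigon c) = reversepath" "faces (bigon c) = {id}"
  "bdry (bigon c) = (\<lambda>_. [halfU, halfL])" "base (bigon c) = 1"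
  "label (bigon c) halfU = c" "label (bigon c) halfL = inv c"
  "label (bigon c) (reversepath halfU) = inv c" "label (bigon c) (reversepath halfL) = c"
  using half_distinct by (auto simp: bigon_def)

lemma bigon_cells:
  "cells (bigon c) = {Vertex 1, Vertex (-1), Edge halfU, Edge halfL, Edge (reversepath halfU),
     Edge (reversepath halfL), Face id}"
  by (auto simp: cells_def)

lemma bigon_planar: "planar_complex (bigon c)"
  unfolding planar_complex_def
proof (intro conjI ballI impI)
  fix e assume "e \<in> edges (bigon c)"
  then show "simple_path e" "reversepath e \<in> edges (bigon c)" "pathstart e \<in> verts (bigon c)"
    using half_simple by (auto simp: simple_path_reversepath)
next
  fix \<sigma> assume \<sigma>: "\<sigma> \<in> faces (bigon c)"
  show "continuous_on (cball 0 1) \<sigma>" "inj_on \<sigma> (ball 0 1)" "bdry (bigon c) \<sigma> \<noteq> []"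
    "set (bdry (bigon c) \<sigma>) \<subseteq> edges (bigon c)" using \<sigma> by auto
  show "traverses \<sigma> (\<sigma> 1) (bdry (bigon c) \<sigma>)"
    using \<sigma> by (auto simp: traverses_def less_Suc_eq pol_def halfU_def halfL_def)
next
  fix d d' assume d: "d \<in> cells (bigon c)" "d' \<in> cells (bigon c)" "open_cell d \<inter> open_cell d' \<noteq> {}"
  then obtain z where z: "z \<in> open_cell d" "z \<in> open_cell d'" by blast
  have v: "z \<in> open_cell (Vertex v) \<longleftrightarrow> z = v" "z \<in> open_cell (Face id) \<longleftrightarrow> norm z < 1" for v
    by auto
  have oc: "open_cell (Edge (reversepath halfU)) = open_cell (Edge halfU)"
    "open_cell (Edge (reversepath halfL)) = open_cell (Edge halfL)" by (rule open_cell_reversepath)+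
  show "d = d' \<or> (\<exists>e. d = Edge e \<and> d' = Edge (reversepath e))"
    using d(1,2) z unfolding bigon_cells
    by (auto simp only: insert_iff empty_iff oc half_open v turn_1 turn_m1 norm_one norm_minus_cancel
        cell.inject reversepath_reversepath simp_thms)
      (auto simp: turn_1 turn_m1)
qed simp_all

lemma bigon_support: "support (bigon c) = region (\<lambda>_. 1)"
proof -
  have *: "z \<in> support (bigon c) \<longleftrightarrow> norm z \<le> 1" for z
  proof -
    have v: "z \<in> open_cell (Vertex v) \<longleftrightarrow> z = v" "z \<in> open_cell (Face id) \<longleftrightarrow> norm z < 1" for v
      by auto
    have oc: "open_cell (Edge (reversepath halfU)) = open_cell (Edge halfU)"
      "open_cell (Edge (reversepath halfL)) = open_cell (Edge halfL)" by (rule open_cell_reversepath)+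
    have "z \<in> support (bigon c) \<longleftrightarrow> z = 1 \<or> z = -1 \<or> z \<in> open_cell (Edge halfU) \<or> z \<in> open_cell (Edge halfL) \<or> norm z < 1"
      unfolding support_def bigon_cells UN_iff bex_simps(5,7) oc v by blast
    also have "\<dots> \<longleftrightarrow> norm z \<le> 1"
    proof
      assume n: "norm z \<le> 1"
      show "z = 1 \<or> z = -1 \<or> z \<in> open_cell (Edge halfU) \<or> z \<in> open_cell (Edge halfL) \<or> norm z < 1"
      proof (cases "norm z = 1")
        case True
        have "turn z = 0 \<Longrightarrow> z = 1" "turn z = 1/2 \<Longrightarrow> z = -1"
          using pol_turn[of z] True pol_1_half pol_at_0[of 1] by (metis of_real_1)+
        then show ?thesis using True turn_bounds(1)[of z] unfolding half_open by linarith
      qed (use n in auto)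
    next
      assume "z = 1 \<or> z = -1 \<or> z \<in> open_cell (Edge halfU) \<or> z \<in> open_cell (Edge halfL) \<or> norm z < 1"
      then show "norm z \<le> 1" unfolding half_open by auto
    qed
    finally show ?thesis .
  qed
  show ?thesis by (intro Set.set_eqI) (simp only: region_1 mem_cball_0 *)
qed

text \<open>Level 1 throughout suffices: the vertex -1 is one edge away from the base point, and
  \<open>C \<ge> 2\<close> covers the lower bound at the base point, where the word distance is
  0.\<close>

lemma bigon_tame_disc:
  assumes c: "c \<in> A" and R: "[c, inv c] \<in> R" and C: "2 \<le> C"
  shows "tame_disc G A R C (bigon c) (\<lambda>_. 1) [(halfU, 1/2, 0), (halfL, 1, 1)] bigon_homotopy
    (\<lambda>z. if z = 1 then \<one> else c) (\<lambda>_. 1) 1"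
proof
  have cc: "c \<in> carrier G" using c A_closed by blast
  have ne: "(1::complex) \<noteq> -1" by simp
  have r0: "reach (bigon c) 1 0" unfolding reach_def by (intro exI[of _ "[]"]) simp
  have r1: "reach (bigon c) (-1) 1" unfolding reach_def by (intro exI[of _ "[halfU]"]) simp
  show "radial (\<lambda>_. 1)" by (simp add: radial_def)
  show "arc_chain (bigon c) (\<lambda>_. 1) 0 [(halfU, 1/2, 0), (halfL, 1, 1)] 1"
    using r0 r1 by (auto simp: halfU_def halfL_def pol_1_half algebra_simps add_divide_distrib)
  show "label (bigon c) e \<in> A" if "e \<in> edges (bigon c)" for e
    using that c A_inv by auto
  show "label (bigon c) (reversepath e) = inv (label (bigon c) e)" if "e \<in> edges (bigon c)" for e
    using that cc by auto
  show "map (label (bigon c)) (bdry (bigon c) \<sigma>) \<in> R" for \<sigma> using R by simp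
  show "(if pathfinish e = 1 then \<one> else c) = (if pathstart e = 1 then \<one> else c) \<otimes> label (bigon c) e"
    if "e \<in> edges (bigon c)" for e
    using that cc ne by auto
  show "reach (bigon c) v 1 \<and> 1 + 1 \<le> C * wlen (if v = 1 then \<one> else c) + C"
    if "d \<in> cells (bigon c)" "z \<in> open_cell d" "v \<in> cell_verts (bigon c) d" for d z v
  proof -
    have "v = 1 \<or> v = -1" using that(1,3) by (auto simp: bigon_cells)
    then show ?thesis using r1 reach_mono[OF r0, of 1] C by auto
  qed
  show "bigon_homotopy (t, s) \<in> region (\<lambda>_. 1)" for t s
    using bigon_homotopy_norm by (simp add: region_1)
  show "bigon_homotopy (0, s) = 1 \<and> bigon_homotopy (1, s) = 1" for s
    using bigon_homotopy_simps(3,4)[of 0] by simp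
  show "bigon_homotopy (t, s) \<in> skeleton1 (bigon c)"
    if t: "t \<in> {0..1}" "pol 1 t \<in> verts (bigon c)" and s: "s \<in> {0..1}" for t s
  proof -
    have "t = 0 \<or> t = 1 \<or> t = 1/2"
      using t pol_1_eq_iff[of t 0] pol_1_eq_iff[of t "1/2"] by (cases "t = 1") (auto simp: pol_1_half)
    then have "bigon_homotopy (t, s) = 1 \<or> bigon_homotopy (t, s) = halfU s"
      using bigon_homotopy_simps(3-5)[of 0 s] by (metis atLeastAtMost_iff order_refl zero_le_one)
    then show ?thesis using s by (auto simp: skeleton1_def path_image_def)
  qed
qed (use bigon_planar bigon_support bigon_homotopy_cont bigon_homotopy_simps c A_closed in auto)

text \<open>Discs have nonempty boundary words, so the empty word gets the diagram with one
  vertex.\<close>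

definition point_diagram :: "'g diagram" where
  "point_diagram = \<lparr>verts = {0}, edges = {}, src = pathstart, flip = reversepath, faces = {},
     bdry = (\<lambda>_. []), label = (\<lambda>_. undefined), base = 0\<rparr>"

lemma point_cells: "cells point_diagram = {Vertex 0}"
  by (simp add: cells_def point_diagram_def)

lemma point_support: "support point_diagram = {0}"
  by (simp add: support_def point_cells)

lemma point_van_kampen: "van_kampen_diagram G A R [] point_diagram"
proof -
  \<comment> \<open>This map subtracts 1 from the norm and keeps the direction, so the unit circle
    collapses to the vertex.\<close>
  let ?\<Omega> = "\<lambda>z::complex. of_real (1 - 1 / norm z) * z"
  have n: "norm (?\<Omega> z) = norm z - 1" if "1 \<le> norm z" for z
  proof -
    have "norm (?\<Omega> z) = \<bar>1 - 1 / norm z\<bar> * norm z" by (simp only: norm_mult norm_of_real)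
    also have "\<dots> = norm z - 1" using that by (cases "z = 0") (auto simp: field_simps abs_if)
    finally show ?thesis .
  qed
  have "continuous_on {z. 1 \<le> norm z} ?\<Omega>"
    by (intro continuous_intros) auto
  moreover have "inj_on ?\<Omega> {z. 1 < norm z}"
  proof (rule inj_onI)
    fix w z :: complex assume wz: "w \<in> {z. 1 < norm z}" "z \<in> {z. 1 < norm z}" "?\<Omega> w = ?\<Omega> z"
    then have "norm w = norm z" using n[of w] n[of z] by auto
    moreover have "1 - 1 / norm z \<noteq> 0" using wz(2) by auto
    ultimately show "w = z" using wz(3) by (metis mult_cancel_left of_real_eq_0_iff)
  qed
  moreover have "?\<Omega> ` {z. 1 < norm z} = - support point_diagram"
  proof (intro equalityI subsetI)
    fix y assume "y \<in> ?\<Omega> ` {z. 1 < norm z}"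
    then obtain z where z: "1 < norm z" "y = ?\<Omega> z" by blast
    then have "norm y \<noteq> 0" using n[of z] by simp
    then show "y \<in> - support point_diagram" by (auto simp: point_support)
  next
    fix y assume "y \<in> - support point_diagram"
    then have y: "0 < norm y" by (simp add: point_support)
    let ?z = "of_real (1 + 1 / norm y) * y"
    have nz: "norm ?z = norm y + 1"
    proof -
      have "norm ?z = \<bar>1 + 1 / norm y\<bar> * norm y" by (simp only: norm_mult norm_of_real)
      also have "\<dots> = norm y + 1" using y by (simp add: field_simps)
      finally show ?thesis .
    qed
    have "(1 - 1 / (r + 1)) * (1 + 1 / r) = 1" if "0 < r" for r :: real
    proof -
      have "1 - 1 / (r + 1) = r / (r + 1)" "1 + 1 / r = (r + 1) / r" "r + 1 \<noteq> 0"
        using that by (simp_all add: field_simps)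
      then show ?thesis using that by simp
    qed
    from this[OF y] have "(1 - 1 / (norm y + 1)) * (1 + 1 / norm y) = 1" .
    then have "y = of_real ((1 - 1 / (norm y + 1)) * (1 + 1 / norm y)) * y" by simp
    also have "\<dots> = ?\<Omega> ?z" unfolding nz by (simp only: of_real_mult mult.assoc)
    finally show "y \<in> ?\<Omega> ` {z. 1 < norm z}"
      using nz y by (intro image_eqI[of _ _ ?z]) auto
  qed
  moreover have "traverses ?\<Omega> (base point_diagram) []"
    by (simp add: traverses_def point_diagram_def)
  moreover have "winding_number (?\<Omega> \<circ> circlepath 0 2) (base point_diagram) = 1"
  proof -
    have "?\<Omega> \<circ> circlepath 0 2 = circlepath 0 1"
      by (rule ext) (simp add: circlepath norm_mult)
    then show ?thesis by (simp add: point_diagram_def winding_number_circlepath_centre)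
  qed
  ultimately have "boundary_path point_diagram []"
    unfolding boundary_path_def by (intro conjI exI[of _ ?\<Omega>]) auto
  then show ?thesis
    unfolding van_kampen_diagram_def planar_complex_def point_support point_cells
    by (auto simp: point_diagram_def contractible_sing)
qed

lemma point_filling:
  "van_kampen_homotopy point_diagram (\<lambda>_. 0)"
  "tame_along point_diagram (\<lambda>_. 0) (intrinsic_dist point_diagram) (\<lambda>x. real C * x + real C)"
  "tame_along point_diagram (\<lambda>_. 0) (extrinsic_dist G A R point_diagram) (\<lambda>x. real C * x + real C)"
proof -
  have fr: "frontier {0::complex} = {0}" by (simp add: frontier_def)
  show "van_kampen_homotopy point_diagram (\<lambda>_. 0)"
    unfolding van_kampen_homotopy_def point_support fr
    by (auto simp: point_diagram_def skeleton1_def)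
  have cell: "cell_of point_diagram 0 = Vertex 0"
    unfolding cell_of_def point_cells by (rule some_equality) auto
  have ep: "edge_path point_diagram 0 p v \<longleftrightarrow> p = [] \<and> v = 0" for p v
    by (cases p) (auto simp: point_diagram_def)
  have b: "base point_diagram = 0" by (simp add: point_diagram_def)
  have "path_dist point_diagram 0 0 = 0" by (simp add: path_dist_def ep)
  then have i: "intrinsic_dist point_diagram 0 = 0" by (simp add: intrinsic_dist_def cell b)
  have "proj_vertex G point_diagram 0 = \<one>"
    unfolding proj_vertex_def b ep by (rule the_equality) auto
  then have e: "extrinsic_dist G A R point_diagram 0 = 0"
    by (simp add: extrinsic_dist_def cell wlen_path_dist)
  show "tame_along point_diagram (\<lambda>_. 0) (intrinsic_dist point_diagram) (\<lambda>x. real C * x + real C)"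
    "tame_along point_diagram (\<lambda>_. 0) (extrinsic_dist G A R point_diagram) (\<lambda>x. real C * x + real C)"
    by (simp_all add: tame_along_def i e)
qed

end

section \<open>Fillable words\<close>

context marked_group
begin

text \<open>The number attached to a letter bounds the distance from the base point to its start.\<close>

definition filled :: "nat \<Rightarrow> nat \<Rightarrow> nat \<Rightarrow> ('g \<times> nat) list \<Rightarrow> bool" where
  "filled K C B P \<longleftrightarrow> rel_equiv (short_relators G A K) (map fst P) [] \<and>
     (\<exists>\<Delta> F S H val lev. tame_disc G A (short_relators G A K) C \<Delta> F S H val lev B \<and>
        map (\<lambda>(e, \<gamma>, k). (label \<Delta> e, k)) S = P)"

lemma filled_start:
  assumes "c \<in> A" "2 \<le> C"
  shows "filled K C 1 [(c, 0), (inv c, 1)]"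
proof -
  have "[c, inv c] \<in> short_relators G A K"
    using assms(1) by (auto simp: short_relators_def A_closed A_inv)
  from bigon_tame_disc[OF assms(1) this assms(2)] show ?thesis
    unfolding filled_def using rel_equiv_cancel[of "[c]"] assms(1)
    by (intro conjI exI) (assumption | simp)+
qed

text \<open>Gluing one cell, expressed for words with bounds. If \<open>X\<close> or
  \<open>Y\<close> is empty, the corresponding end of the cell is the base point, whence the bound
  0. The equivalence modulo relators is carried along because a finite presentation is a statement
  about words; it results from the same sequence of replacements.\<close>

lemma filled_step:
  assumes fil: "filled K C B (X @ Q @ Y)" and ne: "Q \<noteq> []" "N \<noteq> []" and NA: "map fst N \<in> lists A"
    and val_eq: "word_val G (map fst N) = word_val G (map fst Q)"
    and short: "length N + length Q \<le> 2 * K + 2" and "B \<le> B'"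
    and b0: "X = [] \<or> snd (hd Q) \<le> snd (hd N)"
    and b1: "\<And>q. q \<in> set (tl N) \<Longrightarrow>
      (if X = [] then 0 else snd (hd Q)) + length N \<le> snd q \<or> (if Y = [] then 0 else snd (hd Y)) + length N \<le> snd q"
    and bB: "\<And>q. q \<in> set N \<Longrightarrow> snd q \<le> B'"
    and low: "\<And>d. wlen (word_val G (map fst X)) \<le> d + (2 * K + 2) \<Longrightarrow> B' + 1 \<le> C * d + C"
  shows "filled K C B' (X @ N @ Y)"
proof -
  obtain \<Delta> F S H val lev where td: "tame_disc G A (short_relators G A K) C \<Delta> F S H val lev B"
    and S: "map (\<lambda>(e, \<gamma>, k). (label \<Delta> e, k)) S = X @ Q @ Y"
    and eqv: "rel_equiv (short_relators G A K) (map fst (X @ Q @ Y)) []"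
    using fil unfolding filled_def by blast
  interpret tame_disc G A "short_relators G A K" C \<Delta> F S H val lev B by (rule td)
  let ?f = "\<lambda>(e, \<gamma>, k). (label \<Delta> e, k)"
  obtain X' T where T: "S = X' @ T" "X = map ?f X'" "Q @ Y = map ?f T"
    using S unfolding map_eq_append_conv by blast
  obtain Q' Y' where "T = Q' @ Y'" "Q = map ?f Q'" "Y = map ?f Y'"
    using T(3)[symmetric] unfolding map_eq_append_conv by blast
  then have S': "S = X' @ Q' @ Y'" "X = map ?f X'" "Q = map ?f Q'" "Y = map ?f Y'" using T by simp_all
  obtain a b where ch: "arc_chain \<Delta> F 0 X' a" "arc_chain \<Delta> F a Q' b" "arc_chain \<Delta> F b Y' 1"
    using chain unfolding S' arc_chain_append by blast
  have fst_f: "map (label \<Delta> \<circ> fst) T = map fst (map ?f T)" for T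
    by (simp add: case_prod_unfold o_def)
  have hd_reach: "reach \<Delta> (curve F \<alpha>) (snd (hd (map ?f T)))" if "arc_chain \<Delta> F \<alpha> T \<beta>" "T \<noteq> []" for \<alpha> T \<beta>
    using that by (cases T) auto
  have F0: "curve F 0 = 1" "curve F 1 = 1" using radialD[OF radial] by simp_all
  have Qne: "Q' \<noteq> []" using ne S' by simp
  have ra: "reach \<Delta> (curve F a) (if X = [] then 0 else snd (hd Q))"
    using hd_reach[OF ch(2) Qne] ch(1) reach_base F0 S' by auto
  have rb: "reach \<Delta> (curve F b) (if Y = [] then 0 else snd (hd Y))"
    using hd_reach[OF ch(3)] ch(3) reach_base F0 S' by auto
  have Q'len: "length Q' = length Q" using S' by simp
  have va: "val (curve F a) = word_val G (map fst X)"
    using chain_val(2)[OF ch(1)] F0 val_1 chain_val(1)[OF ch(1)] unfolding S'(2) fst_f[symmetric] by simp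
  have XA: "map fst X \<in> lists A"
    using chain_val(1)[OF ch(1)] F0 val_1 unfolding S'(2) fst_f by simp
  have va_c: "val (curve F a) \<in> carrier G" unfolding va using XA by (rule word_val_closed)
  have QA: "map fst Q \<in> lists A"
    using chain_val(1)[OF ch(2) va_c] unfolding S'(3) fst_f .
  have vb_c: "val (curve F b) \<in> carrier G"
    using chain_val(2)[OF ch(2) va_c] chain_val(1)[OF ch(2) va_c] va_c by simp
  have YA: "map fst Y \<in> lists A"
    using chain_val(1)[OF ch(3) vb_c] unfolding S'(4) fst_f .
  interpret cell_gluing G A K C \<Delta> F S H val lev B X' Q' Y' N a b B'
  proof
    show "S = X' @ Q' @ Y'" "arc_chain \<Delta> F 0 X' a" "arc_chain \<Delta> F a Q' b" "arc_chain \<Delta> F b Y' 1"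
      "Q' \<noteq> []" "N \<noteq> []" "map fst N \<in> lists A" "B \<le> B'"
      using S' ch Qne ne NA \<open>B \<le> B'\<close> by blast+
    show "word_val G (map fst N) = word_val G (map (label \<Delta> \<circ> fst) Q')"
      using val_eq unfolding S'(3) fst_f .
    show "length N + length Q' \<le> 2 * K + 2" using short Q'len by simp
    show "reach \<Delta> (curve F a) (snd (N ! 0))"
    proof (rule reach_mono[OF ra])
      show "(if X = [] then 0 else snd (hd Q)) \<le> snd (N ! 0)" using b0 ne(2) by (auto simp: hd_conv_nth)
    qed
    show "snd q \<le> B'" if "q \<in> set N" for q using bB that .
    show "(\<exists>n. reach \<Delta> (curve F a) n \<and> n + k \<le> snd (N ! k)) \<or>
      (\<exists>n. reach \<Delta> (curve F b) n \<and> n + (length N - k) \<le> snd (N ! k))" if k: "0 < k" "k < length N" for k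
    proof -
      have "N ! k \<in> set (tl N)"
        using k by (cases N) (auto simp: nth_Cons split: nat.splits)
      from b1[OF this] show ?thesis
      proof
        assume "(if X = [] then 0 else snd (hd Q)) + length N \<le> snd (N ! k)"
        then show ?thesis using k ra by (intro disjI1 exI[of _ "if X = [] then 0 else snd (hd Q)"]) auto
      next
        assume "(if Y = [] then 0 else snd (hd Y)) + length N \<le> snd (N ! k)"
        then show ?thesis using k rb by (intro disjI2 exI[of _ "if Y = [] then 0 else snd (hd Y)"]) auto
      qed
    qed
    show "B' + 1 \<le> C * d + C" if "wlen (val (curve F a)) \<le> d + (2 * K + 2)" for d
      using low that unfolding va .
  qed
  have "rel_equiv (short_relators G A K) (map fst Q) (map fst N)"
    by (rule rel_equiv_short_swap[OF QA NA val_eq[symmetric]]) (use short Q'len in simp)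
  then have "rel_equiv (short_relators G A K) (map fst (X @ Q @ Y)) (map fst (X @ N @ Y))"
    using rel_equiv_context[OF _ XA YA] by simp
  then have "rel_equiv (short_relators G A K) (map fst (X @ N @ Y)) []"
    using eqv equivclp_sym equivclp_trans by metis
  moreover have "map (\<lambda>(e, \<gamma>, k). (label \<Delta>' e, k)) (X' @ newS @ Y') = X @ N @ Y"
    using boundary_labels' S' by simp
  ultimately show ?thesis unfolding filled_def using glued_tame_disc by blast
qed

text \<open>Upper bounds may be relaxed without changing the diagram. This is how a finished column
  passes from one level to the next.\<close>

lemma filled_weaken:
  assumes "filled K C B P" "map fst P = map fst P'" "list_all2 (\<le>) (map snd P) (map snd P')" "B \<le> B'"
  shows "filled K C B' P'"
proof -
  obtain \<Delta> F S H val lev where td: "tame_disc G A (short_relators G A K) C \<Delta> F S H val lev B"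
    and S: "map (\<lambda>(e, \<gamma>, k). (label \<Delta> e, k)) S = P"
    and eqv: "rel_equiv (short_relators G A K) (map fst P) []"
    using assms(1) unfolding filled_def by blast
  interpret tame_disc G A "short_relators G A K" C \<Delta> F S H val lev B by (rule td)
  have "\<exists>S'. arc_chain \<Delta> F \<alpha> S' \<beta> \<and> map (\<lambda>(e, \<gamma>, k). (label \<Delta> e, k)) S' = P'"
    if "arc_chain \<Delta> F \<alpha> S \<beta>" "map (\<lambda>(e, \<gamma>, k). (label \<Delta> e, k)) S = P" "map fst P = map fst P'"
      "list_all2 (\<le>) (map snd P) (map snd P')" for \<alpha> S \<beta> P P'
    using that
  proof (induction S arbitrary: \<alpha> P P')
    case Nil
    then show ?case by (intro exI[of _ "[]"]) auto
  next
    case (Cons s S)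
    obtain e \<gamma> k where s: "s = (e, \<gamma>, k)" by (cases s)
    obtain x k' P1 where P': "P' = (x, k') # P1" using Cons.prems(2,3) by (cases P') auto
    have *: "arc_chain \<Delta> F \<gamma> S \<beta>" "x = label \<Delta> e" "k \<le> k'"
      using Cons.prems by (auto simp: s P')
    obtain S' where S': "arc_chain \<Delta> F \<gamma> S' \<beta>" "map (\<lambda>(e, \<gamma>, k). (label \<Delta> e, k)) S' = P1"
      using Cons.IH[OF *(1) refl, of P1] Cons.prems by (auto simp: s P')
    have "arc_chain \<Delta> F \<alpha> ((e, \<gamma>, k') # S') \<beta>"
      using Cons.prems(1) S'(1) reach_mono[OF _ *(3)] by (auto simp: s)
    then show ?case using S'(2) *(2) by (intro exI[of _ "(e, \<gamma>, k') # S'"]) (simp add: P')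
  qed
  from this[OF chain S assms(2,3)] obtain S' where S': "arc_chain \<Delta> F 0 S' 1"
    "map (\<lambda>(e, \<gamma>, k). (label \<Delta> e, k)) S' = P'" by blast
  have "tame_disc G A (short_relators G A K) C \<Delta> F S' H val lev B'"
  proof
    show "lev z \<le> B'" if "z \<in> region F" for z using lev_le[OF that] assms(4) by simp
  qed (fact radial planar supp base label_A label_rev face_R S'(1) val_1 val_closed val_edge lev_cell
      H_cont H_region H_0 H_1 H_base H_skel H_lev)+
  then show ?thesis unfolding filled_def using S'(2) eqv assms(2) by metis
qed

lemma filled_tame:
  assumes "filled K C B P"
  shows "\<exists>\<Delta> \<Psi>. van_kampen_diagram G A (short_relators G A K) (map fst P) \<Delta> \<and> van_kampen_homotopy \<Delta> \<Psi> \<and>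
     tame_along \<Delta> \<Psi> (intrinsic_dist \<Delta>) (\<lambda>x. real C * x + real C) \<and>
     tame_along \<Delta> \<Psi> (extrinsic_dist G A (short_relators G A K) \<Delta>) (\<lambda>x. real C * x + real C)"
proof -
  obtain \<Delta> F S H val lev where td: "tame_disc G A (short_relators G A K) C \<Delta> F S H val lev B"
    and S: "map (\<lambda>(e, \<gamma>, k). (label \<Delta> e, k)) S = P"
    using assms unfolding filled_def by blast
  interpret tame_disc G A "short_relators G A K" C \<Delta> F S H val lev B by (rule td)
  have "map (label \<Delta> \<circ> fst) S = map fst P" unfolding S[symmetric] by (simp add: case_prod_unfold o_def)
  then show ?thesis using van_kampen homotopy tame by blast
qed

end

section \<open>Sweeping through the normal forms\<close>

lemma (in group) word_path_nth:
  "g \<in> carrier G \<Longrightarrow> set w \<subseteq> carrier G \<Longrightarrow> j < length w \<Longrightarrow>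
    fst (word_path G g w ! j) = g \<otimes> word_val G (take j w)"
proof (induction w arbitrary: g j)
  case (Cons a w)
  have "word_val G (take i w) \<in> carrier G" for i
  proof -
    have "set u \<subseteq> carrier G \<Longrightarrow> word_val G u \<in> carrier G" for u by (induction u) auto
    then show ?thesis using Cons.prems(2) set_take_subset[of i w] by (meson order_trans set_subset_Cons)
  qed
  then show ?case using Cons by (cases j) (auto simp: m_assoc)
qed simp

text \<open>In the sweep the bound of a letter depends on its level alone, so a whole word is
  annotated with one number.\<close>

definition ann :: "nat \<Rightarrow> 'a list \<Rightarrow> ('a \<times> nat) list" where
  "ann b w = map (\<lambda>a. (a, b)) w"

lemma ann_simps [simp]:
  "ann b [] = []" "ann b (a # w) = (a, b) # ann b w" "ann b (u @ v) = ann b u @ ann b v"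
  "map fst (ann b w) = w" "length (ann b w) = length w" "ann b w = [] \<longleftrightarrow> w = []"
  by (simp_all add: ann_def o_def)

lemma in_ann: "q \<in> set (ann b w) \<Longrightarrow> snd q = b"
  by (auto simp: ann_def)

lemma hd_ann: "w \<noteq> [] \<Longrightarrow> snd (hd (ann b w)) = b"
  by (cases w) auto

lemma in_tl_ann: "q \<in> set (tl (ann b w)) \<Longrightarrow> snd q = b"
  by (cases w) (auto dest: in_ann)

lemma snd_ann: "map snd (ann b w) = replicate (length w) b"
  by (simp add: ann_def map_replicate_const o_def)

locale combed_group = marked_group G A for G :: "('g, 'b) monoid_scheme" (structure) and A +
  fixes N :: "'g list set" and K l l' :: nat
  assumes nfs: "normal_forms G A N" and simple: "y \<in> N \<Longrightarrow> simple_word G A y"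
    and K_pos: "1 \<le> K" and ft: "fellow_traveler G A N K"
    and quasi_geodesic: "y1 @ y2 \<in> N \<Longrightarrow> length y1 \<le> l * wlen (word_val G y1) + l'"
begin

text \<open>The constant serves \<open>low_bound\<close>. There \<open>K + 2\<close> consists of
  \<open>K + 1\<close> from \<open>active_bound\<close> and 1 for a borrowed letter; with the
  \<open>2 * K + 2\<close> for the corners of a cell this gives
  \<open>i \<le> l * (d + 3 * K + 4) + l'\<close>. The cells of that step have level
  \<open>(K + 2) * (i + 3)\<close>, which is turned into a bound linear in \<open>d\<close>.\<close>

definition C :: nat where "C = (K + 2) * (l * (3 * K + 5) + l' + 3) + 1"

abbreviation "fil \<equiv> filled K C"

lemma low_bound:
  assumes "i \<le> l * (x + K + 2) + l'" "x \<le> d + (2 * K + 2)"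
  shows "(K + 2) * (i + 3) + 1 \<le> C * d + C"
proof -
  have "l * (x + K + 2) \<le> l * (d + (3 * K + 4))" using assms(2) by (intro mult_le_mono2) simp
  then have "i \<le> l * (d + (3 * K + 4)) + l'" using assms(1) by linarith
  then have "i + 3 \<le> l * d + l * (3 * K + 4) + l' + 3" by (simp only: distrib_left)
  also have "\<dots> \<le> (l * (3 * K + 5) + l' + 3) * d + (l * (3 * K + 5) + l' + 3)"
  proof -
    have "l * d \<le> (l * (3 * K + 5) + l' + 3) * d" by (intro mult_le_mono1) (simp add: algebra_simps)
    moreover have "l * (3 * K + 4) \<le> l * (3 * K + 5)" by simp
    ultimately show ?thesis by linarith
  qed
  finally have "(K + 2) * (i + 3) \<le> (K + 2) * ((l * (3 * K + 5) + l' + 3) * d + (l * (3 * K + 5) + l' + 3))"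
    by (rule mult_le_mono2)
  then show ?thesis unfolding C_def by (simp add: algebra_simps)
qed

lemma C_ge: "(K + 2) * 3 + 1 \<le> C"
  unfolding C_def by (intro add_mono mult_le_mono2) auto

definition nf :: "'g \<Rightarrow> 'g list" where
  "nf g = (THE y. y \<in> N \<and> word_val G y = g)"

lemma nf: "g \<in> carrier G \<Longrightarrow> nf g \<in> N \<and> word_val G (nf g) = g"
proof -
  assume "g \<in> carrier G"
  then have "\<exists>!y. y \<in> N \<and> word_val G y = g" using nfs unfolding normal_forms_def by blast
  then show ?thesis unfolding nf_def by (rule theI')
qed

lemma nf_lists: "g \<in> carrier G \<Longrightarrow> nf g \<in> lists A"
  using nf nfs by (auto simp: normal_forms_def)

text \<open>A nonempty prefix representing the identity would make the path of a simple word return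
  to its starting vertex.\<close>

lemma nf_prefix_ne_one:
  assumes "y \<in> N" "1 \<le> j" "j \<le> length y"
  shows "word_val G (take j y) \<noteq> \<one>"
proof
  assume e: "word_val G (take j y) = \<one>"
  have yA: "set y \<subseteq> carrier G" using assms(1) nfs A_closed by (auto simp: normal_forms_def)
  let ?vs = "map fst (word_path G \<one> y) @ [word_val G y]"
  have len: "length (word_path G g w) = length w" for g and w :: "'g list" by (induction w arbitrary: g) auto
  have "src (cayley_graph G A) = fst" by (simp add: cayley_complex_def)
  then have d: "distinct ?vs" using simple[OF assms(1)] by (simp add: simple_word_def Let_def)
  have at: "?vs ! i = word_val G (take i y)" if "i \<le> length y" for i
  proof (cases "i < length y")
    case True
    have "word_val G (take i y) \<in> carrier G"
    proof -
      have "set u \<subseteq> carrier G \<Longrightarrow> word_val G u \<in> carrier G" for u by (induction u) auto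
      then show ?thesis using yA set_take_subset[of i y] by (meson order_trans)
    qed
    then show ?thesis using True word_path_nth[of \<one> y i] yA by (simp add: nth_append len)
  next
    case False
    then have "i = length y" using that by simp
    then show ?thesis by (simp add: nth_append len)
  qed
  have "?vs ! 0 = ?vs ! j" using at[of 0] at[of j] assms(3) e by simp
  moreover have "0 < length ?vs" "j < length ?vs" using assms(3) len by simp_all
  ultimately have "0 = j" using nth_eq_iff_index_eq[OF d] by blast
  then show False using assms(2) by simp
qed

lemma nf_one: "nf \<one> = []"
proof (rule ccontr)
  assume "nf \<one> \<noteq> []"
  then have "1 \<le> length (nf \<one>)" by (cases "nf \<one>") auto
  then show False using nf_prefix_ne_one[of "nf \<one>" "length (nf \<one>)"] nf[of \<one>] by simp
qed

end

section \<open>Columns and levels for a fixed word\<close>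

locale sweep = combed_group G A N K l l' for G :: "('g, 'b) monoid_scheme" (structure) and A N K l l' +
  fixes w :: "'g list"
  assumes wA: "w \<in> lists A" and w_val: "word_val G w = \<one>" and w_ne: "w \<noteq> []"
begin

definition "y k = nf (word_val G (take k w))"
definition "u k i = word_val G (take i (y k))"
definition "M k = max (length (y k)) (length (y (Suc k)))"
definition "\<beta> k i = (if i < length (y k) then [y k ! i] else [])"
text \<open>Column \<open>k\<close> lies between the normal forms of the prefixes of lengths
  \<open>k\<close> and \<open>k + 1\<close>. Once both have ended, the rung is fixed to be the
  letter of \<open>w\<close> instead of a chosen geodesic, so that finished columns no longer change
  and high levels spell \<open>w\<close>.\<close>

definition "rung k i = (if M k \<le> i then [w ! k]
  else SOME r. r \<in> lists A \<and> u k i \<otimes> word_val G r = u (Suc k) i \<and> length r = cayley_dist G A (u k i) (u (Suc k) i))"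
definition "n = length w"

lemma y: "y k \<in> N" "word_val G (y k) = word_val G (take k w)" "y k \<in> lists A"
  using nf[of "word_val G (take k w)"] nf_lists[of "word_val G (take k w)"] wA
  unfolding y_def by auto

lemma u_closed [simp]: "u k i \<in> carrier G"
  unfolding u_def using y(3) by (intro word_val_closed lists_take_drop)

lemma u_0 [simp]: "u k 0 = \<one>" by (simp add: u_def)

lemma u_end: "length (y k) \<le> i \<Longrightarrow> u k i = word_val G (take k w)"
  using y(2) by (simp add: u_def)

lemma w_nth: "k < n \<Longrightarrow> w ! k \<in> A"
  using wA by (auto simp: n_def in_lists_conv_set)

lemma take_Suc_w: "k < n \<Longrightarrow> word_val G (take (Suc k) w) = word_val G (take k w) \<otimes> w ! k"
proof -
  assume k: "k < n"
  have "take (Suc k) w = take k w @ [w ! k]" using k by (simp add: n_def take_Suc_conv_app_nth)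
  then show ?thesis
    using word_val_append[of "take k w" "[w ! k]"] wA w_nth[OF k] A_closed by (simp add: lists.intros)
qed

lemma y_ends: "y 0 = []" "y n = []"
  using nf_one w_val by (simp_all add: y_def n_def)

lemma u_ends: "u 0 i = \<one>" "u n i = \<one>"
  by (simp_all add: u_def y_ends)

text \<open>The fellow traveler property lists the shorter normal form first; if that is
  \<open>y (Suc k)\<close>, it is applied with the inverse letter. Index 0 is not covered by it, but
  there both paths are at the identity.\<close>

lemma u_dist:
  assumes k: "k < n" and i: "i < M k"
  shows "cayley_dist G A (u k i) (u (Suc k) i) \<le> K"
proof (cases "i = 0")
  case True
  have "cayley_dist G A \<one> \<one> = 0" using wlen_one unfolding wlen_def .
  then have "cayley_dist G A (u k 0) (u (Suc k) 0) = 0" unfolding u_0 .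
  then show ?thesis using \<open>i = 0\<close> by (metis zero_le)
next
  case False
  have *: "cayley_dist G A (word_val G (take i p)) (word_val G (take i q)) \<le> K"
    if pq: "p \<in> N" "q \<in> N" "a \<in> A" "word_val G p \<otimes> a = word_val G q" "length p \<le> length q" "i < length q" for p q a
  proof -
    have "(\<forall>i. 1 \<le> i \<and> i \<le> length p \<longrightarrow> cayley_dist G A (word_val G (take i p)) (word_val G (take i q)) \<le> K) \<and>
          (\<forall>i. length p < i \<and> i \<le> length q \<longrightarrow> cayley_dist G A (word_val G p) (word_val G (take i q)) \<le> K)"
      by (rule mp[OF bspec[OF bspec[OF bspec[OF ft[unfolded fellow_traveler_def] pq(1)] pq(2)] pq(3)]
              conjI[OF pq(4,5)]])
    then show ?thesis using False pq(6) by (cases "i \<le> length p") auto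
  qed
  have a: "word_val G (y k) \<otimes> w ! k = word_val G (y (Suc k))" using take_Suc_w[OF k] y(2) by simp
  have wk: "w ! k \<in> A" "w ! k \<in> carrier G" using w_nth[OF k] A_closed by auto
  have yk: "word_val G (y k) \<in> carrier G" using y(3) by (rule word_val_closed)
  show ?thesis
  proof (cases "length (y k) \<le> length (y (Suc k))")
    case True
    then show ?thesis using *[OF y(1) y(1) wk(1) a True] i by (simp add: M_def u_def)
  next
    case 2: False
    have "word_val G (y (Suc k)) \<otimes> inv (w ! k) = word_val G (y k)"
      using a[symmetric] wk yk by (simp add: m_assoc)
    then show ?thesis using *[OF y(1) y(1) A_inv[OF wk(1)]] 2 i cayley_dist_commute[OF u_closed u_closed, of k i "Suc k" i]
      by (simp add: M_def u_def)
  qed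
qed

lemma rung:
  assumes k: "k < n"
  shows "rung k i \<in> lists A" "u k i \<otimes> word_val G (rung k i) = u (Suc k) i" "length (rung k i) \<le> K"
    "i < M k \<Longrightarrow> length (rung k i) = cayley_dist G A (u k i) (u (Suc k) i)"
proof -
  have "rung k i \<in> lists A \<and> u k i \<otimes> word_val G (rung k i) = u (Suc k) i \<and> length (rung k i) \<le> K \<and>
    (i < M k \<longrightarrow> length (rung k i) = cayley_dist G A (u k i) (u (Suc k) i))"
  proof (cases "M k \<le> i")
    case True
    then have r: "rung k i = [w ! k]" and "length (y k) \<le> i" "length (y (Suc k)) \<le> i" by (auto simp: rung_def M_def)
    then have "u k i = word_val G (take k w)" "u (Suc k) i = word_val G (take (Suc k) w)" using u_end by auto
    then show ?thesis using take_Suc_w[OF k] r True w_nth[OF k] A_closed K_pos by simp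
  next
    case False
    have "\<exists>r. r \<in> lists A \<and> u k i \<otimes> word_val G r = u (Suc k) i \<and> length r = cayley_dist G A (u k i) (u (Suc k) i)"
      using geodesic_exists[OF u_closed u_closed] by blast
    from someI_ex[OF this] show ?thesis using False u_dist[OF k, of i] by (simp add: rung_def)
  qed
  then show "rung k i \<in> lists A" "u k i \<otimes> word_val G (rung k i) = u (Suc k) i" "length (rung k i) \<le> K"
    "i < M k \<Longrightarrow> length (rung k i) = cayley_dist G A (u k i) (u (Suc k) i)" by blast+
qed

text \<open>Two consecutive empty normal forms would force a letter of \<open>w\<close> to be the
  identity.\<close>

lemma M_pos: "k < n \<Longrightarrow> 0 < M k"
proof (rule ccontr)
  assume k: "k < n" and "\<not> 0 < M k"
  then have "y k = []" "y (Suc k) = []" by (auto simp: M_def)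
  then have "\<one> \<otimes> w ! k = \<one>" using take_Suc_w[OF k] y(2)[of k] y(2)[of "Suc k"] by simp
  then show False using w_nth[OF k] A_closed one_notin_A by (metis l_one)
qed

text \<open>Every column is active at level 0, so its rung is a geodesic from the identity to
  itself. The word of level 0 is therefore empty.\<close>

lemma rung_0: "k < n \<Longrightarrow> rung k 0 = []"
  using rung(4)[of k 0] M_pos[of k] wlen_one by (simp add: wlen_def)

lemma \<beta>: "\<beta> k i \<in> lists A" "u k i \<otimes> word_val G (\<beta> k i) = u k (Suc i)" "length (\<beta> k i) \<le> 1"
proof -
  show A: "\<beta> k i \<in> lists A" using y(3)[of k] by (auto simp: \<beta>_def in_lists_conv_set)
  have "take (Suc i) (y k) = take i (y k) @ \<beta> k i"
    by (simp add: \<beta>_def take_Suc_conv_app_nth)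
  then show "u k i \<otimes> word_val G (\<beta> k i) = u k (Suc i)"
    using word_val_append[OF lists_take_drop(1)[OF y(3)] A] by (simp add: u_def)
qed (simp add: \<beta>_def)

lemma u_eq_one: "u k i = \<one> \<Longrightarrow> 1 \<le> i \<Longrightarrow> y k = []"
proof (rule ccontr)
  assume *: "u k i = \<one>" "1 \<le> i" "y k \<noteq> []"
  let ?j = "min i (length (y k))"
  have "take i (y k) = take ?j (y k)" by (simp add: min_def)
  moreover have "1 \<le> ?j" using * by (cases "y k") auto
  ultimately show False using nf_prefix_ne_one[OF y(1), of ?j k] *(1) by (simp add: u_def)
qed

definition "pre i k = concat (map (\<lambda>j. rung j (Suc i)) [0..<k])"
definition "suf i k = concat (map (\<lambda>j. rung j i) [k..<n])"

lemma pre: "k \<le> n \<Longrightarrow> pre i k \<in> lists A \<and> word_val G (pre i k) = u k (Suc i)"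
proof (induction k)
  case 0
  then show ?case by (simp add: pre_def u_ends)
next
  case (Suc k)
  then have "pre i (Suc k) = pre i k @ rung k (Suc i)" by (simp add: pre_def)
  then show ?case using Suc rung[of k "Suc i"] by (simp add: word_val_append del: in_lists_conv_set)
qed

lemma suf_Suc: "k < n \<Longrightarrow> suf i k = rung k i @ suf i (Suc k)"
  by (simp add: suf_def upt_conv_Cons)

lemma pre_suf: "pre i n = suf (Suc i) 0"
  by (simp add: pre_def suf_def)

text \<open>
  While column \<open>k\<close> is processed, the word runs along level \<open>i + 1\<close> up to column \<open>k\<close>, goes down one
  edge of the normal form, and continues along level \<open>i\<close>.
\<close>

definition "mixed i k = pre i k @ inv_word (\<beta> k i) @ suf i k"

text \<open>If the word were empty, so would be all its rungs. Following them inwards from the two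
  outermost columns, where everything is the identity, yields trivial vertices in every column; at
  positive levels this makes all normal forms empty, against \<open>M_pos\<close>.\<close>

lemma mixed_ne:
  assumes "1 \<le> i" "k \<le> n"
  shows "mixed i k \<noteq> []"
proof
  assume "mixed i k = []"
  then have e: "rung j (Suc i) = []" if "j < k" for j using that by (auto simp: mixed_def pre_def)
  have e': "rung j i = []" if "k \<le> j" "j < n" for j
    using \<open>mixed i k = []\<close> that by (auto simp: mixed_def suf_def)
  have up: "u j (Suc i) = \<one>" if "j \<le> k" for j
    using that
  proof (induction j)
    case (Suc j)
    then show ?case using rung(2)[of j "Suc i"] e[of j] assms(2) by simp
  qed (simp add: u_ends)
  have down: "u (n - j) i = \<one>" if "j \<le> n - k" for j
    using that
  proof (induction j)
    case (Suc j)
    then have "Suc (n - Suc j) = n - j" "n - Suc j < n" "k \<le> n - Suc j" by auto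
    then show ?case using rung(2)[of "n - Suc j" i] e'[of "n - Suc j"] Suc by simp
  qed (simp add: u_ends)
  have y0: "y j = []" if "j \<le> n" for j
  proof (cases "j \<le> k")
    case True then show ?thesis using u_eq_one[of j "Suc i"] up by simp
  next
    case False
    then show ?thesis using u_eq_one[of j i] down[of "n - j"] that assms by simp
  qed
  have "0 < n" using w_ne by (simp add: n_def)
  then show False using M_pos[of 0] y0[of 0] y0[of 1] by (simp add: M_def)
qed


lemma word_val_back:
  "x \<in> carrier G \<Longrightarrow> p \<in> lists A \<Longrightarrow> x \<otimes> word_val G p = z \<Longrightarrow> z \<otimes> word_val G (inv_word p) = x"
proof -
  assume x: "x \<in> carrier G" and p: "p \<in> lists A" and z: "x \<otimes> word_val G p = z"
  then show ?thesis using word_val_closed[OF p] by (simp add: z[symmetric] word_val_inv_word[OF p] m_assoc)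
qed

text \<open>One of the two normal forms is longer than \<open>i\<close>. Quasi-geodesicity of its
  prefix of length \<open>i\<close> bounds \<open>i\<close> by the word distance of a vertex that is
  at most \<open>K + 1\<close> away from \<open>u k (Suc i)\<close>.\<close>

lemma active_bound:
  assumes k: "k < n" and i: "i < M k"
  shows "i \<le> l * (wlen (u k (Suc i)) + K + 1) + l'"
proof -
  have qg: "i \<le> l * wlen (u j i) + l'" if "i < length (y j)" for j
    using quasi_geodesic[of "take i (y j)" "drop i (y j)"] y(1) that by (simp add: u_def)
  have 1: "wlen (u k i) \<le> wlen (u k (Suc i)) + 1"
    using wlen_le_mult[of "u k i" "\<beta> k i"] \<beta>[of k i] by simp
  have 2: "wlen (u (Suc k) i) \<le> wlen (u k i) + K"
    using wlen_mult_le[of "u k i" "rung k i"] rung[OF k, of i] by simp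
  obtain j where "i < length (y j)" "wlen (u j i) \<le> wlen (u k (Suc i)) + K + 1"
  proof (cases "i < length (y k)")
    case True then show ?thesis using that[of k] 1 by simp
  next
    case False
    then have "i < length (y (Suc k))" using i by (auto simp: M_def)
    then show ?thesis using that[of "Suc k"] 1 2 by simp
  qed
  then show ?thesis using qg[of j] mult_le_mono2[of "wlen (u j i)" "wlen (u k (Suc i)) + K + 1" l] by linarith
qed

lemma list_all2_le_refl: "list_all2 (\<le>) xs (xs :: nat list)"
  by (simp add: list_all2_refl)

lemma list_all2_le_ann: "b \<le> b' \<Longrightarrow> list_all2 (\<le>) (map snd (ann b v)) (map snd (ann b' v))"
  by (simp add: snd_ann list_all2_conv_all_nth)

text \<open>The cell replaces \<open>s\<close> (down, then along the old rung) by \<open>s'\<close>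
  (along the new rung, then down), each of at most \<open>K + 1\<close> letters. In general new
  vertices are reached backwards from the right end, whose bound is still at most \<open>b\<close>;
  even with a borrowed letter this adds at most \<open>K + 2\<close>, so \<open>b'\<close> suffices.
  Counting from the left end, already on the new level, would accumulate over the columns.\<close>

lemma sweep_column:
  assumes k: "k < n" and D: "D \<in> lists A" "word_val G D = \<one>"
    and b: "b = (K + 2) * (i + 1)" "b' = b + (K + 2)" and B: "B \<le> B'" "B' = (K + 2) * (i + 3)"
    and fl: "fil B (ann b' (D @ pre i k @ inv_word (\<beta> k i)) @ ann b (suf i k))"
    and ne: "D @ mixed i k \<noteq> []" "D @ mixed i (Suc k) \<noteq> []"
  shows "fil B' (ann b' (D @ pre i (Suc k) @ inv_word (\<beta> (Suc k) i)) @ ann b (suf i (Suc k)))"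
proof -
  define X where "X = D @ pre i k"
  define Y where "Y = suf i (Suc k)"
  define s where "s = inv_word (\<beta> k i) @ rung k i"
  define s' where "s' = rung k (Suc i) @ inv_word (\<beta> (Suc k) i)"
  define Q where "Q = ann b' (inv_word (\<beta> k i)) @ ann b (rung k i)"
  have start: "fil B (ann b' X @ Q @ ann b Y)"
    using fl suf_Suc[OF k] by (simp add: X_def Y_def Q_def)
  have fin: "D @ pre i (Suc k) @ inv_word (\<beta> (Suc k) i) = X @ s'"
    by (simp add: X_def s'_def pre_def)
  have b'B: "b' \<le> B'" "b \<le> b'" "K + 2 \<le> b" using b B by (simp_all add: algebra_simps)
  have sA: "s \<in> lists A" and s'A: "s' \<in> lists A"
    using rung(1)[OF k] \<beta>(1) by (simp_all add: s_def s'_def del: in_lists_conv_set)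
  have XA: "X \<in> lists A" and Xv: "word_val G X = u k (Suc i)"
    using D pre[of k i] k by (simp_all add: X_def word_val_append del: in_lists_conv_set)
  have len: "length (rung k i) \<le> K" "length (rung k (Suc i)) \<le> K" "length (\<beta> k i) \<le> 1" "length (\<beta> (Suc k) i) \<le> 1"
    using rung(3)[OF k] \<beta>(3) by blast+
  then have lens: "length s \<le> K + 1" "length s' \<le> K + 1" by (simp_all add: s_def s'_def)
  have val_eq: "word_val G s = word_val G s'"
  proof -
    have "u k (Suc i) \<otimes> word_val G s = u (Suc k) i"
    proof -
      have "u k (Suc i) \<otimes> word_val G (inv_word (\<beta> k i)) = u k i"
        by (rule word_val_back[OF u_closed \<beta>(1,2)])
      then show ?thesis
        using rung(1,2)[OF k, of i] \<beta>(1)[of k i] word_val_closed[OF inv_word_in_lists[OF \<beta>(1)[of k i]]]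
        by (simp add: s_def word_val_append m_assoc[symmetric] del: in_lists_conv_set)
    qed
    moreover have "u k (Suc i) \<otimes> word_val G s' = u (Suc k) i"
    proof -
      have "u (Suc k) (Suc i) \<otimes> word_val G (inv_word (\<beta> (Suc k) i)) = u (Suc k) i"
        by (rule word_val_back[OF u_closed \<beta>(1,2)])
      then show ?thesis
        using rung(1,2)[OF k, of "Suc i"] \<beta>(1)[of "Suc k" i]
          word_val_closed[OF inv_word_in_lists[OF \<beta>(1)[of "Suc k" i]]]
        by (simp add: s'_def word_val_append m_assoc[symmetric] del: in_lists_conv_set)
    qed
    ultimately show ?thesis using sA s'A by (metis Units_eq Units_l_cancel u_closed word_val_closed)
  qed
  have hdY: "(if ann b Y = [] then 0 else snd (hd (ann b Y))) \<le> b" by (simp add: hd_ann)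
  have fstQ: "map fst Q = s" "length Q = length s" by (simp_all add: Q_def s_def)
  have hdQ: "Q \<noteq> [] \<Longrightarrow> snd (hd Q) \<le> b'"
    using b'B by (cases "inv_word (\<beta> k i) = []") (auto simp: Q_def hd_append hd_ann)
  have "fil B' (ann b' X @ ann b' s' @ ann b Y)"
  proof (cases "M k \<le> i")
    \<comment> \<open>A finished column receives no cell: its letter merely passes to the bound of
      the next level.\<close>
    case True
    then have "\<beta> k i = []" "\<beta> (Suc k) i = []" "rung k i = [w ! k]" "rung k (Suc i) = [w ! k]"
      by (auto simp: M_def \<beta>_def rung_def)
    then have "Q = ann b s'" by (simp add: Q_def s'_def)
    moreover have "list_all2 (\<le>) (map snd (ann b' X @ ann b s' @ ann b Y)) (map snd (ann b' X @ ann b' s' @ ann b Y))"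
      unfolding map_append by (intro list_all2_appendI list_all2_le_refl list_all2_le_ann b'B(2))
    ultimately show ?thesis
      by (intro filled_weaken[OF start _ _ B(1)]) simp_all
  next
    case False
    have act: "i \<le> l * (wlen (word_val G X) + K + 1) + l'" using active_bound[OF k] False Xv by simp
    have low: "B' + 1 \<le> C * d + C"
      if "wlen (word_val G X) \<le> wlen (word_val G Z) + 1" "wlen (word_val G Z) \<le> d + (2 * K + 2)" for Z d
    proof -
      have "l * (wlen (word_val G X) + K + 1) \<le> l * (wlen (word_val G Z) + K + 2)"
        using that(1) by (intro mult_le_mono2) simp
      then have "i \<le> l * (wlen (word_val G Z) + K + 2) + l'" using act by linarith
      then show ?thesis using low_bound that(2) B(2) by simp
    qed
    \<comment> \<open>Borrowing the last letter of \<open>X\<close> moves the left end of the cell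
      back by one letter, which costs at most 1 in the word distance.\<close>
    have lowX0: "wlen (word_val G X) \<le> wlen (word_val G X0) + 1" if "X = X0 @ [c]" for X0 c
    proof -
      have "X0 \<in> lists A" "[c] \<in> lists A" using XA that by auto
      then show ?thesis using wlen_mult_le[of "word_val G X0" "[c]"] that
        by (simp add: word_val_append del: in_lists_conv_set word_val_Cons)
    qed
    have mix: "D @ mixed i k = X @ s @ Y" "D @ mixed i (Suc k) = X @ s' @ Y"
      using suf_Suc[OF k] by (simp_all add: mixed_def X_def Y_def s_def s'_def pre_def)
    consider (both) "s \<noteq> []" "s' \<noteq> []" | (none) "s = []" "s' = []"
      | (one) X0 c where "s = [] \<or> s' = []" "s @ s' \<noteq> []" "X = X0 @ [c]"
      | (first) c Y0 where "s = [] \<or> s' = []" "s @ s' \<noteq> []" "X = []" "Y = c # Y0"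
    proof -
      show ?thesis
      proof (cases "s = [] \<longleftrightarrow> s' = []")
        case True then show ?thesis using both none by blast
      next
        case mixed: False
        show ?thesis
        proof (cases X rule: rev_cases)
          case Nil
          \<comment> \<open>With \<open>X\<close> and one of \<open>s\<close>, \<open>s'\<close>
            empty, the whole word before or after this column is just \<open>Y\<close>, and it is
            nonempty by hypothesis.\<close>
          then have "Y \<noteq> []" using ne mixed unfolding mix by auto
          then obtain c Y0 where "Y = c # Y0" by (cases Y) auto
          then show ?thesis using first Nil mixed by auto
        next
          case (snoc X0 c)
          then show ?thesis using one mixed by auto
        qed
      qed
    qed
    then show ?thesis
    proof cases
      case both
      show ?thesis
      proof (rule filled_step[OF start])
        show "Q \<noteq> []" using both(1) by (simp add: Q_def s_def)
        then show "ann b' X = [] \<or> snd (hd Q) \<le> snd (hd (ann b' s'))" using both hdQ by (simp add: hd_ann)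
        show "(if ann b' X = [] then 0 else snd (hd Q)) + length (ann b' s') \<le> snd q \<or>
          (if ann b Y = [] then 0 else snd (hd (ann b Y))) + length (ann b' s') \<le> snd q"
          if "q \<in> set (tl (ann b' s'))" for q
          using hdY lens(2) in_tl_ann[OF that] b(2) by (intro disjI2) simp
        show "snd q \<le> B'" if "q \<in> set (ann b' s')" for q using in_ann[OF that] b'B by simp
        show "B' + 1 \<le> C * d + C" if "wlen (word_val G (map fst (ann b' X))) \<le> d + (2 * K + 2)" for d
          using low[of X d] that by simp
      qed (use both s'A val_eq lens fstQ B in auto)
    next
      case none
      then have "Q = []" by (simp add: Q_def s_def)
      then show ?thesis using none start filled_weaken[OF start refl list_all2_le_refl B(1)] by simp
    next
      case one
      have st: "fil B (ann b' X0 @ ((c, b') # Q) @ ann b Y)" using start one by simp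
      have "fil B' (ann b' X0 @ ann b' (c # s') @ ann b Y)"
      proof (rule filled_step[OF st])
        have "c \<in> A" using XA one by auto
        then show "map fst (ann b' (c # s')) \<in> lists A" using s'A by auto
        show "word_val G (map fst (ann b' (c # s'))) = word_val G (map fst ((c, b') # Q))"
          using val_eq fstQ by simp
        \<comment> \<open>One side was empty before borrowing, so the perimeter is at most
          \<open>K + 3\<close>, which is within \<open>2 * K + 2\<close> because
          \<open>K \<ge> 1\<close>.\<close>
        show "length (ann b' (c # s')) + length ((c, b') # Q) \<le> 2 * K + 2"
          using one(1) lens fstQ(2) K_pos by (elim disjE) simp_all
        show "(if ann b' X0 = [] then 0 else snd (hd ((c, b') # Q))) + length (ann b' (c # s')) \<le> snd q \<or>
          (if ann b Y = [] then 0 else snd (hd (ann b Y))) + length (ann b' (c # s')) \<le> snd q"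
          if "q \<in> set (tl (ann b' (c # s')))" for q
          using hdY lens(2) in_tl_ann[OF that] b(2) by (intro disjI2) simp
        show "snd q \<le> B'" if "q \<in> set (ann b' (c # s'))" for q using in_ann[OF that] b'B by simp
        show "B' + 1 \<le> C * d + C" if "wlen (word_val G (map fst (ann b' X0))) \<le> d + (2 * K + 2)" for d
          using low[OF lowX0[OF one(3)], of d] that by simp
      qed (use B in auto)
      then show ?thesis using one by simp
    next
      case first
      have st: "fil B ([] @ (Q @ [(c, b)]) @ ann b Y0)" using start first by simp
      have cA: "c \<in> A"
      proof -
        have "set (suf i (Suc k)) \<subseteq> A" using rung(1) by (auto simp: suf_def in_lists_conv_set)
        then show ?thesis using first(4) by (auto simp: Y_def)
      qed
      have "fil B' ([] @ (ann b' s' @ [(c, b)]) @ ann b Y0)"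
      proof (rule filled_step[OF st])
        show "map fst (ann b' s' @ [(c, b)]) \<in> lists A" using s'A cA by auto
        show "word_val G (map fst (ann b' s' @ [(c, b)])) = word_val G (map fst (Q @ [(c, b)]))"
          using val_eq fstQ word_val_append[OF sA, of "[c]"] word_val_append[OF s'A, of "[c]"] cA by auto
        show "length (ann b' s' @ [(c, b)]) + length (Q @ [(c, b)]) \<le> 2 * K + 2"
          using first(1) lens fstQ(2) K_pos by (elim disjE) simp_all
        \<comment> \<open>Here the left end is the base point, and the new vertices are reached from
          it. The borrowed letter keeps the bound \<open>b\<close>, which is at least
          \<open>K + 2\<close> and so covers the length of the new side.\<close>
        show "(if [] = [] then 0 else snd (hd (Q @ [(c, b)]))) + length (ann b' s' @ [(c, b)]) \<le> snd q \<or>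
          (if ann b Y0 = [] then 0 else snd (hd (ann b Y0))) + length (ann b' s' @ [(c, b)]) \<le> snd q"
          if "q \<in> set (tl (ann b' s' @ [(c, b)]))" for q
        proof -
          have "q \<in> set (ann b' s' @ [(c, b)])" using that by (cases s') auto
          then have "b \<le> snd q" using b'B by (auto dest: in_ann)
          then show ?thesis using lens(2) b'B(3) by (intro disjI1) simp
        qed
        show "snd q \<le> B'" if "q \<in> set (ann b' s' @ [(c, b)])" for q using that b'B by (auto dest: in_ann)
        show "B' + 1 \<le> C * d + C" if "wlen (word_val G (map fst [])) \<le> d + (2 * K + 2)" for d
          using low[of X d] that first by simp
      qed (use B in auto)
      then show ?thesis using first by simp
    qed
  qed
  then show ?thesis unfolding fin Y_def by simp
qed

text \<open>\<open>D\<close> is a prefix of trivial value carried unchanged through all columns. It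
  is the cancelling pair when level 0 is swept and empty afterwards.\<close>

lemma sweep_level:
  assumes D: "D \<in> lists A" "word_val G D = \<one>"
    and fl: "fil ((K + 2) * (i + 2)) (ann ((K + 2) * (i + 1)) (D @ suf i 0))"
    and ne: "\<And>k. k \<le> n \<Longrightarrow> D @ mixed i k \<noteq> []"
  shows "fil ((K + 2) * (i + 3)) (ann ((K + 2) * (i + 2)) (D @ suf (Suc i) 0))"
proof -
  define b where "b = (K + 2) * (i + 1)"
  define b' where "b' = b + (K + 2)"
  define B' where "B' = (K + 2) * (i + 3)"
  have "fil B' (ann b' (D @ pre i k @ inv_word (\<beta> k i)) @ ann b (suf i k))" if "k \<le> n" for k
    using that
  proof (induction k)
    case 0
    have z: "\<beta> 0 i = []" "pre i 0 = []" by (simp_all add: \<beta>_def y_ends pre_def)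
    have "fil B' (ann b' D @ ann b (suf i 0))"
    proof (rule filled_weaken[OF fl])
      show "list_all2 (\<le>) (map snd (ann ((K + 2) * (i + 1)) (D @ suf i 0))) (map snd (ann b' D @ ann b (suf i 0)))"
        unfolding b_def[symmetric] ann_simps(3) map_append
        by (intro list_all2_appendI list_all2_le_ann list_all2_le_refl) (simp add: b'_def)
      show "(K + 2) * (i + 2) \<le> B'" unfolding B'_def by (intro mult_le_mono2) simp
    qed simp
    then show ?case by (simp add: z)
  next
    case (Suc k)
    then show ?case using sweep_column[OF _ D b_def b'_def order_refl B'_def, of k] ne[of k] ne[of "Suc k"] by simp
  qed
  from this[of n] have "fil B' (ann b' (D @ pre i n @ inv_word (\<beta> n i)) @ ann b (suf i n))" by simp
  moreover have "\<beta> n i = []" "suf i n = []" by (simp_all add: \<beta>_def y_ends suf_def)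
  moreover have "b' = (K + 2) * (i + 2)" by (simp add: b_def b'_def)
  ultimately show ?thesis using pre_suf by (simp add: B'_def)
qed

lemma suf_in_lists: "suf i k \<in> lists A"
  using rung(1) by (auto simp: suf_def in_lists_conv_set)

lemma filled_level: "1 \<le> i \<Longrightarrow> fil ((K + 2) * (i + 2)) (ann ((K + 2) * (i + 1)) (suf i 0))"
proof (induction i rule: dec_induct)
  case base
  \<comment> \<open>The word of level 0 is empty and bounds no disc, so the sweep starts from the
    bigon of a cancelling pair; any letter would do.\<close>
  define c where "c = w ! 0"
  have c: "c \<in> A" "c \<in> carrier G" using w_nth[of 0] w_ne A_closed by (auto simp: c_def n_def)
  let ?D = "[c, inv c]"
  have D: "?D \<in> lists A" "word_val G ?D = \<one>" using c A_inv by auto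
  have C2: "2 \<le> C" using C_ge by simp
  have s0: "suf 0 0 = []" by (simp add: suf_def rung_0)
  have "fil ((K + 2) * (0 + 2)) (ann ((K + 2) * (0 + 1)) (?D @ suf 0 0))"
    by (rule filled_weaken[OF filled_start[OF c(1) C2]]) (auto simp: s0)
  then have "fil ((K + 2) * (0 + 3)) (ann ((K + 2) * (0 + 2)) (?D @ suf (Suc 0) 0))"
    by (rule sweep_level[OF D]) simp
  then have f1: "fil ((K + 2) * 3) (ann ((K + 2) * 2) (?D @ suf 1 0))" by (simp only: add_0 One_nat_def)
  have "suf 1 0 \<noteq> []"
    using mixed_ne[of 1 0] by (simp add: mixed_def pre_def \<beta>_def y_ends)
  then obtain v W where vW: "suf 1 0 = v # W" by (cases "suf 1 0") auto
  have v: "v \<in> A" using suf_in_lists[of 1 0] vW by simp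
  let ?b = "(K + 2) * 2"
  \<comment> \<open>At level 1 the pair is removed again by one cell of perimeter 4, glued along the
    pair together with the letter after it.\<close>
  have "fil ((K + 2) * 3) ([] @ [(v, ?b)] @ ann ?b W)"
  proof (rule filled_step)
    show "fil ((K + 2) * 3) ([] @ [(c, ?b), (inv c, ?b), (v, ?b)] @ ann ?b W)" using f1 vW by simp
    show "word_val G (map fst [(v, ?b)]) = word_val G (map fst [(c, ?b), (inv c, ?b), (v, ?b)])"
      using c v A_closed by (simp add: m_assoc[symmetric])
    show "(K + 2) * 3 + 1 \<le> C * d + C" for d using C_ge by (simp add: trans_le_add2)
  qed (use v K_pos in auto)
  moreover have "(1::nat) + 2 = 3" "(1::nat) + 1 = 2" by simp_all
  ultimately show ?case unfolding vW by (simp only: append_Nil append_Cons ann_simps)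
next
  case (step i)
  have "fil ((K + 2) * (i + 3)) (ann ((K + 2) * (i + 2)) ([] @ suf (Suc i) 0))"
    by (rule sweep_level) (use mixed_ne[OF step(1)] step(3) in simp_all)
  moreover have "Suc i + 2 = i + 3" "Suc i + 1 = i + 2" by simp_all
  ultimately show ?case by (simp only: append_Nil)
qed

lemma filled_word: "\<exists>B b. fil B (ann b w)"
proof -
  \<comment> \<open>A level beyond the length of every normal form, so that all columns are
    finished; the successor makes it positive, as \<open>filled_level\<close> requires.\<close>
  define i where "i = Suc (\<Sum>k\<le>n. length (y k))"
  have yl: "length (y k) \<le> i" if "k \<le> n" for k
  proof -
    have "length (y k) \<le> (\<Sum>k\<le>n. length (y k))" using that by (intro member_le_sum) auto
    then show ?thesis by (simp add: i_def)
  qed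
  have "rung j i = [w ! j]" if "j < n" for j
    using yl[of j] yl[of "Suc j"] that by (simp add: rung_def M_def)
  then have "suf i 0 = concat (map (\<lambda>j. [w ! j]) [0..<n])"
    unfolding suf_def by (intro arg_cong[of _ _ concat] map_cong) auto
  also have "\<dots> = map (\<lambda>j. w ! j) [0..<n]" by (induction n) auto
  also have "\<dots> = w" by (simp add: n_def map_nth)
  finally have "suf i 0 = w" .
  then show ?thesis using filled_level[of i] by (auto simp: i_def)
qed

end

theorem corollary6p3:
  fixes G :: "('g, 'b) monoid_scheme" and A :: "'g set" and N :: "'g list set" and K :: nat
  assumes "group G"
    and "finite A" and "symmetric_generating_set G A"
    and "normal_forms G A N"
    and "\<forall>y\<in>N. simple_word G A y"
    and "quasi_geodesic_language G A N"
    and "K \<ge> 1" and "fellow_traveler G A N K"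
  shows "(\<exists>f. linear_function f \<and> intrinsic_tame_filling G A (short_relators G A K) f) \<and>
         (\<exists>f. linear_function f \<and> extrinsic_tame_filling G A (short_relators G A K) f)"
proof -
  interpret group G by (rule assms(1))
  interpret marked_group G A by unfold_locales (rule assms(3))
  obtain l l' :: real where ll: "1 \<le> l" "1 \<le> l'" "\<And>y1 y2 y3. y1 @ y2 @ y3 \<in> N \<Longrightarrow>
      real (length y2) \<le> l * real (cayley_dist G A \<one>\<^bsub>G\<^esub> (word_val G y2)) + l'"
    using assms(6) unfolding quasi_geodesic_language_def by blast
  \<comment> \<open>The quasi-geodesic constants are rounded up to natural numbers, and the estimate
    is specialised to prefixes.\<close>
  interpret combed_group G A N K "nat \<lceil>l\<rceil>" "nat \<lceil>l'\<rceil>"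
  proof
    fix y1 y2 assume "y1 @ y2 \<in> N"
    then have "real (length y1) \<le> l * real (wlen (word_val G y1)) + l'"
      using ll(3)[of "[]" y1 y2] by (simp add: wlen_def)
    also have "\<dots> \<le> real (nat \<lceil>l\<rceil>) * real (wlen (word_val G y1)) + real (nat \<lceil>l'\<rceil>)"
      by (intro add_mono mult_right_mono) (simp_all add: real_nat_ceiling_ge)
    finally show "length y1 \<le> nat \<lceil>l\<rceil> * wlen (word_val G y1) + nat \<lceil>l'\<rceil>"
      by (simp flip: of_nat_mult of_nat_add)
  qed (use assms in auto)
  let ?f = "\<lambda>x. real C * x + real C" and ?R = "short_relators G A K"
  have fw: "\<exists>B P. fil B P \<and> map fst P = w" if "w \<in> lists A" "word_val G w = \<one>\<^bsub>G\<^esub>" "w \<noteq> []" for w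
  proof -
    interpret sweep G A N K "nat \<lceil>l\<rceil>" "nat \<lceil>l'\<rceil>" w by unfold_locales (use that in auto)
    obtain B b where "fil B (ann b w)" using filled_word by blast
    then show ?thesis by (intro exI[of _ B] exI[of _ "ann b w"]) simp
  qed
  \<comment> \<open>The sweep that produces the diagrams also reduces every nonempty trivial word to
    the empty word, so the presentation comes with it.\<close>
  have fp: "finite_presentation G A ?R"
  proof (rule finite_presentation_short_relators[OF assms(2)])
    fix w assume w: "w \<in> lists A" "word_val G w = \<one>\<^bsub>G\<^esub>"
    show "rel_equiv ?R w []"
    proof (cases "w = []")
      case False
      then obtain B P where "fil B P" "map fst P = w" using fw[OF w] by blast
      then show ?thesis unfolding filled_def by blast
    qed simp
  qed
  have diagram: "\<exists>\<Delta> \<Psi>. van_kampen_diagram G A ?R w \<Delta> \<and> van_kampen_homotopy \<Delta> \<Psi> \<and>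
     tame_along \<Delta> \<Psi> (intrinsic_dist \<Delta>) ?f \<and> tame_along \<Delta> \<Psi> (extrinsic_dist G A ?R \<Delta>) ?f"
    if w: "w \<in> lists A" "word_val G w = \<one>\<^bsub>G\<^esub>" for w
  proof (cases "w = []")
    case True
    then show ?thesis using point_van_kampen point_filling by blast
  next
    case False
    then obtain B P where "fil B P" "map fst P = w" using fw[OF w] by blast
    then show ?thesis using filled_tame by blast
  qed
  have lin: "linear_function ?f" unfolding linear_function_def by blast
  have fil: "filling_function ?f"
    unfolding filling_function_def
  proof
    show "?f ` quarter_nats \<subseteq> quarter_nats"
    proof
      fix x assume "x \<in> ?f ` quarter_nats"
      then obtain t where t: "t \<in> quarter_nats" "x = real C * t + real C" by blast
      then obtain m :: nat where "t = real m / 4" unfolding quarter_nats_def by blast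
      with t(2) have "x = real (C * m + 4 * C) / 4" by simp
      then show "x \<in> quarter_nats" unfolding quarter_nats_def by blast
    qed
    show "mono_on quarter_nats ?f" by (intro mono_onI) (simp add: mult_left_mono)
  qed
  have "intrinsic_tame_filling G A ?R ?f" "extrinsic_tame_filling G A ?R ?f"
    unfolding intrinsic_tame_filling_def extrinsic_tame_filling_def using fp fil diagram by blast+
  then show ?thesis using lin by blast
qed

end
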